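(* Let $\mathcal G$ be an equilateral metric graph (all edges of length $1$) that satisfies the growth condition for equilateral graphs stated in the context. Let $X_{\mathrm c}\in\{L^p(\mathcal G)\ (1\le p<\infty),\,C_0(\mathcal G),\,BUC(\mathcal G)\}$ and let $X_{\mathrm d}$ be the corresponding discrete space. Then the spectrum of $-\Delta_{X_{\mathrm c}}$ on $X_{\mathrm c}$ away from the point spectrum $\sigma_p(-\Delta_{X_{\mathrm c}})$ and the Dirichlet spectrum $\sigma(-\Delta^D)$ coincides with $$\big\{\lambda\notin\sigma_p(-\Delta_{X_{\mathrm c}})\cup\sigma(-\Delta^D):\ c_\lambda(1)\in\sigma(P_{X_{\mathrm d}})\big\},\qquad c_\lambda(1)=\cos\sqrt\lambda .$$
   Context: **Metric graph.** $\mathcal G$ is the metric graph over a countable, oriented, connected graph with vertex set $\mathcal V$ and edge set $\mathcal E$, without self-loops, uniformly locally finite: writing $\mathcal E_{\mathsf v}$ for the set of edges incident to $\mathsf v$, $\sup_{\mathsf v}|\mathcal E_{\mathsf v}|<\infty$. Every edge $\mathsf e$ has an initial vertex $i(\mathsf e)$ and a terminal vertex $t(\mathsf e)$ and is identified with $(0,1)$ ($0\leftrightarrow i(\mathsf e)$, $1\leftrightarrow t(\mathsf e)$). $\mathcal G$ carries the natural path metric; $B_r(x)$ is the ball of radius $r$ around $x$. Each edge has a conductivity $c(\mathsf e)>0$, and $c(\mathsf v):=\sum_{\mathsf e\in\mathcal E_{\mathsf v}}c(\mathsf e)$. **Growth condition (equilateral graphs).** For every $\varepsilon>0$ there is $C_\varepsilon>0$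 such that for all $\mathsf e\in\mathcal E$ and all $r>0$, with $x=i(\mathsf e)$, the sum of $c(\mathsf e')$ over all edges $\mathsf e'$ fully contained in $B_r(x)$ is at most $C_\varepsilon e^{\varepsilon r}c(\mathsf e)$. **Spaces.** $L^p(\mathcal G)$: with respect to the measure whose restriction to $\mathsf e$ is $c(\mathsf e)$ times Lebesgue measure; $\ell^p(\mathcal V)$: with norm $(\sum_{\mathsf v}|z(\mathsf v)|^pc(\mathsf v))^{1/p}$; $C_0(\mathcal G)$, $BUC(\mathcal G)$ (bounded uniformly continuous functions), $c_0(\mathcal V)$, $\ell^\infty(\mathcal V)$: unweighted sup-norm. Correspondence $X_{\mathrm c}\leftrightarrow X_{\mathrm d}$: $C_0(\mathcal G)\leftrightarrow c_0(\mathcal V)$, $L^p(\mathcal G)\leftrightarrow\ell^p(\mathcal V)$, $BUC(\mathcal G)\leftrightarrow\ell^\infty(\mathcal V)$. **Operators.** $(\Delta_{X_{\mathrm c}}u)_{\mathsf e}=u_{\mathsf e}''$ with domain $\{u\in X_{\mathrm c}:(u''_{\mathsf e})_{\mathsf e}\in X_{\mathrm c},\ u\in C(\mathcal G),\ \sum_{\mathsf e\in\mathcal E_{\mathsf v}}\frac{\partial u_{\mathsf e}}{\partial n_{\mathsf e}}(\mathsf v)=0\ \forall\mathsf v\}$, where $\frac{\partial u_{\mathsf e}}{\partial n_{\mathsf e}}(\mathsf v)=c(\mathsf e)u_{\mathsf e}'(0^+)$ if $\mathsf v=i(\mathsf e)$ and $-c(\mathsf e)u_{\mathsf e}'(1^-)$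 if $\mathsf v=t(\mathsf e)$, and $C(\mathcal G)$ denotes continuous functions (in particular at vertices). $\Delta^D$ is the second derivative on $[0,1]$ with Dirichlet conditions $f(0)=f(1)=0$, so $\sigma(-\Delta^D)=\{k^2\pi^2:k\in\mathbb N\}$. $c_\lambda(t)=\cos(\sqrt\lambda t)$. $P_{X_{\mathrm d}}$ acts on $X_{\mathrm d}$ by $(P_{X_{\mathrm d}}z)(\mathsf v)=\sum_{\mathsf e\in\mathcal E_{\mathsf v}}\frac{c(\mathsf e)}{c(\mathsf v)}z(\mathsf v_{\mathsf e})$, where $\mathsf v_{\mathsf e}$ is the endpoint of $\mathsf e$ other than $\mathsf v$. $\sigma_p$ denotes the set of eigenvalues. *)

theory Defs
  imports "HOL-Analysis.Analysis" "Graph_Theory.Digraph_Component"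
begin

section \<open>Spectra of unbounded operators\<close>

text \<open>
  A Banach space of (classes of) complex functions is given by a carrier \<open>X\<close> of representatives
  together with a seminorm \<open>N\<close>; the Banach space meant is \<open>X\<close> modulo \<open>{u. N u = 0}\<close>, so that
  \<open>N (u - v) = 0\<close> is equality. This quotient matters for \<open>L\<^sup>p\<close> (equality almost everywhere) and
  makes values outside the underlying set irrelevant.
  An unbounded operator \<open>T\<close> is given by its graph, i.e. by pairs \<open>(u, g)\<close> of representatives with
  \<open>T u = g\<close> modulo null elements; the first components form the domain.
\<close>

type_synonym 'a fspace = "('a \<Rightarrow> complex) set \<times> (('a \<Rightarrow> complex) \<Rightarrow> real)"
type_synonym 'a oper = "(('a \<Rightarrow> complex) \<times> ('a \<Rightarrow> complex)) set"

definition neg_oper :: "'a oper \<Rightarrow> 'a oper" where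
  "neg_oper T = {(u, \<lambda>x. - g x) | u g. (u, g) \<in> T}"

definition resolvent_set :: "'a fspace \<Rightarrow> 'a oper \<Rightarrow> complex set" where
  "resolvent_set E T = (case E of (X, N) \<Rightarrow> {\<mu>.
     \<comment> \<open>\<open>\<mu> - T\<close> is injective, surjective, and its inverse is bounded\<close>
     (\<forall>(u, g)\<in>T. N (\<lambda>x. \<mu> * u x - g x) = 0 \<longrightarrow> N u = 0) \<and>
     (\<forall>f\<in>X. \<exists>(u, g)\<in>T. N (\<lambda>x. (\<mu> * u x - g x) - f x) = 0) \<and>
     (\<exists>C. \<forall>(u, g)\<in>T. N u \<le> C * N (\<lambda>x. \<mu> * u x - g x))})"

definition spectrum :: "'a fspace \<Rightarrow> 'a oper \<Rightarrow> complex set" where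
  "spectrum E T = - resolvent_set E T"

definition point_spectrum :: "'a fspace \<Rightarrow> 'a oper \<Rightarrow> complex set" where
  "point_spectrum E T = (case E of (X, N) \<Rightarrow>
     {\<mu>. \<exists>(u, g)\<in>T. N u \<noteq> 0 \<and> N (\<lambda>x. \<mu> * u x - g x) = 0})"

definition sup_norm :: "'a set \<Rightarrow> ('a \<Rightarrow> complex) \<Rightarrow> real" where
  "sup_norm S u = (SUP x\<in>S. cmod (u x))"

text \<open>
  \<open>w\<close> is differentiable on the open unit interval, its derivative is locally absolutely continuous
  there, and \<open>w'' = g\<close> almost everywhere (everywhere, if \<open>g\<close> is continuous).
\<close>
definition has_second_deriv :: "(real \<Rightarrow> complex) \<Rightarrow> (real \<Rightarrow> complex) \<Rightarrow> bool" where
  "has_second_deriv w g \<longleftrightarrow>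
     (\<forall>t\<in>{0<..<1}. w differentiable (at t)) \<and>
     (\<forall>s t. 0 < s \<longrightarrow> s \<le> t \<longrightarrow> t < 1 \<longrightarrow>
        g absolutely_integrable_on {s..t} \<and>
        vector_derivative w (at t) - vector_derivative w (at s) = integral {s..t} g)"

definition Lp_interval :: "real \<Rightarrow> (real \<Rightarrow> complex) \<Rightarrow> bool" where
  "Lp_interval p w \<longleftrightarrow>
     set_borel_measurable lebesgue {0<..<1} w \<and>
     set_integrable lebesgue {0<..<1} (\<lambda>t. cmod (w t) powr p)"

definition Lp_integral :: "real \<Rightarrow> (real \<Rightarrow> complex) \<Rightarrow> real" where
  "Lp_integral p w = (LINT t:{0<..<1}|lebesgue. cmod (w t) powr p)"

text \<open>The Dirichlet Laplacian, realised on \<open>L\<^sup>2(0,1)\<close>.\<close>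

definition L2_interval_space :: "real fspace" where
  "L2_interval_space = (Collect (Lp_interval 2), \<lambda>w. sqrt (Lp_integral 2 w))"

definition dirichlet_laplacian :: "real oper" where
  "dirichlet_laplacian = {(w, g). Lp_interval 2 w \<and> Lp_interval 2 g \<and>
     continuous_on {0..1} w \<and> w 0 = 0 \<and> w 1 = 0 \<and> has_second_deriv w g}"


section \<open>Equilateral metric graphs\<close>

definition inc_arcs :: "('v, 'e) pre_digraph \<Rightarrow> 'v \<Rightarrow> 'e set" where
  "inc_arcs G v = in_arcs G v \<union> out_arcs G v"

text \<open>
  Parallel edges are allowed. The graph is required to have an edge, since otherwise the vertex
  weight \<open>c(v)\<close>, by which the transition operator divides, vanishes.
\<close>
locale equilateral_metric_graph = loopfree_digraph G
  for G :: "('v, 'e) pre_digraph" (structure) +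
  fixes c :: "'e \<Rightarrow> real"
  assumes countable_verts: "countable (verts G)"
    and countable_arcs: "countable (arcs G)"
    and connected: "Digraph_Component.connected G"
    and has_arc: "arcs G \<noteq> {}"
    and uniformly_locally_finite:
      "\<exists>K. \<forall>v\<in>verts G. finite (inc_arcs G v) \<and> card (inc_arcs G v) \<le> K"
    and conductivity_pos: "\<And>e. e \<in> arcs G \<Longrightarrow> 0 < c e"

datatype ('v, 'e) mg_point = Vert 'v | Inner 'e real

definition mg_points :: "('v, 'e) pre_digraph \<Rightarrow> ('v, 'e) mg_point set" where
  "mg_points G = Vert ` verts G \<union> {Inner e t | e t. e \<in> arcs G \<and> t \<in> {0<..<1}}"

definition edge_point :: "('v, 'e) pre_digraph \<Rightarrow> 'e \<Rightarrow> real \<Rightarrow> ('v, 'e) mg_point" where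
  "edge_point G e t =
     (if t \<le> 0 then Vert (tail G e) else if 1 \<le> t then Vert (head G e) else Inner e t)"

text \<open>\<open>mg_path G x y l\<close>: a path of length \<open>l\<close>, composed of segments of closed edges, joins \<open>x\<close> to \<open>y\<close>.\<close>
inductive mg_path ::
  "('v, 'e) pre_digraph \<Rightarrow> ('v, 'e) mg_point \<Rightarrow> ('v, 'e) mg_point \<Rightarrow> real \<Rightarrow> bool"
  for G where
  refl: "x \<in> mg_points G \<Longrightarrow> mg_path G x x 0"
| step: "mg_path G x (edge_point G e s) l \<Longrightarrow> e \<in> arcs G \<Longrightarrow> s \<in> {0..1} \<Longrightarrow> t \<in> {0..1} \<Longrightarrow>
    mg_path G x (edge_point G e t) (l + \<bar>s - t\<bar>)"

definition mg_dist :: "('v, 'e) pre_digraph \<Rightarrow> ('v, 'e) mg_point \<Rightarrow> ('v, 'e) mg_point \<Rightarrow> real" where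
  "mg_dist G x y =
     (if x \<in> mg_points G \<and> y \<in> mg_points G then Inf {l. mg_path G x y l} else 0)"

definition mg_metric :: "('v, 'e) pre_digraph \<Rightarrow> ('v, 'e) mg_point metric" where
  "mg_metric G = metric (mg_points G, mg_dist G)"

lemma edge_point_in_mg_points:
  assumes "wf_digraph G" "e \<in> arcs G"
  shows "edge_point G e t \<in> mg_points G"
  using assms by (auto simp: edge_point_def mg_points_def wf_digraph_def)

lemma mg_path_points:
  assumes "wf_digraph G" "mg_path G x y l"
  shows "x \<in> mg_points G \<and> y \<in> mg_points G \<and> 0 \<le> l"
  using assms(2) by induction (auto simp: edge_point_in_mg_points[OF assms(1)])

lemma mg_path_trans:
  assumes "mg_path G y z m" "mg_path G x y l"
  shows "mg_path G x z (l + m)"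
  using assms
proof induction
  case (step y e s m t)
  then show ?case using mg_path.step[of G x e s "l + m" t] by (simp add: add.assoc)
qed simp

lemma mg_path_sym:
  assumes "wf_digraph G" "mg_path G x y l"
  shows "mg_path G y x l"
  using assms(2)
proof induction
  case (refl x)
  then show ?case by (rule mg_path.refl)
next
  case (step x e s l t)
  have "mg_path G (edge_point G e t) (edge_point G e t) 0"
    by (intro mg_path.refl edge_point_in_mg_points assms step)
  from mg_path.step[OF this step(2,4,3)]
  have "mg_path G (edge_point G e t) (edge_point G e s) \<bar>t - s\<bar>" by simp
  from mg_path_trans[OF step.IH this] show ?case by (simp add: abs_minus_commute add.commute)
qed

context equilateral_metric_graph
begin

lemma mg_path_edge:
  assumes "e \<in> arcs G" "s \<in> {0..1}" "t \<in> {0..1}"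
  shows "mg_path G (edge_point G e s) (edge_point G e t) \<bar>s - t\<bar>"
proof -
  have "mg_path G (edge_point G e s) (edge_point G e s) 0"
    by (intro mg_path.refl edge_point_in_mg_points assms wf_digraph)
  from mg_path.step[OF this assms] show ?thesis by simp
qed

lemma mg_path_arc:
  assumes "e \<in> arcs G"
  shows "mg_path G (Vert (tail G e)) (Vert (head G e)) 1"
  using mg_path_edge[OF assms, of 0 1] by (simp add: edge_point_def)

lemma mg_path_Vert:
  assumes "v \<in> verts G" "w \<in> verts G"
  shows "\<exists>l. mg_path G (Vert v) (Vert w) l"
proof -
  have "(v, w) \<in> rtrancl_on (verts G) (arcs_ends (mk_symmetric G))"
    using connected assms unfolding Digraph_Component.connected_def strongly_connected_def
      reachable_def by (auto simp: mk_symmetric_def)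
  then show ?thesis
  proof induction
    case base
    have "Vert w \<in> mg_points G" using assms by (simp add: mg_points_def)
    from mg_path.refl[OF this] show ?case by blast
  next
    case (step y z)
    then obtain l where l: "mg_path G (Vert z) (Vert w) l" by blast
    obtain e where e: "e \<in> arcs G"
      "y = tail G e \<and> z = head G e \<or> y = head G e \<and> z = tail G e"
      using step(1) by (auto simp: mk_symmetric_def arcs_ends_def arc_to_ends_def)
    have "mg_path G (Vert y) (Vert z) 1"
      using e(2) mg_path_arc[OF e(1)] mg_path_sym[OF wf_digraph mg_path_arc[OF e(1)]] by auto
    from mg_path_trans[OF l this] show ?case by blast
  qed
qed

lemma mg_path_exists:
  assumes "x \<in> mg_points G" "y \<in> mg_points G"
  shows "\<exists>l. mg_path G x y l"
proof -
  have *: "\<exists>v\<in>verts G. \<exists>l. mg_path G (Vert v) x l" if x: "x \<in> mg_points G" for x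
  proof (cases x)
    case (Vert v)
    then show ?thesis using x mg_path.refl[OF x] by (auto simp: mg_points_def)
  next
    case (Inner e t)
    then have e: "e \<in> arcs G" "0 < t" "t < 1" using x by (auto simp: mg_points_def)
    have "mg_path G (Vert (tail G e)) x t"
      using mg_path_edge[of e 0 t] e Inner by (simp add: edge_point_def)
    then show ?thesis using tail_in_verts[OF e(1)] by blast
  qed
  obtain v l where v: "v \<in> verts G" "mg_path G (Vert v) x l" using *[OF assms(1)] by blast
  obtain w m where w: "w \<in> verts G" "mg_path G (Vert w) y m" using *[OF assms(2)] by blast
  obtain k where k: "mg_path G (Vert v) (Vert w) k" using mg_path_Vert v w by blast
  show ?thesis
    using mg_path_trans[OF w(2) mg_path_trans[OF k mg_path_sym[OF wf_digraph v(2)]]] by blast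
qed

lemma mg_dist_le:
  assumes "mg_path G x y l"
  shows "mg_dist G x y \<le> l"
  using assms mg_path_points[OF wf_digraph assms]
  by (auto simp: mg_dist_def intro!: cInf_lower bdd_belowI[of _ 0]
      dest: mg_path_points[OF wf_digraph])

lemma mg_dist_less:
  assumes "x \<in> mg_points G" "y \<in> mg_points G" "mg_dist G x y < r"
  obtains l where "mg_path G x y l" "l < r"
proof -
  have "{l. mg_path G x y l} \<noteq> {}" using mg_path_exists[OF assms(1,2)] by blast
  then have "\<exists>l\<in>{l. mg_path G x y l}. l < r"
    using assms by (intro cInf_lessD) (auto simp: mg_dist_def)
  then show ?thesis using that by blast
qed

text \<open>A function that is 1-Lipschitz along every edge is 1-Lipschitz for the path metric.\<close>
lemma mg_path_Lipschitz:
  assumes "mg_path G x y l"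
    and "\<And>e s t. e \<in> arcs G \<Longrightarrow> s \<in> {0..1} \<Longrightarrow> t \<in> {0..1} \<Longrightarrow>
      h (edge_point G e t) \<le> h (edge_point G e s) + \<bar>s - t\<bar>"
  shows "h y \<le> h x + (l::real)"
  using assms(1)
proof induction
  case (step x e s l t)
  then show ?case using assms(2)[of e s t] by simp
qed simp

lemma mg_dist_pos:
  assumes "x \<in> mg_points G" "y \<in> mg_points G" "x \<noteq> y"
  shows "0 < mg_dist G x y"
proof -
  obtain h :: "('v, 'e) mg_point \<Rightarrow> real" where h: "h x = 0" "h y > 0"
    and L: "\<And>e s t. e \<in> arcs G \<Longrightarrow> s \<in> {0..1} \<Longrightarrow> t \<in> {0..1} \<Longrightarrow>
      h (edge_point G e t) \<le> h (edge_point G e s) + \<bar>s - t\<bar>"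
  proof (cases x)
    case (Vert v)
    define h :: "('v, 'e) mg_point \<Rightarrow> real" where
      "h = (\<lambda>y. case y of Vert w \<Rightarrow> if w = v then 0 else 1
        | Inner e t \<Rightarrow> if tail G e = v then t else if head G e = v then 1 - t else 1)"
    have "h (edge_point G e t) \<le> h (edge_point G e s) + \<bar>s - t\<bar>"
      if "e \<in> arcs G" "s \<in> {0..1}" "t \<in> {0..1}" for e s t
      using that no_loops[OF that(1)] by (auto simp: h_def edge_point_def)
    moreover have "h x = 0" "h y > 0"
      using assms Vert by (auto simp: h_def mg_points_def split: mg_point.splits)
    ultimately show ?thesis using that by blast
  next
    case (Inner d r)
    then have dr: "d \<in> arcs G" "0 < r" "r < 1" using assms by (auto simp: mg_points_def)
    define h :: "('v, 'e) mg_point \<Rightarrow> real" where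
      "h = (\<lambda>y. case y of Vert w \<Rightarrow> min r (1 - r)
        | Inner e t \<Rightarrow> if e = d then min \<bar>t - r\<bar> (min r (1 - r)) else min r (1 - r))"
    have "h (edge_point G e t) \<le> h (edge_point G e s) + \<bar>s - t\<bar>"
      if "e \<in> arcs G" "s \<in> {0..1}" "t \<in> {0..1}" for e s t
      using that dr by (auto simp: h_def edge_point_def)
    moreover have "h x = 0" "h y > 0"
      using assms Inner dr by (auto simp: h_def mg_points_def split: mg_point.splits)
    ultimately show ?thesis using that by blast
  qed
  have "h y \<le> mg_dist G x y"
  proof (rule ccontr)
    assume "\<not> h y \<le> mg_dist G x y"
    then obtain l where l: "mg_path G x y l" "l < h y"
      using mg_dist_less[OF assms(1,2), of "h y"] by auto
    have "h y \<le> h x + l" using l(1) L by (rule mg_path_Lipschitz)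
    then show False using h l by simp
  qed
  then show ?thesis using h by simp
qed

lemma Metric_space_mg: "Metric_space (mg_points G) (mg_dist G)"
proof
  fix x y
  show "0 \<le> mg_dist G x y"
  proof (cases "x \<in> mg_points G \<and> y \<in> mg_points G")
    case True
    then have "{l. mg_path G x y l} \<noteq> {}" using mg_path_exists by blast
    then show ?thesis using True
      by (auto simp: mg_dist_def intro!: cInf_greatest dest: mg_path_points[OF wf_digraph])
  qed (auto simp: mg_dist_def)
  show "mg_dist G x y = mg_dist G y x"
  proof -
    have "mg_path G x y = mg_path G y x" using mg_path_sym[OF wf_digraph] by blast
    then show ?thesis by (simp add: mg_dist_def)
  qed
  assume xy: "x \<in> mg_points G" "y \<in> mg_points G"
  have "mg_dist G x x \<le> 0" by (intro mg_dist_le mg_path.refl xy)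
  moreover have "0 \<le> mg_dist G x x"
    using xy by (auto simp: mg_dist_def intro!: cInf_greatest mg_path.refl
        dest: mg_path_points[OF wf_digraph])
  ultimately show "(mg_dist G x y = 0) = (x = y)" using mg_dist_pos[OF xy] by (metis less_irrefl order_antisym)
next
  fix x y z
  assume xyz: "x \<in> mg_points G" "y \<in> mg_points G" "z \<in> mg_points G"
  show "mg_dist G x z \<le> mg_dist G x y + mg_dist G y z"
  proof (rule field_le_epsilon)
    fix \<epsilon> :: real assume "0 < \<epsilon>"
    then have *: "mg_dist G x y < mg_dist G x y + \<epsilon> / 2" "mg_dist G y z < mg_dist G y z + \<epsilon> / 2"
      by simp_all
    obtain l where l: "mg_path G x y l" "l < mg_dist G x y + \<epsilon> / 2"
      by (rule mg_dist_less[OF xyz(1,2) *(1)])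
    obtain m where m: "mg_path G y z m" "m < mg_dist G y z + \<epsilon> / 2"
      by (rule mg_dist_less[OF xyz(2,3) *(2)])
    show "mg_dist G x z \<le> mg_dist G x y + mg_dist G y z + \<epsilon>"
      using mg_dist_le[OF mg_path_trans[OF m(1) l(1)]] l(2) m(2) by linarith
  qed
qed

lemma mspace_mg_metric [simp]: "mspace (mg_metric G) = mg_points G"
  and mdist_mg_metric [simp]: "mdist (mg_metric G) = mg_dist G"
  using Metric_space_mg by (simp_all add: mg_metric_def Metric_space.mspace_metric
      Metric_space.mdist_metric)

end

definition vertex_weight :: "('v, 'e) pre_digraph \<Rightarrow> ('e \<Rightarrow> real) \<Rightarrow> 'v \<Rightarrow> real" where
  "vertex_weight G c v = (\<Sum>e\<in>inc_arcs G v. c e)"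

text \<open>By local finiteness only finitely many edges lie in a given ball.\<close>
definition growth_condition :: "('v, 'e) pre_digraph \<Rightarrow> ('e \<Rightarrow> real) \<Rightarrow> bool" where
  "growth_condition G c \<longleftrightarrow>
     (\<forall>\<epsilon>>0. \<exists>C>0. \<forall>e\<in>arcs G. \<forall>r>0.
        (\<Sum>e' | e' \<in> arcs G \<and> (\<forall>t\<in>{0<..<1}. mg_dist G (Vert (tail G e)) (Inner e' t) < r). c e')
          \<le> C * exp (\<epsilon> * r) * c e)"


section \<open>Function spaces\<close>

definition Lp_graph_space ::
  "('v, 'e) pre_digraph \<Rightarrow> ('e \<Rightarrow> real) \<Rightarrow> real \<Rightarrow> ('v, 'e) mg_point fspace" where
  "Lp_graph_space G c p =
    ({u. (\<forall>e\<in>arcs G. Lp_interval p (\<lambda>t. u (Inner e t))) \<and>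
         (\<lambda>e. c e * Lp_integral p (\<lambda>t. u (Inner e t))) summable_on arcs G},
     \<lambda>u. (\<Sum>\<^sub>\<infinity>e\<in>arcs G. c e * Lp_integral p (\<lambda>t. u (Inner e t))) powr (1 / p))"

definition lp_vertex_space ::
  "('v, 'e) pre_digraph \<Rightarrow> ('e \<Rightarrow> real) \<Rightarrow> real \<Rightarrow> 'v fspace" where
  "lp_vertex_space G c p =
    ({z. (\<lambda>v. cmod (z v) powr p * vertex_weight G c v) summable_on verts G},
     \<lambda>z. (\<Sum>\<^sub>\<infinity>v\<in>verts G. cmod (z v) powr p * vertex_weight G c v) powr (1 / p))"

definition continuous_on_graph :: "('v, 'e) pre_digraph \<Rightarrow> (('v, 'e) mg_point \<Rightarrow> complex) \<Rightarrow> bool"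
  where "continuous_on_graph G u \<longleftrightarrow> continuous_map (mtopology_of (mg_metric G)) euclidean u"

definition C0_graph_space :: "('v, 'e) pre_digraph \<Rightarrow> ('v, 'e) mg_point fspace" where
  "C0_graph_space G =
    ({u. continuous_on_graph G u \<and>
         (\<forall>\<epsilon>>0. \<exists>K. compactin (mtopology_of (mg_metric G)) K \<and>
            (\<forall>x\<in>mg_points G - K. cmod (u x) < \<epsilon>))},
     sup_norm (mg_points G))"

definition c0_vertex_space :: "('v, 'e) pre_digraph \<Rightarrow> 'v fspace" where
  "c0_vertex_space G =
    ({z. \<forall>\<epsilon>>0. finite {v \<in> verts G. \<epsilon> \<le> cmod (z v)}}, sup_norm (verts G))"

definition BUC_graph_space :: "('v, 'e) pre_digraph \<Rightarrow> ('v, 'e) mg_point fspace" where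
  "BUC_graph_space G =
    ({u. bounded (u ` mg_points G) \<and> uniformly_continuous_map (mg_metric G) euclidean_metric u},
     sup_norm (mg_points G))"

definition linf_vertex_space :: "('v, 'e) pre_digraph \<Rightarrow> 'v fspace" where
  "linf_vertex_space G = ({z. bounded (z ` verts G)}, sup_norm (verts G))"

definition corresponding_spaces ::
  "('v, 'e) pre_digraph \<Rightarrow> ('e \<Rightarrow> real) \<Rightarrow> (('v, 'e) mg_point fspace \<times> 'v fspace) set" where
  "corresponding_spaces G c =
     {(Lp_graph_space G c p, lp_vertex_space G c p) | p. 1 \<le> p} \<union>
     {(C0_graph_space G, c0_vertex_space G), (BUC_graph_space G, linf_vertex_space G)}"


section \<open>The Laplacian and the transition operator\<close>

text \<open>
  In the graph of the Laplacian below the one-sided limits exist, because \<open>u'\<close> is absolutely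
  continuous up to the endpoints of every edge. An edge incident to \<open>v\<close> has \<open>v\<close> as exactly one of
  its endpoints.
\<close>
definition normal_deriv ::
  "('v, 'e) pre_digraph \<Rightarrow> ('e \<Rightarrow> real) \<Rightarrow> (('v, 'e) mg_point \<Rightarrow> complex) \<Rightarrow> 'e \<Rightarrow> 'v \<Rightarrow> complex"
  where
  "normal_deriv G c u e v =
    (let u' = (\<lambda>t. vector_derivative (\<lambda>s. u (Inner e s)) (at t))
     in if v = tail G e then complex_of_real (c e) * Lim (at_right 0) u'
        else - complex_of_real (c e) * Lim (at_left 1) u')"

definition laplacian ::
  "('v, 'e) pre_digraph \<Rightarrow> ('e \<Rightarrow> real) \<Rightarrow> ('v, 'e) mg_point fspace \<Rightarrow> ('v, 'e) mg_point oper" where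
  "laplacian G c E = {(u, g). u \<in> fst E \<and> g \<in> fst E \<and>
     (\<forall>e\<in>arcs G. has_second_deriv (\<lambda>t. u (Inner e t)) (\<lambda>t. g (Inner e t))) \<and>
     continuous_on_graph G u \<and>
     (\<forall>v\<in>verts G. (\<Sum>e\<in>inc_arcs G v. normal_deriv G c u e v) = 0)}"

definition other_end :: "('v, 'e) pre_digraph \<Rightarrow> 'e \<Rightarrow> 'v \<Rightarrow> 'v" where
  "other_end G e v = (if v = tail G e then head G e else tail G e)"

definition transition_operator ::
  "('v, 'e) pre_digraph \<Rightarrow> ('e \<Rightarrow> real) \<Rightarrow> 'v fspace \<Rightarrow> 'v oper" where
  "transition_operator G c E =
     {(z, \<lambda>v. \<Sum>e\<in>inc_arcs G v. complex_of_real (c e / vertex_weight G c v) * z (other_end G e v))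
      | z. z \<in> fst E}"

text \<open>The choice of the square root is immaterial, as the cosine is even.\<close>
definition cos_fun :: "complex \<Rightarrow> real \<Rightarrow> complex" where
  "cos_fun \<mu> t = cos (csqrt \<mu> * complex_of_real t)"

end

theory Submission
  imports Defs
begin

text \<open>
  Write \<open>C\<close> and \<open>S\<close> for the solutions of \<open>w'' + \<mu> w = 0\<close> with \<open>C 0 = 1\<close>, \<open>C' 0 = 0\<close> and \<open>S 0 = 0\<close>,
  \<open>S' 0 = 1\<close>. The Dirichlet spectrum contains every \<open>\<mu>\<close> with \<open>S 1 = 0\<close>; off it, the solution of
  \<open>w'' + \<mu> w = f\<close> on an edge is determined by its boundary values, and the Kirchhoff conditions for
  \<open>u'' + \<mu> u = f\<close> turn into \<open>(C 1 - P) z = h\<close>, where \<open>z\<close> is the restriction of \<open>u\<close> to the vertices and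
  \<open>h\<close> depends on \<open>f\<close> only. Every \<open>h\<close> in the discrete space arises from some \<open>f\<close>, and all passages
  between \<open>(u, f)\<close> and \<open>(z, h)\<close> are bounded since they are local. Hence \<open>\<mu>\<close> is in the resolvent set of
  \<open>-\<Delta>\<close> if and only if \<open>C 1\<close> is in that of \<open>P\<close>.
\<close>

section \<open>The equation on an edge\<close>

text \<open>One argument has to serve both spaces whose elements have no point values and sup-norm
  spaces. The common currency is one number per edge: the \<open>L^1\<close> norm of the data goes
  in, a sup and a Lipschitz bound come out, and since all edges have length 1 the constants depend
  on \<mu> only. The delicate passage leads from \<open>u\<close> to its vertex values. It rests on
  duality: the homogeneous part of \<open>u\<close> is integrated against
  \<open>\<mu> w + w''\<close> for a fixed polynomial \<open>w\<close> vanishing at both ends, and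
  Green's identity leaves only the end values. The same polynomials have prescribed slopes at the
  ends and provide a bounded right inverse of \<open>f \<mapsto> h\<close>. The conductivities of
  the edges at a vertex need not be comparable, so \<open>P z\<close> and \<open>h\<close> at a
  vertex are bounded by \<open>c\<close>-weighted means over its edges. The norm bound then comes
  from convexity of \<open>x^p\<close>, or from the fact that some term is at least the
  mean.\<close>

definition sin_fun :: "complex \<Rightarrow> real \<Rightarrow> complex" where
  "sin_fun \<mu> t = (if \<mu> = 0 then complex_of_real t
    else sin (csqrt \<mu> * complex_of_real t) / csqrt \<mu>)"

lemma cos_fun_0 [simp]: "cos_fun \<mu> 0 = 1"
  and sin_fun_0 [simp]: "sin_fun \<mu> 0 = 0"
  by (simp_all add: cos_fun_def sin_fun_def)

text \<open>The chain rule brings out \<open>csqrt \<mu>\<close>, which is \<mu> divided by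
  \<open>csqrt \<mu>\<close>; for \<mu> = 0 both sides vanish.\<close>

lemma cos_fun_has_vector_derivative:
  "(cos_fun \<mu> has_vector_derivative - \<mu> * sin_fun \<mu> t) (at t within A)"
proof -
  have "((\<lambda>z. cos (csqrt \<mu> * z)) has_field_derivative
      - sin (csqrt \<mu> * of_real t) * csqrt \<mu>) (at (of_real t))"
    by (auto intro!: derivative_eq_intros)
  from has_vector_derivative_real_field[OF this]
  have "(cos_fun \<mu> has_vector_derivative - sin (csqrt \<mu> * of_real t) * csqrt \<mu>) (at t within A)"
    unfolding cos_fun_def .
  moreover have "- sin (csqrt \<mu> * of_real t) * csqrt \<mu> = - \<mu> * sin_fun \<mu> t"
  proof (cases "\<mu> = 0")
    case False
    have "\<mu> * sin (csqrt \<mu> * of_real t) / csqrt \<mu> = csqrt \<mu> ^ 2 * sin (csqrt \<mu> * of_real t) / csqrt \<mu>"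
      by simp
    also have "\<dots> = csqrt \<mu> * sin (csqrt \<mu> * of_real t)"
      using False by (simp add: power2_eq_square del: power2_csqrt)
    finally show ?thesis using False by (simp add: sin_fun_def mult.commute)
  qed simp
  ultimately show ?thesis by simp
qed

text \<open>The separate clause of \<open>sin_fun\<close> for \<mu> = 0 is the limit of the general
  one, which makes this formula uniform in \<mu>.\<close>

lemma sin_fun_has_vector_derivative:
  "(sin_fun \<mu> has_vector_derivative cos_fun \<mu> t) (at t within A)"
proof (cases "\<mu> = 0")
  case True
  have "((\<lambda>z. z) has_field_derivative 1) (at (complex_of_real t))" by simp
  from has_vector_derivative_real_field[OF this] show ?thesis
    using True by (simp add: sin_fun_def [abs_def] cos_fun_def)
next
  case False
  have "((\<lambda>z. sin (csqrt \<mu> * z) / csqrt \<mu>) has_field_derivative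
      cos (csqrt \<mu> * of_real t)) (at (of_real t))"
    using False by (auto intro!: derivative_eq_intros)
  from has_vector_derivative_real_field[OF this] show ?thesis
    using False unfolding cos_fun_def sin_fun_def by simp
qed

text \<open>The Wronskian \<open>C * S' - C' * S\<close> of the fundamental system, used below
  whenever coefficients with respect to \<open>C\<close> and \<open>S\<close> are
  eliminated.\<close>

lemma cos_fun_sin_fun_squared: "cos_fun \<mu> t * cos_fun \<mu> t + \<mu> * (sin_fun \<mu> t * sin_fun \<mu> t) = 1"
proof (cases "\<mu> = 0")
  case False
  have "\<mu> * (sin_fun \<mu> t * sin_fun \<mu> t) = (csqrt \<mu>)\<^sup>2 * (sin_fun \<mu> t)\<^sup>2"
    by (simp add: power2_eq_square[of "sin_fun \<mu> t"])
  also have "\<dots> = (sin (csqrt \<mu> * of_real t))\<^sup>2"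
    using False by (simp add: sin_fun_def power_divide del: power2_csqrt)
  finally show ?thesis
    by (simp add: cos_fun_def flip: power2_eq_square)
qed (simp add: cos_fun_def)

lemma continuous_on_cos_fun [continuous_intros]: "continuous_on A (cos_fun \<mu>)"
  and continuous_on_sin_fun [continuous_intros]: "continuous_on A (sin_fun \<mu>)"
  by (auto intro!: continuous_on_vector_derivative cos_fun_has_vector_derivative
      sin_fun_has_vector_derivative)

section \<open>The inhomogeneous equation on one edge with given end values\<close>

locale regular_value =
  fixes \<mu> :: complex
  assumes sin_nz: "sin_fun \<mu> 1 \<noteq> 0"
begin

abbreviation "C \<equiv> cos_fun \<mu>"
abbreviation "S \<equiv> sin_fun \<mu>"

lemmas CS_derivs = cos_fun_has_vector_derivative[of \<mu>] sin_fun_has_vector_derivative[of \<mu>]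

text \<open>
  The particular solution of \<open>w'' + \<mu> w = f\<close> is \<open>w t = (\<integral>r\<le>t. C (t - r) * F r)\<close> with \<open>F' = f\<close>, expanded
  by the addition formula. Integrating \<open>f\<close> first makes all integrands continuous, so that for
  merely integrable \<open>f\<close> the first derivative of \<open>w\<close> exists everywhere.
\<close>
definition prim :: "(real \<Rightarrow> complex) \<Rightarrow> real \<Rightarrow> complex" where
  "prim f t = integral {0..t} f"

definition int_cos :: "(real \<Rightarrow> complex) \<Rightarrow> real \<Rightarrow> complex" where
  "int_cos f t = integral {0..t} (\<lambda>r. C r * prim f r)"

definition int_sin :: "(real \<Rightarrow> complex) \<Rightarrow> real \<Rightarrow> complex" where
  "int_sin f t = integral {0..t} (\<lambda>r. S r * prim f r)"

definition part :: "(real \<Rightarrow> complex) \<Rightarrow> real \<Rightarrow> complex" where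
  "part f t = C t * int_cos f t + \<mu> * (S t * int_sin f t)"

text \<open>By \<open>S (t - r) = S t * C r - C t * S r\<close> the bracket is the integral of
  \<open>S (t - r) * F r\<close>, so this is the derivative of a convolution with kernel
  \<open>C\<close>: boundary term plus integral of the differentiated kernel.\<close>

definition part' :: "(real \<Rightarrow> complex) \<Rightarrow> real \<Rightarrow> complex" where
  "part' f t = prim f t - \<mu> * (S t * int_cos f t - C t * int_sin f t)"

text \<open>Since \<open>part f\<close> vanishes at 0, \<open>C\<close> carries the value at 0, and
  the coefficient of \<open>S\<close> is what the value \<open>b\<close> at 1 then forces. Here
  \<open>S 1\<close> has to be invertible.\<close>

definition edge_sol :: "(real \<Rightarrow> complex) \<Rightarrow> complex \<Rightarrow> complex \<Rightarrow> real \<Rightarrow> complex" where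
  "edge_sol f a b t = a * C t + ((b - C 1 * a - part f 1) / S 1) * S t + part f t"

definition edge_sol' :: "(real \<Rightarrow> complex) \<Rightarrow> complex \<Rightarrow> complex \<Rightarrow> real \<Rightarrow> complex" where
  "edge_sol' f a b t = - a * \<mu> * S t + ((b - C 1 * a - part f 1) / S 1) * C t + part' f t"

lemma part_0 [simp]: "part f 0 = 0" and part'_0 [simp]: "part' f 0 = 0"
  by (simp_all add: part_def part'_def int_cos_def int_sin_def prim_def)

lemma edge_sol_0 [simp]: "edge_sol f a b 0 = a"
  and edge_sol_1 [simp]: "edge_sol f a b 1 = b"
  using sin_nz by (simp_all add: edge_sol_def)

text \<open>The slope separates into an explicit contribution of the end values, which becomes the
  discrete operator, and the slope for zero end values, which is all that \<open>f\<close>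
  contributes to a Kirchhoff sum.\<close>

lemma edge_sol'_0: "edge_sol' f a b 0 = (b - C 1 * a) / S 1 + edge_sol' f 0 0 0"
  by (simp add: edge_sol'_def diff_divide_distrib)

lemma edge_sol'_1:
  "edge_sol' f a b 1 = (C 1 * b - a) / S 1 + edge_sol' f 0 0 1"
proof -
  \<comment> \<open>The Wronskian at 1 merges the two terms containing \<open>a\<close> into
    \<open>- a / S 1\<close>. The slope at 1 thus mirrors the one at 0, so the orientation of an
    edge drops out of the Kirchhoff sum.\<close>
  have "a = a * (C 1 * C 1 + \<mu> * (S 1 * S 1))" by (simp add: cos_fun_sin_fun_squared)
  then have "a / S 1 = a * C 1 * C 1 / S 1 + a * \<mu> * S 1"
    using sin_nz by (simp add: field_simps)
  then show ?thesis using sin_nz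
    by (simp add: edge_sol'_def diff_divide_distrib add_divide_distrib algebra_simps)
qed

context
  fixes f :: "real \<Rightarrow> complex"
  assumes f: "f absolutely_integrable_on {0..1}"
begin

lemma f_integrable: "f integrable_on {0..1}" "(\<lambda>t. cmod (f t)) integrable_on {0..1}"
  using f by (auto simp: absolutely_integrable_on_def)

lemma f_integrable_sub:
  assumes "0 \<le> s" "t \<le> 1"
  shows "f absolutely_integrable_on {s..t}" "f integrable_on {s..t}"
    "(\<lambda>t. cmod (f t)) integrable_on {s..t}"
proof -
  show "f absolutely_integrable_on {s..t}"
    using f assms by (auto intro: absolutely_integrable_on_subinterval)
  then show "f integrable_on {s..t}" "(\<lambda>t. cmod (f t)) integrable_on {s..t}"
    by (auto simp: absolutely_integrable_on_def)
qed

lemma continuous_on_prim: "continuous_on {0..1} (prim f)"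
  unfolding prim_def by (rule indefinite_integral_continuous_1[OF f_integrable(1)])

text \<open>The second fact recognises the bracket in \<open>part'\<close> as an antiderivative of
  \<open>part f\<close>. It replaces a second derivative, which need not exist everywhere when
  \<open>f\<close> is merely integrable.\<close>

lemma part_has_vector_derivative:
  assumes t: "t \<in> {0..1}"
  shows "(part f has_vector_derivative part' f t) (at t within {0..1})"
    and "((\<lambda>t. S t * int_cos f t - C t * int_sin f t) has_vector_derivative part f t)
      (at t within {0..1})"
proof -
  have c: "(int_cos f has_vector_derivative C t * prim f t) (at t within {0..1})"
    unfolding int_cos_def using t
    by (intro integral_has_vector_derivative continuous_intros continuous_on_prim)
  have s: "(int_sin f has_vector_derivative S t * prim f t) (at t within {0..1})"
    unfolding int_sin_def using t
    by (intro integral_has_vector_derivative continuous_intros continuous_on_prim)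
  have "(part f has_vector_derivative
      C t * (C t * prim f t) + (- \<mu> * S t) * int_cos f t
      + \<mu> * (S t * (S t * prim f t) + C t * int_sin f t)) (at t within {0..1})"
    unfolding part_def
    by (intro has_vector_derivative_add has_vector_derivative_mult_right
        has_vector_derivative_mult c s CS_derivs)
  moreover have "C t * (C t * prim f t) + (- \<mu> * S t) * int_cos f t
      + \<mu> * (S t * (S t * prim f t) + C t * int_sin f t)
    = (C t * C t + \<mu> * (S t * S t)) * prim f t - \<mu> * (S t * int_cos f t - C t * int_sin f t)"
    by (simp add: algebra_simps)
  ultimately show "(part f has_vector_derivative part' f t) (at t within {0..1})"
    by (simp add: part'_def cos_fun_sin_fun_squared)
  have "((\<lambda>t. S t * int_cos f t - C t * int_sin f t) has_vector_derivative
      (S t * (C t * prim f t) + C t * int_cos f t) -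
      (C t * (S t * prim f t) + (- \<mu> * S t) * int_sin f t)) (at t within {0..1})"
    by (intro has_vector_derivative_diff has_vector_derivative_mult c s CS_derivs)
  then show "((\<lambda>t. S t * int_cos f t - C t * int_sin f t) has_vector_derivative part f t)
      (at t within {0..1})"
    by (simp add: part_def algebra_simps)
qed

lemma edge_sol_has_vector_derivative:
  assumes t: "t \<in> {0..1}"
  shows "(edge_sol f a b has_vector_derivative edge_sol' f a b t) (at t within {0..1})"
proof -
  have "(edge_sol f a b has_vector_derivative
    a * (- \<mu> * S t) + ((b - C 1 * a - part f 1) / S 1) * C t + part' f t) (at t within {0..1})"
    unfolding edge_sol_def
    by (intro has_vector_derivative_add has_vector_derivative_mult_right CS_derivs
        part_has_vector_derivative(1) t)
  then show ?thesis by (simp add: edge_sol'_def mult.assoc)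
qed

lemma continuous_on_edge_sol: "continuous_on {0..1} (edge_sol f a b)"
  using continuous_on_vector_derivative edge_sol_has_vector_derivative by blast

lemma continuous_on_edge_sol': "continuous_on {0..1} (edge_sol' f a b)"
proof -
  have "continuous_on {0..1} (int_cos f)" "continuous_on {0..1} (int_sin f)"
    unfolding int_cos_def int_sin_def
    by (intro indefinite_integral_continuous_1 integrable_continuous_real continuous_intros
        continuous_on_prim)+
  then show ?thesis
    unfolding edge_sol'_def part'_def by (intro continuous_intros continuous_on_prim)
qed

lemma edge_sol_integrable_sub:
  assumes "0 \<le> s" "t \<le> 1"
  shows "(\<lambda>r. f r - \<mu> * edge_sol f a b r) absolutely_integrable_on {s..t}"
proof -
  have "continuous_on {s..t} (\<lambda>r. \<mu> * edge_sol f a b r)"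
    using assms
    by (intro continuous_intros continuous_on_subset[OF continuous_on_edge_sol]) auto
  then show ?thesis
    by (intro set_integral_diff f_integrable_sub assms absolutely_integrable_continuous_real)
qed

text \<open>The derivative is split into \<open>prim f\<close>, whose increments are integrals of
  \<open>f\<close> by definition, and a smooth rest \<open>?H\<close>, to which the fundamental
  theorem applies.\<close>

lemma edge_sol'_diff:
  assumes "0 \<le> s" "s \<le> t" "t \<le> 1"
  shows "edge_sol' f a b t - edge_sol' f a b s = integral {s..t} (\<lambda>r. f r - \<mu> * edge_sol f a b r)"
proof -
  let ?k = "(b - C 1 * a - part f 1) / S 1"
  let ?D = "\<lambda>t. S t * int_cos f t - C t * int_sin f t"
  let ?H = "\<lambda>t. - a * \<mu> * S t + ?k * C t - \<mu> * ?D t"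
  have "(?H has_vector_derivative - \<mu> * edge_sol f a b r) (at r within {s..t})"
    if r: "r \<in> {s..t}" for r
  proof -
    have "(?D has_vector_derivative part f r) (at r within {s..t})"
      using has_vector_derivative_within_subset[OF part_has_vector_derivative(2)] r assms by auto
    then have "(?H has_vector_derivative - a * \<mu> * C r + ?k * (- \<mu> * S r) - \<mu> * part f r)
        (at r within {s..t})"
      by (intro has_vector_derivative_add has_vector_derivative_diff has_vector_derivative_mult_right CS_derivs)
    then show ?thesis by (simp add: edge_sol_def algebra_simps)
  qed
  from fundamental_theorem_of_calculus[OF assms(2) this]
  have H: "((\<lambda>r. - \<mu> * edge_sol f a b r) has_integral ?H t - ?H s) {s..t}" .
  have "(f has_integral prim f t - prim f s) {s..t}"
  proof -
    have "integral {0..s} f + integral {s..t} f = integral {0..t} f"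
      using assms by (intro Henstock_Kurzweil_Integration.integral_combine f_integrable_sub) auto
    then have "prim f t - prim f s = integral {s..t} f" by (simp add: prim_def algebra_simps)
    then show ?thesis using f_integrable_sub(2)[of s t] assms by (simp add: integrable_integral)
  qed
  from has_integral_add[OF this H]
  have "((\<lambda>r. f r - \<mu> * edge_sol f a b r) has_integral
      prim f t - prim f s + (?H t - ?H s)) {s..t}" by simp
  then show ?thesis
    by (simp add: integral_unique edge_sol'_def part'_def algebra_simps)
qed

lemma edge_sol_deriv_at:
  assumes "t \<in> {0<..<1}"
  shows "(edge_sol f a b has_vector_derivative edge_sol' f a b t) (at t)"
  using edge_sol_has_vector_derivative[of t a b] assms
  by (metis at_within_Icc_at atLeastAtMost_iff greaterThanLessThan_iff less_imp_le)

lemma has_second_deriv_edge_sol: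
  "has_second_deriv (edge_sol f a b) (\<lambda>t. f t - \<mu> * edge_sol f a b t)"
  unfolding has_second_deriv_def
proof (intro conjI ballI allI impI)
  fix t :: real assume "t \<in> {0<..<1}"
  then show "edge_sol f a b differentiable at t"
    using edge_sol_deriv_at differentiableI_vector by blast
next
  fix s t :: real assume st: "0 < s" "s \<le> t" "t < 1"
  then show "(\<lambda>r. f r - \<mu> * edge_sol f a b r) absolutely_integrable_on {s..t}"
    by (intro edge_sol_integrable_sub) auto
  show "vector_derivative (edge_sol f a b) (at t) - vector_derivative (edge_sol f a b) (at s)
      = integral {s..t} (\<lambda>r. f r - \<mu> * edge_sol f a b r)"
    using st edge_sol'_diff[of s t a b] vector_derivative_at[OF edge_sol_deriv_at, of t a b]
      vector_derivative_at[OF edge_sol_deriv_at, of s a b] by simp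
qed

lemma edge_sol_unique:
  assumes y: "continuous_on {0..1} y" "has_second_deriv y (\<lambda>t. f t - \<mu> * y t)"
    and t: "t \<in> {0..1}"
  shows "y t = edge_sol f (y 0) (y 1) t"
proof -
  let ?U = "edge_sol f (y 0) (y 1)" and ?U' = "edge_sol' f (y 0) (y 1)"
  let ?y' = "\<lambda>t. vector_derivative y (at t)"
  define d where "d t = y t - ?U t" for t
  define d' where "d' t = ?y' t - ?U' t" for t
  have cd: "continuous_on {0..1} d"
    unfolding d_def by (intro continuous_intros y continuous_on_edge_sol)
  have d1: "(d has_vector_derivative d' t) (at t)" if t: "t \<in> {0<..<1}" for t
    unfolding d_def d'_def using y(2) t
    by (intro has_vector_derivative_diff edge_sol_deriv_at)
       (auto simp: has_second_deriv_def vector_derivative_works)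
  \<comment> \<open>The inhomogeneity cancels, so the increments of \<open>d'\<close> are integrals
    of a continuous function although \<open>f\<close> need not be continuous.\<close>
  have dd: "d' t - d' s = integral {s..t} (\<lambda>r. - \<mu> * d r)" if st: "0 < s" "s \<le> t" "t < 1" for s t
  proof -
    have "?y' t - ?y' s = integral {s..t} (\<lambda>r. f r - \<mu> * y r)"
      and i: "(\<lambda>r. f r - \<mu> * y r) absolutely_integrable_on {s..t}"
      using y(2) st by (auto simp: has_second_deriv_def)
    moreover have "?U' t - ?U' s = integral {s..t} (\<lambda>r. f r - \<mu> * ?U r)"
      using st by (intro edge_sol'_diff) auto
    moreover have i2: "(\<lambda>r. f r - \<mu> * ?U r) absolutely_integrable_on {s..t}"
      using st by (intro edge_sol_integrable_sub) auto
    ultimately have "d' t - d' s =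
        integral {s..t} (\<lambda>r. f r - \<mu> * y r) - integral {s..t} (\<lambda>r. f r - \<mu> * ?U r)"
      by (simp add: d'_def algebra_simps)
    also have "\<dots> = integral {s..t} (\<lambda>r. (f r - \<mu> * y r) - (f r - \<mu> * ?U r))"
      using i i2
      by (intro Henstock_Kurzweil_Integration.integral_diff[symmetric])
         (auto simp: absolutely_integrable_on_def)
    also have "\<dots> = integral {s..t} (\<lambda>r. - \<mu> * d r)"
      by (simp add: d_def algebra_simps)
    finally show ?thesis .
  qed
  have d2: "(d' has_vector_derivative - \<mu> * d t) (at t)" if t: "t \<in> {0<..<1}" for t
  proof -
    \<comment> \<open>A compact neighbourhood of \<open>t\<close> in the open interval, on which
      \<open>d'\<close> is a constant plus an indefinite integral.\<close>
    define l where "l = t / 2"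
    define u where "u = (t + 1) / 2"
    have lu: "0 < l" "l < t" "t < u" "u < 1" using t by (auto simp: l_def u_def)
    have "((\<lambda>x. integral {l..x} (\<lambda>r. - \<mu> * d r)) has_vector_derivative - \<mu> * d t)
        (at t within {l..u})"
      using lu by (intro integral_has_vector_derivative continuous_intros
          continuous_on_subset[OF cd]) auto
    then have "((\<lambda>x. d' l + integral {l..x} (\<lambda>r. - \<mu> * d r)) has_vector_derivative
        0 + - \<mu> * d t) (at t within {l..u})"
      by (intro has_vector_derivative_add has_vector_derivative_const)
    then have "(d' has_vector_derivative - \<mu> * d t) (at t within {l..u})"
      using lu dd[of l] by (auto simp: algebra_simps intro: has_vector_derivative_transform[rotated -1])
    then show ?thesis using lu by (simp add: at_within_Icc_at)
  qed
  \<comment> \<open>\<open>A\<close> and \<open>B\<close> are the Wronskians of \<open>d\<close>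
    with \<open>S\<close> and with \<open>C\<close>. They are constant because all three functions
    solve the homogeneous equation, and by Cramer's rule they are the coordinates of
    \<open>d\<close> in the basis \<open>C\<close>, \<open>S\<close>.\<close>
  obtain A where A: "\<And>t. t \<in> {0<..<1} \<Longrightarrow> d t * C t - d' t * S t = A"
  proof -
    have "((\<lambda>t. d t * C t - d' t * S t) has_vector_derivative 0) (at t within {0<..<1})"
      if "t \<in> {0<..<1}" for t
    proof -
      have "((\<lambda>t. d t * C t - d' t * S t) has_vector_derivative
          (d t * (- \<mu> * S t) + d' t * C t) - (d' t * C t + (- \<mu> * d t) * S t)) (at t within {0<..<1})"
        using that by (intro has_vector_derivative_diff has_vector_derivative_mult CS_derivs
            has_vector_derivative_at_within[OF d1] has_vector_derivative_at_within[OF d2])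
      then show ?thesis by (simp add: algebra_simps)
    qed
    with has_vector_derivative_zero_constant[of "{0<..<1}"] that show ?thesis
      by (metis (no_types, lifting) convex_real_interval(8))
  qed
  obtain B where B: "\<And>t. t \<in> {0<..<1} \<Longrightarrow> \<mu> * (d t * S t) + d' t * C t = B"
  proof -
    have "((\<lambda>t. \<mu> * (d t * S t) + d' t * C t) has_vector_derivative 0) (at t within {0<..<1})"
      if "t \<in> {0<..<1}" for t
    proof -
      have "((\<lambda>t. \<mu> * (d t * S t) + d' t * C t) has_vector_derivative
          \<mu> * (d t * C t + d' t * S t) + (d' t * (- \<mu> * S t) + (- \<mu> * d t) * C t)) (at t within {0<..<1})"
        using that by (intro has_vector_derivative_add has_vector_derivative_mult CS_derivs
            has_vector_derivative_mult_right
            has_vector_derivative_at_within[OF d1] has_vector_derivative_at_within[OF d2])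
      then show ?thesis by (simp add: algebra_simps)
    qed
    with has_vector_derivative_zero_constant[of "{0<..<1}"] that show ?thesis
      by (metis (no_types, lifting) convex_real_interval(8))
  qed
  have rep: "d t = A * C t + B * S t" if t: "t \<in> {0<..<1}" for t
  proof -
    have "d t = d t * (C t * C t + \<mu> * (S t * S t))" by (simp add: cos_fun_sin_fun_squared)
    also have "\<dots> = (d t * C t - d' t * S t) * C t + (\<mu> * (d t * S t) + d' t * C t) * S t"
      by (simp add: algebra_simps)
    finally show ?thesis using A[OF t] B[OF t] by simp
  qed
  \<comment> \<open>Derivatives of \<open>d\<close> are known in the open interval only; continuity
    carries the representation to the ends, where the boundary values determine \<open>A\<close> and
    \<open>B\<close>.\<close>
  have rep': "d t = A * C t + B * S t" if t: "t \<in> {0..1}" for t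
  proof -
    have "d t - (A * C t + B * S t) = 0"
    proof (rule continuous_constant_on_closure[of "{0<..<1}" "\<lambda>t. d t - (A * C t + B * S t)"])
      show "continuous_on (closure {0<..<1}) (\<lambda>t. d t - (A * C t + B * S t))"
        using cd by (auto intro!: continuous_intros)
    qed (use rep t in auto)
    then show ?thesis by simp
  qed
  have "A = 0" using rep'[of 0] by (simp add: d_def)
  moreover have "B = 0" using rep'[of 1] sin_nz \<open>A = 0\<close> by (simp add: d_def)
  ultimately show ?thesis using rep'[OF t] by (simp add: d_def)
qed

end

end

section \<open>Elementary estimates and polynomial test functions\<close>

lemma vector_Lipschitz:
  fixes g :: "real \<Rightarrow> complex"
  assumes d: "\<And>t. t \<in> {0..1} \<Longrightarrow> (g has_vector_derivative g' t) (at t within {0..1})"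
    and B: "\<And>t. t \<in> {0..1} \<Longrightarrow> cmod (g' t) \<le> B"
    and st: "s \<in> {0..1}" "t \<in> {0..1}"
  shows "cmod (g s - g t) \<le> B * \<bar>s - t\<bar>"
proof -
  have "norm (g s - g t) \<le> B * norm (s - t)"
  proof (rule differentiable_bound)
    show "(g has_derivative (\<lambda>h. h *\<^sub>R g' r)) (at r within {0..1})" if "r \<in> {0..1}" for r
      using d[OF that] by (simp add: has_vector_derivative_def)
    show "onorm (\<lambda>h. h *\<^sub>R g' r) \<le> B" if "r \<in> {0..1}" for r
      using B[OF that] by (intro onorm_le) (simp add: mult.commute[of B] mult_left_mono)
  qed (use st in auto)
  then show ?thesis by simp
qed

lemma reflect_has_vector_derivative:
  assumes "\<And>t. ((g :: real \<Rightarrow> complex) has_vector_derivative g' t) (at t)"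
  shows "((\<lambda>t. g (1 - t)) has_vector_derivative - g' (1 - t)) (at t within A)"
proof -
  have "((\<lambda>t. 1 - t) has_real_derivative -1) (at t)" by (auto intro!: derivative_eq_intros)
  then have "((\<lambda>t. 1 - t) has_vector_derivative -1) (at t)"
    by (simp add: has_real_derivative_iff_has_vector_derivative)
  from vector_diff_chain_at[OF this assms] show ?thesis
    by (simp add: o_def has_vector_derivative_at_within)
qed

lemma norm_integral_mult_le:
  fixes g h :: "real \<Rightarrow> complex"
  assumes "t \<in> {0..1}" "continuous_on {0..1} g" "continuous_on {0..1} h"
    and "\<And>r. r \<in> {0..1} \<Longrightarrow> cmod (g r) \<le> A" "\<And>r. r \<in> {0..1} \<Longrightarrow> cmod (h r) \<le> B"
  shows "cmod (integral {0..t} (\<lambda>r. g r * h r)) \<le> A * B"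
proof -
  have "0 \<le> A" "0 \<le> B"
    using order_trans[OF norm_ge_zero assms(4)[of 0]] order_trans[OF norm_ge_zero assms(5)[of 0]]
    by auto
  have "cmod (integral {0..t} (\<lambda>r. g r * h r)) \<le> A * B * (t - 0)"
  proof (rule integral_bound)
    show "continuous_on {0..t} (\<lambda>r. g r * h r)"
      using assms(1) by (intro continuous_intros continuous_on_subset[OF assms(2)]
          continuous_on_subset[OF assms(3)]) auto
    show "\<And>r. r \<in> {0..t} \<Longrightarrow> cmod (g r * h r) \<le> A * B"
      using assms \<open>0 \<le> A\<close> by (auto simp: norm_mult intro!: mult_mono)
  qed (use assms in auto)
  also have "\<dots> \<le> A * B" using \<open>0 \<le> A\<close> \<open>0 \<le> B\<close> assms(1)
    by (auto intro: mult_left_le)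
  finally show ?thesis .
qed

lemma bounded_on_unit:
  assumes "continuous_on {0..1} (g :: real \<Rightarrow> complex)"
  obtains B where "B > 0" "\<And>t. t \<in> {0..1} \<Longrightarrow> cmod (g t) \<le> B"
  using compact_imp_bounded[OF compact_continuous_image[OF assms compact_Icc]]
  unfolding bounded_pos by auto

text \<open>
  A function vanishing at both endpoints with its first two derivatives, except for the slope at 0.
  It serves to prescribe normal derivatives, and as a test function recovering boundary values.
\<close>
definition bump :: "real \<Rightarrow> complex" where
  "bump t = of_real (t - 6 * t ^ 3 + 8 * t ^ 4 - 3 * t ^ 5)"

definition bump1 :: "real \<Rightarrow> complex" where
  "bump1 t = of_real (1 - 18 * t ^ 2 + 32 * t ^ 3 - 15 * t ^ 4)"

definition bump2 :: "real \<Rightarrow> complex" where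
  "bump2 t = of_real (- 36 * t + 96 * t ^ 2 - 60 * t ^ 3)"

definition bump3 :: "real \<Rightarrow> complex" where
  "bump3 t = of_real (- 36 + 192 * t - 180 * t ^ 2)"

text \<open>These six conditions determine the quintic: it is the Hermite basis polynomial for the
  slope at 0. The vanishing second derivatives make \<open>bump_load\<close> below vanish at both
  ends, so that it can be glued at the vertices with value 0.\<close>

lemma bump_simps [simp]:
  "bump 0 = 0" "bump 1 = 0" "bump1 0 = 1" "bump1 1 = 0" "bump2 0 = 0" "bump2 1 = 0"
  by (simp_all add: bump_def bump1_def bump2_def)

lemma bump_derivs:
  "(bump has_vector_derivative bump1 t) (at t within A)"
  "(bump1 has_vector_derivative bump2 t) (at t within A)"
  "(bump2 has_vector_derivative bump3 t) (at t within A)"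
proof -
  have "((\<lambda>t. t - 6 * t ^ 3 + 8 * t ^ 4 - 3 * t ^ 5) has_real_derivative
      1 - 18 * t ^ 2 + 32 * t ^ 3 - 15 * t ^ 4) (at t within A)"
    "((\<lambda>t. 1 - 18 * t ^ 2 + 32 * t ^ 3 - 15 * t ^ 4) has_real_derivative
      - 36 * t + 96 * t ^ 2 - 60 * t ^ 3) (at t within A)"
    "((\<lambda>t. - 36 * t + 96 * t ^ 2 - 60 * t ^ 3) has_real_derivative
      - 36 + 192 * t - 180 * t ^ 2) (at t within A)"
    by (auto intro!: derivative_eq_intros simp: power2_eq_square)
  from this[THEN has_vector_derivative_of_real] show
    "(bump has_vector_derivative bump1 t) (at t within A)"
    "(bump1 has_vector_derivative bump2 t) (at t within A)"
    "(bump2 has_vector_derivative bump3 t) (at t within A)"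
    unfolding bump_def bump1_def bump2_def bump3_def .
qed

text \<open>The numbers \<open>x\<close> and \<open>y\<close> are the slopes at the two ends, both
  measured into the interval, as normal derivatives are.\<close>

definition bump_pair :: "complex \<Rightarrow> complex \<Rightarrow> real \<Rightarrow> complex" where
  "bump_pair x y t = x * bump t + y * bump (1 - t)"

definition bump_pair1 :: "complex \<Rightarrow> complex \<Rightarrow> real \<Rightarrow> complex" where
  "bump_pair1 x y t = x * bump1 t + y * (- bump1 (1 - t))"

text \<open>The two signs stay uncancelled because differentiating the reflected summand twice
  produces them in this form.\<close>

definition bump_pair2 :: "complex \<Rightarrow> complex \<Rightarrow> real \<Rightarrow> complex" where
  "bump_pair2 x y t = x * bump2 t + y * (- (- bump2 (1 - t)))"

lemma bump_pair_derivs: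
  "(bump_pair x y has_vector_derivative bump_pair1 x y t) (at t within A)"
  "(bump_pair1 x y has_vector_derivative bump_pair2 x y t) (at t within A)"
  unfolding bump_pair_def bump_pair1_def bump_pair2_def
  by (intro has_vector_derivative_add has_vector_derivative_mult_right
      bump_derivs reflect_has_vector_derivative has_vector_derivative_minus)+

lemma bump_pair_simps [simp]:
  "bump_pair x y 0 = 0" "bump_pair x y 1 = 0"
  "bump_pair1 x y 0 = x" "bump_pair1 x y 1 = - y"
  by (simp_all add: bump_pair_def bump_pair1_def)

section \<open>Estimates on an edge that are uniform in the data\<close>

context regular_value
begin

lemma edge_sol_split: "edge_sol f a b t = edge_sol (\<lambda>_. 0) a b t + edge_sol f 0 0 t"
  by (simp add: edge_sol_def part_def int_cos_def int_sin_def prim_def diff_divide_distrib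
      add_divide_distrib algebra_simps)

lemma norm_prim_le:
  assumes "f absolutely_integrable_on {0..1}" "t \<in> {0..1}"
  shows "cmod (prim f t) \<le> integral {0..1} (\<lambda>t. cmod (f t))"
proof -
  have i: "f integrable_on {0..t}" "(\<lambda>t. cmod (f t)) integrable_on {0..t}"
    using f_integrable_sub[OF assms(1), of 0 t] assms(2) by auto
  have "cmod (prim f t) \<le> integral {0..t} (\<lambda>t. cmod (f t))"
    unfolding prim_def using i by (rule integral_norm_bound_integral) auto
  also have "\<dots> \<le> integral {0..1} (\<lambda>t. cmod (f t))"
    using i(2) f_integrable(2)[OF assms(1)] assms(2) by (intro integral_subset_le) auto
  finally show ?thesis .
qed

text \<open>Only the \<open>L^1\<close> norm of \<open>f\<close> enters, because the solution
  formula sees \<open>f\<close> through its primitive. The constant is chosen before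
  \<open>f\<close>, \<open>a\<close> and \<open>b\<close>, so it serves all edges at once.\<close>

lemma edge_sol_bound:
  obtains K where "0 \<le> K"
    "\<And>f a b t. f absolutely_integrable_on {0..1} \<Longrightarrow> t \<in> {0..1} \<Longrightarrow>
      cmod (edge_sol f a b t) \<le> K * (cmod a + cmod b + integral {0..1} (\<lambda>t. cmod (f t)))"
    "\<And>f a b t. f absolutely_integrable_on {0..1} \<Longrightarrow> t \<in> {0..1} \<Longrightarrow>
      cmod (edge_sol' f a b t) \<le> K * (cmod a + cmod b + integral {0..1} (\<lambda>t. cmod (f t)))"
proof -
  obtain Bc where Bc: "Bc > 0" "\<And>t. t \<in> {0..1} \<Longrightarrow> cmod (C t) \<le> Bc"
    by (rule bounded_on_unit[OF continuous_on_cos_fun[of _ \<mu>]]) blast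
  obtain Bs where Bs: "Bs > 0" "\<And>t. t \<in> {0..1} \<Longrightarrow> cmod (S t) \<le> Bs"
    by (rule bounded_on_unit[OF continuous_on_sin_fun[of _ \<mu>]]) blast
  define B where "B = max Bc Bs"
  have B: "B > 0" "\<And>t. t \<in> {0..1} \<Longrightarrow> cmod (C t) \<le> B" "\<And>t. t \<in> {0..1} \<Longrightarrow> cmod (S t) \<le> B"
    using Bc Bs by (force simp: B_def)+
  define m where "m = cmod \<mu>"
  \<comment> \<open>\<open>L\<close> dominates the constants of \<open>part\<close> and
    \<open>part'\<close>, namely \<open>B * B + m * B * B\<close> and
    \<open>1 + 2 * m * B * B\<close>. In \<open>K\<close> the terms belong to \<open>a * C\<close>,
    to \<open>a * \<mu> * S\<close>, to the coefficient of the boundary condition (bounded with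
    \<open>1 + B + L\<close> and \<open>s\<close>), and to the particular solution.\<close>
  define L where "L = 1 + 2 * B * B + 2 * m * B * B"
  define s where "s = 1 / cmod (S 1)"
  define K where "K = B + m * B + (1 + B + L) * s * B + L"
  have nn: "0 \<le> m" "0 \<le> s" "0 \<le> L" using B(1) by (auto simp: m_def s_def L_def)
  then have K0: "0 \<le> K" using B(1) by (simp add: K_def)
  have main: "cmod (edge_sol f a b t) \<le> K * (cmod a + cmod b + integral {0..1} (\<lambda>t. cmod (f t))) \<and>
      cmod (edge_sol' f a b t) \<le> K * (cmod a + cmod b + integral {0..1} (\<lambda>t. cmod (f t)))"
    if f: "f absolutely_integrable_on {0..1}" and t: "t \<in> {0..1}" for f a b t
  proof -
    define I where "I = integral {0..1} (\<lambda>t. cmod (f t))"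
    have p: "cmod (prim f t) \<le> I" if "t \<in> {0..1}" for t
      unfolding I_def by (rule norm_prim_le[OF f that])
    have I0: "0 \<le> I" using order_trans[OF norm_ge_zero p[of 0]] by simp
    have ic: "cmod (int_cos f t) \<le> B * I" "cmod (int_sin f t) \<le> B * I" if "t \<in> {0..1}" for t
      unfolding int_cos_def int_sin_def
      by (rule norm_integral_mult_le[OF that continuous_on_cos_fun continuous_on_prim[OF f] B(2) p]
          norm_integral_mult_le[OF that continuous_on_sin_fun continuous_on_prim[OF f] B(3) p];
          assumption)+
    have pp: "cmod (part f t) \<le> L * I" "cmod (part' f t) \<le> L * I" if t: "t \<in> {0..1}" for t
    proof -
      have mm: "cmod (g * h) \<le> B * (B * I)" if "cmod g \<le> B" "cmod h \<le> B * I" for g h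
        unfolding norm_mult using that B(1) by (intro mult_mono) auto
      have "cmod (part f t) \<le> cmod (C t * int_cos f t) + m * cmod (S t * int_sin f t)"
        unfolding part_def m_def norm_mult[of \<mu>, symmetric] by (rule norm_triangle_ineq)
      also have "\<dots> \<le> B * (B * I) + m * (B * (B * I))"
        using t nn by (intro add_mono mult_left_mono mm B ic) auto
      also have "\<dots> \<le> L * I" using I0 B(1) nn by (simp add: L_def algebra_simps)
      finally show "cmod (part f t) \<le> L * I" .
      have "cmod (part' f t) \<le> cmod (prim f t) + m * cmod (S t * int_cos f t - C t * int_sin f t)"
        unfolding part'_def m_def norm_mult[of \<mu>, symmetric] by (rule norm_triangle_ineq4)
      also have "\<dots> \<le> I + m * (B * (B * I) + B * (B * I))"
        using t nn
        by (intro add_mono p mult_left_mono order_trans[OF norm_triangle_ineq4] mm B ic) auto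
      also have "\<dots> \<le> L * I" using I0 B(1) nn by (simp add: L_def algebra_simps)
      finally show "cmod (part' f t) \<le> L * I" .
    qed
    define k where "k = (b - C 1 * a - part f 1) / S 1"
    have C1: "cmod (C 1 * a) \<le> B * cmod a"
      by (auto simp: norm_mult intro!: mult_right_mono B)
    have "cmod k = cmod (b - C 1 * a - part f 1) * s" by (simp add: k_def s_def norm_divide)
    also have "\<dots> \<le> (cmod b + B * cmod a + L * I) * s"
    proof (rule mult_right_mono)
      have "cmod (b - C 1 * a - part f 1) \<le> cmod b + cmod (C 1 * a) + cmod (part f 1)"
        using norm_triangle_ineq4[of "b - C 1 * a" "part f 1"] norm_triangle_ineq4[of b "C 1 * a"]
        by linarith
      then show "cmod (b - C 1 * a - part f 1) \<le> cmod b + B * cmod a + L * I"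
        using C1 pp(1)[of 1] by simp
    qed (use nn in auto)
    finally have k: "cmod k * B \<le> (cmod b + B * cmod a + L * I) * s * B"
      using B(1) by (intro mult_right_mono) auto
    define T where "T = cmod a + cmod b + I"
    have T: "cmod a \<le> T" "cmod b \<le> T" "I \<le> T" "0 \<le> T" using I0 by (auto simp: T_def)
    have mono: "B * cmod a \<le> B * T" "(m * B) * cmod a \<le> (m * B) * T"
        "(s * B) * cmod b \<le> (s * B) * T" "(B * s * B) * cmod a \<le> (B * s * B) * T"
        "(L * s * B) * I \<le> (L * s * B) * T" "L * I \<le> L * T"
        "0 \<le> B * T" "0 \<le> (m * B) * T"
      using B(1) nn T by (auto intro!: mult_left_mono mult_nonneg_nonneg)
    have KT: "K * T = B * T + (m * B) * T + (s * B) * T + (B * s * B) * T + (L * s * B) * T + L * T"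
      by (simp add: K_def algebra_simps)
    have "(cmod b + B * cmod a + L * I) * s * B =
        (s * B) * cmod b + (B * s * B) * cmod a + (L * s * B) * I"
      by (simp add: algebra_simps)
    then have total: "B * cmod a + (cmod b + B * cmod a + L * I) * s * B + L * I \<le> K * T"
      "m * (B * cmod a) + (cmod b + B * cmod a + L * I) * s * B + L * I \<le> K * T"
      using mono unfolding KT mult.assoc[of m B "cmod a", symmetric] by linarith+
    have aC: "cmod (a * C t) \<le> B * cmod a" and aS: "cmod (a * S t) \<le> B * cmod a"
      and kC: "cmod (k * C t) \<le> cmod k * B" and kS: "cmod (k * S t) \<le> cmod k * B"
      using B(2,3)[OF t] by (auto simp: norm_mult mult.commute[of B] intro!: mult_left_mono)
    have "cmod (edge_sol f a b t) \<le> cmod (a * C t) + cmod (k * S t) + cmod (part f t)"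
      unfolding edge_sol_def k_def[symmetric]
      by (intro order_trans[OF norm_triangle_ineq] add_mono order_refl)
    with aC kS k pp(1)[OF t] total(1)
    have 1: "cmod (edge_sol f a b t) \<le> K * T" by linarith
    have "cmod (edge_sol' f a b t) \<le> cmod (- a * \<mu> * S t) + cmod (k * C t) + cmod (part' f t)"
      unfolding edge_sol'_def k_def[symmetric]
      by (intro order_trans[OF norm_triangle_ineq] add_mono order_refl)
    moreover have "cmod (- a * \<mu> * S t) = m * cmod (a * S t)" by (simp add: norm_mult m_def)
    moreover have "m * cmod (a * S t) \<le> m * (B * cmod a)"
      using aS nn by (intro mult_left_mono)
    ultimately have "cmod (edge_sol' f a b t) \<le> K * T"
      using kC k pp(2)[OF t] total(2) by linarith
    with 1 show ?thesis by (simp add: T_def I_def)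
  qed
  show ?thesis by (rule that[OF K0]) (use main in auto)
qed

lemma edge_sol_Lipschitz:
  assumes f: "f absolutely_integrable_on {0..1}" and st: "s \<in> {0..1}" "t \<in> {0..1}"
    and B: "\<And>t. t \<in> {0..1} \<Longrightarrow> cmod (edge_sol' f a b t) \<le> B"
  shows "cmod (edge_sol f a b s - edge_sol f a b t) \<le> B * \<bar>s - t\<bar>"
  using edge_sol_has_vector_derivative[OF f] B st by (rule vector_Lipschitz)

text \<open>Functions at \<open>L^1\<close> distance 0 have the same primitive, and the slope
  depends on \<open>f\<close> only through it. Hence slopes are well defined on classes of
  functions.\<close>

lemma edge_sol'_cong:
  assumes f: "f absolutely_integrable_on {0..1}" and g: "g absolutely_integrable_on {0..1}"
    and 0: "integral {0..1} (\<lambda>t. cmod (f t - g t)) = 0" and t: "t \<in> {0..1}"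
  shows "edge_sol' f a b t = edge_sol' g a b t"
proof -
  have p: "prim f t = prim g t" if t: "t \<in> {0..1}" for t
  proof -
    have "prim f t - prim g t = prim (\<lambda>t. f t - g t) t"
      unfolding prim_def using f_integrable_sub(2)[OF f, of 0 t] f_integrable_sub(2)[OF g, of 0 t] t
      by (simp add: Henstock_Kurzweil_Integration.integral_diff)
    moreover have "cmod (prim (\<lambda>t. f t - g t) t) \<le> 0"
      using norm_prim_le[OF set_integral_diff(1)[OF f g] t] 0 by simp
    ultimately show ?thesis by simp
  qed
  have "int_cos f t = int_cos g t" "int_sin f t = int_sin g t" if "t \<in> {0..1}" for t
    unfolding int_cos_def int_sin_def using that p by (auto intro!: integral_cong)
  then show ?thesis using t p by (simp add: edge_sol'_def part'_def part_def)
qed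

text \<open>The right-hand side of the equation solved by \<open>bump_pair x y\<close>.\<close>

definition bump_load :: "complex \<Rightarrow> complex \<Rightarrow> real \<Rightarrow> complex" where
  "bump_load x y t = x * (\<mu> * bump t + bump2 t) + y * (\<mu> * bump (1 - t) + bump2 (1 - t))"

lemma bump_load_eq: "bump_load x y t = \<mu> * bump_pair x y t + bump_pair2 x y t"
  by (simp add: bump_load_def bump_pair_def bump_pair2_def algebra_simps)

lemma bump_load_0 [simp]: "bump_load x y 0 = 0" and bump_load_1 [simp]: "bump_load x y 1 = 0"
  by (simp_all add: bump_load_def)

lemma bump_load_deriv:
  "(bump_load x y has_vector_derivative x * (\<mu> * bump1 t + bump3 t) +
     y * (\<mu> * (- bump1 (1 - t)) + - bump3 (1 - t))) (at t within A)"
  unfolding bump_load_def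
  by (intro has_vector_derivative_add has_vector_derivative_mult_right
      bump_derivs reflect_has_vector_derivative)

lemma continuous_on_bump_load: "continuous_on A (bump_load x y)"
  by (rule continuous_on_vector_derivative) (rule bump_load_deriv)

lemma bump_load_bound:
  obtains K where "0 \<le> K"
    "\<And>x y t. t \<in> {0..1} \<Longrightarrow> cmod (bump_load x y t) \<le> K * (cmod x + cmod y)"
    "\<And>x y s t. s \<in> {0..1} \<Longrightarrow> t \<in> {0..1} \<Longrightarrow>
      cmod (bump_load x y s - bump_load x y t) \<le> K * (cmod x + cmod y) * \<bar>s - t\<bar>"
proof -
  let ?g = "\<lambda>t. \<mu> * bump t + bump2 t" and ?g' = "\<lambda>t. \<mu> * bump1 t + bump3 t"
  have "continuous_on {0..1} ?g" "continuous_on {0..1} ?g'"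
    unfolding bump_def bump1_def bump2_def bump3_def by (intro continuous_intros)+
  note cont = this
  obtain A where A: "A > 0" "\<And>t. t \<in> {0..1} \<Longrightarrow> cmod (?g t) \<le> A"
    by (rule bounded_on_unit[OF cont(1)]) blast
  obtain B where B: "B > 0" "\<And>t. t \<in> {0..1} \<Longrightarrow> cmod (?g' t) \<le> B"
    by (rule bounded_on_unit[OF cont(2)]) blast
  define K where "K = max A B"
  have K: "K > 0" "\<And>t. t \<in> {0..1} \<Longrightarrow> cmod (?g t) \<le> K" "\<And>t. t \<in> {0..1} \<Longrightarrow> cmod (?g' t) \<le> K"
    using A B by (force simp: K_def)+
  have comb: "cmod (x * p + y * q) \<le> K * (cmod x + cmod y)" if "cmod p \<le> K" "cmod q \<le> K" for x y p q
  proof -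
    have "cmod (x * p + y * q) \<le> cmod x * cmod p + cmod y * cmod q"
      by (metis norm_mult norm_triangle_ineq)
    also have "\<dots> \<le> cmod x * K + cmod y * K" using that by (intro add_mono mult_left_mono) auto
    finally show ?thesis by (simp add: algebra_simps)
  qed
  show ?thesis
  proof (rule that)
    show "0 \<le> K" using K by simp
    show "cmod (bump_load x y t) \<le> K * (cmod x + cmod y)" if "t \<in> {0..1}" for x y t
      unfolding bump_load_def using that by (intro comb K) auto
    show "cmod (bump_load x y s - bump_load x y t) \<le> K * (cmod x + cmod y) * \<bar>s - t\<bar>"
      if st: "s \<in> {0..1}" "t \<in> {0..1}" for x y s t
    proof (rule vector_Lipschitz[OF bump_load_deriv _ st])
      fix r :: real assume r: "r \<in> {0..1}"
      have "\<mu> * (- bump1 (1 - r)) + - bump3 (1 - r) = - ?g' (1 - r)" by simp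
      then have "cmod (\<mu> * (- bump1 (1 - r)) + - bump3 (1 - r)) \<le> K"
        using r K(3)[of "1 - r"] by (simp only: norm_minus_cancel) simp
      then show "cmod (x * (\<mu> * bump1 r + bump3 r) +
          y * (\<mu> * (- bump1 (1 - r)) + - bump3 (1 - r))) \<le> K * (cmod x + cmod y)"
        using r by (intro comb K)
    qed
  qed
qed

text \<open>No integral has to be evaluated: by uniqueness the solution with zero end values is
  \<open>bump_pair x y\<close>, whose slopes are known.\<close>

lemma edge_sol'_bump_load:
  shows "edge_sol' (bump_load x y) 0 0 0 = x" "edge_sol' (bump_load x y) 0 0 1 = - y"
proof -
  let ?f = "bump_load x y" and ?w = "bump_pair x y"
  have f: "?f absolutely_integrable_on {0..1}"
    by (intro absolutely_integrable_continuous_real continuous_on_bump_load)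
  have "continuous_on A (bump_pair2 x y)" for A
    unfolding bump_pair2_def bump2_def by (intro continuous_intros)
  moreover have "bump_pair1 x y t - bump_pair1 x y s = integral {s..t} (bump_pair2 x y)"
    if "s \<le> t" for s t
    using fundamental_theorem_of_calculus[OF that bump_pair_derivs(2)[of x y]] by (simp add: integral_unique)
  ultimately have "has_second_deriv ?w (bump_pair2 x y)"
    unfolding has_second_deriv_def
    by (auto simp: vector_derivative_at[OF bump_pair_derivs(1)] intro: differentiableI_vector
        absolutely_integrable_continuous_real bump_pair_derivs(1))
  then have "has_second_deriv ?w (\<lambda>t. ?f t - \<mu> * ?w t)" by (simp add: bump_load_eq)
  moreover have "continuous_on {0..1} ?w"
    by (rule continuous_on_vector_derivative) (rule bump_pair_derivs)
  ultimately have eq: "?w t = edge_sol ?f 0 0 t" if "t \<in> {0..1}" for t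
    using edge_sol_unique[OF f, of ?w t] that by simp
  have "bump_pair1 x y t = edge_sol' ?f 0 0 t" if t: "t \<in> {0..1}" for t
  proof (rule vector_derivative_unique_within_closed_interval[of 0 1 t ?w])
    show "(?w has_vector_derivative edge_sol' ?f 0 0 t) (at t within cbox 0 1)"
      using edge_sol_has_vector_derivative[OF f t, of 0 0] t eq
      by (auto intro: has_vector_derivative_transform)
  qed (use t bump_pair_derivs in auto)
  from this[of 0] this[of 1]
  show "edge_sol' ?f 0 0 0 = x" "edge_sol' ?f 0 0 1 = - y" by simp_all
qed

text \<open>Green's identity: for a homogeneous solution \<open>h\<close>, the product
  \<open>h * (w'' + \<mu> * w)\<close> is the derivative of \<open>h * w' - h' * w\<close>. As
  \<open>w\<close> vanishes at both ends, the end values of \<open>h\<close> remain, weighted by the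
  end slopes of \<open>w\<close>.\<close>

lemma boundary_value_identity:
  "integral {0..1} (\<lambda>t. edge_sol (\<lambda>_. 0) a b t * bump_load x y t) = - (x * a + y * b)"
proof -
  let ?k = "(b - C 1 * a) / S 1"
  define h where "h t = a * C t + ?k * S t" for t
  define h' where "h' t = a * (- \<mu> * S t) + ?k * C t" for t
  have h: "(h has_vector_derivative h' t) (at t within A)" for t A
    unfolding h_def h'_def
    by (intro has_vector_derivative_add has_vector_derivative_mult_right CS_derivs)
  have h': "(h' has_vector_derivative a * (- \<mu> * C t) + ?k * (- \<mu> * S t)) (at t within A)" for t A
    unfolding h'_def
    by (intro has_vector_derivative_add has_vector_derivative_mult_right CS_derivs)
  let ?w = "bump_pair x y" and ?w' = "bump_pair1 x y" and ?w'' = "bump_pair2 x y"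
  let ?d = "\<lambda>t. (h t * ?w'' t + h' t * ?w' t) -
    (h' t * ?w' t + (a * (- \<mu> * C t) + ?k * (- \<mu> * S t)) * ?w t)"
  have "((\<lambda>t. h t * ?w' t - h' t * ?w t) has_vector_derivative ?d t) (at t within {0..1})" for t
    by (intro has_vector_derivative_diff has_vector_derivative_mult h h' bump_pair_derivs)
  from fundamental_theorem_of_calculus[OF zero_le_one this]
  have "(?d has_integral (h 1 * ?w' 1 - h' 1 * ?w 1) - (h 0 * ?w' 0 - h' 0 * ?w 0)) {0..1}" by simp
  moreover have "?d t = edge_sol (\<lambda>_. 0) a b t * bump_load x y t" for t
  proof -
    have "edge_sol (\<lambda>_. 0) a b t = h t"
      by (simp add: edge_sol_def part_def int_cos_def int_sin_def prim_def h_def)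
    moreover have "a * (- \<mu> * C t) + ?k * (- \<mu> * S t) = - \<mu> * h t"
      by (simp add: h_def algebra_simps)
    ultimately show ?thesis
      by (simp only:) (simp add: bump_load_eq ring_distribs mult_ac)
  qed
  moreover have "h 1 = b" "h 0 = a" using sin_nz by (simp_all add: h_def)
  ultimately show ?thesis by (simp add: integral_unique algebra_simps)
qed

text \<open>An integral norm does not control point values in general, but for a solution of the
  equation it does: the end values are linear functionals given by integration against
  \<open>bump_load\<close>.\<close>

lemma boundary_value_bound:
  obtains K where "0 \<le> K"
    "\<And>f a b. f absolutely_integrable_on {0..1} \<Longrightarrow>
      cmod a + cmod b \<le> K * (integral {0..1} (\<lambda>t. cmod (edge_sol f a b t)) +
        integral {0..1} (\<lambda>t. cmod (f t)))"
proof -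
  obtain L where L: "0 \<le> L" "\<And>f a b t. f absolutely_integrable_on {0..1} \<Longrightarrow> t \<in> {0..1} \<Longrightarrow>
      cmod (edge_sol f a b t) \<le> L * (cmod a + cmod b + integral {0..1} (\<lambda>t. cmod (f t)))"
    by (rule edge_sol_bound) blast
  obtain B where B: "0 \<le> B"
    "\<And>x y t. t \<in> {0..1} \<Longrightarrow> cmod (bump_load x y t) \<le> B * (cmod x + cmod y)"
    by (rule bump_load_bound) blast
  have z: "(\<lambda>_. 0 :: complex) absolutely_integrable_on {0..1::real}" by simp
  have *: "cmod a + cmod b \<le> 2 * B * (integral {0..1} (\<lambda>t. cmod (edge_sol (\<lambda>_. 0) a b t)))" for a b
  proof -
    have "cmod (x * a + y * b) \<le> B * (cmod x + cmod y) *
        integral {0..1} (\<lambda>t. cmod (edge_sol (\<lambda>_. 0) a b t))" for x y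
    proof -
      have "cmod (x * a + y * b) =
          cmod (integral {0..1} (\<lambda>t. edge_sol (\<lambda>_. 0) a b t * bump_load x y t))"
        unfolding boundary_value_identity norm_minus_cancel ..
      also have "\<dots> \<le> integral {0..1} (\<lambda>t. B * (cmod x + cmod y) * cmod (edge_sol (\<lambda>_. 0) a b t))"
      proof (rule integral_norm_bound_integral)
        show "(\<lambda>t. edge_sol (\<lambda>_. 0) a b t * bump_load x y t) integrable_on {0..1}"
          by (intro integrable_continuous_real continuous_intros continuous_on_edge_sol z
              continuous_on_bump_load)
        show "(\<lambda>t. B * (cmod x + cmod y) * cmod (edge_sol (\<lambda>_. 0) a b t)) integrable_on {0..1}"
          by (intro integrable_continuous_real continuous_intros continuous_on_edge_sol z)
        show "cmod (edge_sol (\<lambda>_. 0) a b t * bump_load x y t)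
            \<le> B * (cmod x + cmod y) * cmod (edge_sol (\<lambda>_. 0) a b t)" if "t \<in> {0..1}" for t
          using B(2)[OF that, of x y]
          by (simp add: norm_mult mult.commute[of "cmod (edge_sol _ _ _ _)"] mult_right_mono)
      qed
      finally show ?thesis by simp
    qed
    \<comment> \<open>Slope 1 at one end and 0 at the other isolates one end value; the sum of the
      two estimates gives the factor 2.\<close>
    from this[of 1 0] this[of 0 1] show ?thesis by simp
  qed
  show ?thesis
  proof (rule that)
    show "0 \<le> 2 * B * (1 + L)" using B L by simp
    fix f :: "real \<Rightarrow> complex" and a b assume f: "f absolutely_integrable_on {0..1}"
    let ?I = "integral {0..1} (\<lambda>t. cmod (f t))"
    let ?Y = "integral {0..1} (\<lambda>t. cmod (edge_sol f a b t))"
    have I0: "0 \<le> ?I" "0 \<le> ?Y"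
      by (auto intro!: Henstock_Kurzweil_Integration.integral_nonneg f_integrable(2)[OF f]
          integrable_continuous_real continuous_intros continuous_on_edge_sol f)
    \<comment> \<open>The homogeneous part is the solution minus the one with zero end values, and
      the latter is bounded by the integral of \<open>f\<close>.\<close>
    have "integral {0..1} (\<lambda>t. cmod (edge_sol (\<lambda>_. 0) a b t)) \<le>
        integral {0..1} (\<lambda>t. cmod (edge_sol f a b t) + L * ?I)"
    proof (rule integral_le)
      fix t :: real assume t: "t \<in> {0..1}"
      have "cmod (edge_sol (\<lambda>_. 0) a b t) \<le> cmod (edge_sol f a b t) + cmod (edge_sol f 0 0 t)"
        using edge_sol_split[of f a b t] by (metis add_diff_cancel_right' norm_triangle_ineq4)
      with L(2)[OF f t, of 0 0]
      show "cmod (edge_sol (\<lambda>_. 0) a b t) \<le> cmod (edge_sol f a b t) + L * ?I" by simp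
    qed (intro integrable_continuous_real continuous_intros continuous_on_edge_sol z f)+
    also have "\<dots> = ?Y + L * ?I"
      by (subst Henstock_Kurzweil_Integration.integral_add)
         (auto intro!: integrable_continuous_real continuous_intros continuous_on_edge_sol f)
    finally have "cmod a + cmod b \<le> 2 * B * (?Y + L * ?I)"
      using order_trans[OF *[of a b] mult_left_mono, of "?Y + L * ?I"] B(1) by simp
    also have "\<dots> \<le> 2 * B * ((1 + L) * (?Y + ?I))"
      using B(1) L(1) I0 by (intro mult_left_mono) (simp_all add: algebra_simps)
    finally show "cmod a + cmod b \<le> 2 * B * (1 + L) * (?Y + ?I)" by (simp add: mult.assoc)
  qed
qed

end

section \<open>Geometry of the metric graph\<close>

lemma edge_point_simps [simp]:
  "edge_point G e 0 = Vert (tail G e)" "edge_point G e 1 = Vert (head G e)"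
  "0 < t \<Longrightarrow> t < 1 \<Longrightarrow> edge_point G e t = Inner e t"
  by (simp_all add: edge_point_def)

text \<open>Permits changing between \<open>Inner e t\<close> and \<open>edge_point G e t\<close>,
  which agree in the open interval only.\<close>

lemma has_second_deriv_cong:
  assumes "\<And>t. t \<in> {0<..<1} \<Longrightarrow> w t = w' t" "\<And>t. t \<in> {0<..<1} \<Longrightarrow> g t = g' t"
  shows "has_second_deriv w g \<longleftrightarrow> has_second_deriv w' g'"
proof -
  have imp: "has_second_deriv w' g'" if h: "has_second_deriv w g"
    and w: "\<And>t. t \<in> {0<..<1} \<Longrightarrow> w t = w' t" and g: "\<And>t. t \<in> {0<..<1} \<Longrightarrow> g t = g' t"
  for w w' g g' :: "real \<Rightarrow> complex"
  proof -
    have d: "(w' has_vector_derivative vector_derivative w (at t)) (at t)" if "t \<in> {0<..<1}" for t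
    proof -
      have "(w has_vector_derivative vector_derivative w (at t)) (at t)"
        using h that by (simp add: has_second_deriv_def vector_derivative_works)
      from has_vector_derivative_transform_within_open[OF this, of "{0<..<1}" w'] that w
      show ?thesis by simp
    qed
    have "g' absolutely_integrable_on {s..t} \<and>
        vector_derivative w' (at t) - vector_derivative w' (at s) = integral {s..t} g'"
      if st: "0 < s" "s \<le> t" "t < 1" for s t
    proof -
      have "g absolutely_integrable_on {s..t}"
        and v: "vector_derivative w (at t) - vector_derivative w (at s) = integral {s..t} g"
        using h st by (auto simp: has_second_deriv_def)
      moreover have "integral {s..t} g = integral {s..t} g'"
        using st g by (intro integral_cong) auto
      moreover have "g absolutely_integrable_on {s..t} \<longleftrightarrow> g' absolutely_integrable_on {s..t}"
        using st g by (intro set_integrable_cong) auto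
      ultimately show ?thesis
        using vector_derivative_at[OF d, of s] vector_derivative_at[OF d, of t] st by simp
    qed
    then show ?thesis unfolding has_second_deriv_def using d differentiableI_vector by blast
  qed
  show ?thesis using imp[of w g w' g'] imp[of w' g' w g] assms by auto
qed

text \<open>Continuity of \<open>d\<close> up to the ends makes the \<open>Lim\<close> in the normal
  derivative a genuine one-sided limit.\<close>

lemma normal_deriv_eq:
  assumes d: "\<And>t. t \<in> {0<..<1} \<Longrightarrow> ((\<lambda>s. u (Inner e s)) has_vector_derivative d t) (at t)"
    and c: "continuous_on {0..1} d"
  shows "normal_deriv G c u e v =
    (if v = tail G e then complex_of_real (c e) * d 0 else - complex_of_real (c e) * d 1)"
proof -
  let ?u' = "\<lambda>t. vector_derivative (\<lambda>s. u (Inner e s)) (at t)"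
  have eq: "?u' t = d t" if "0 < t" "t < 1" for t
    using vector_derivative_at[OF d] that by simp
  have lim: "(d \<longlongrightarrow> d 0) (at_right 0)" "(d \<longlongrightarrow> d 1) (at_left 1)"
    using continuous_on_Icc_at_rightD[OF c] continuous_on_Icc_at_leftD[OF c] by simp_all
  have ev: "\<forall>\<^sub>F t in at_right 0. d t = ?u' t"
    unfolding eventually_at_right_field using eq by (intro exI[of _ 1]) auto
  have ev': "\<forall>\<^sub>F t in at_left 1. d t = ?u' t"
    unfolding eventually_at_left_field using eq by (intro exI[of _ 0]) auto
  show ?thesis using Lim_transform_eventually[OF lim(1) ev] Lim_transform_eventually[OF lim(2) ev']
    by (simp add: normal_deriv_def Let_def tendsto_Lim)
qed

context equilateral_metric_graph
begin

lemma inc_arcsD: "e \<in> inc_arcs G v \<Longrightarrow> e \<in> arcs G \<and> (v = tail G e \<or> v = head G e)"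
  by (auto simp: inc_arcs_def)

lemma inc_arcs_iff: "e \<in> inc_arcs G v \<longleftrightarrow> e \<in> arcs G \<and> (v = tail G e \<or> v = head G e)"
  by (auto simp: inc_arcs_def)

lemma finite_inc_arcs: "v \<in> verts G \<Longrightarrow> finite (inc_arcs G v)"
  using uniformly_locally_finite by blast

text \<open>Connectedness joins \<open>v\<close> to the tail of some edge. Either \<open>v\<close>
  is that tail, or the first step of the walk uses an edge at \<open>v\<close>.\<close>

lemma inc_arcs_nonempty:
  assumes v: "v \<in> verts G"
  shows "inc_arcs G v \<noteq> {}"
proof -
  obtain e0 where e0: "e0 \<in> arcs G" using has_arc by blast
  let ?w = "tail G e0"
  have "?w \<in> verts G" using e0 by simp
  then have "(v, ?w) \<in> rtrancl_on (verts G) (arcs_ends (mk_symmetric G))"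
    using connected v unfolding Digraph_Component.connected_def strongly_connected_def
      reachable_def by (auto simp: mk_symmetric_def)
  then have "v = ?w \<or> (\<exists>e\<in>arcs G. v = tail G e \<or> v = head G e)"
    by (cases rule: converse_rtrancl_on_cases)
       (auto simp: mk_symmetric_def arcs_ends_def arc_to_ends_def)
  then show ?thesis using e0 by (auto simp: inc_arcs_def)
qed

lemma vertex_weight_pos: "v \<in> verts G \<Longrightarrow> 0 < vertex_weight G c v"
  unfolding vertex_weight_def
  by (intro sum_pos finite_inc_arcs inc_arcs_nonempty) (auto dest: inc_arcsD conductivity_pos)

lemma conductivity_nonneg: "e \<in> arcs G \<Longrightarrow> 0 \<le> c e"
  using conductivity_pos[of e] by simp

lemma vertex_weight_nonneg: "v \<in> verts G \<Longrightarrow> 0 \<le> vertex_weight G c v"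
  using vertex_weight_pos[of v] by simp

lemma mg_points_edge:
  assumes "x \<in> mg_points G"
  obtains e t where "e \<in> arcs G" "t \<in> {0..1}" "x = edge_point G e t"
proof (cases x)
  case (Vert v)
  then have "v \<in> verts G" using assms by (auto simp: mg_points_def)
  then obtain e where "e \<in> inc_arcs G v" using inc_arcs_nonempty by blast
  then show ?thesis using that[of e 0] that[of e 1] Vert by (auto dest: inc_arcsD)
next
  case (Inner e t)
  then show ?thesis using that[of e t] assms by (auto simp: mg_points_def)
qed

lemma edge_point_mg [simp]: "e \<in> arcs G \<Longrightarrow> edge_point G e t \<in> mg_points G"
  by (rule edge_point_in_mg_points[OF wf_digraph])

lemma mg_dist_edge:
  assumes "e \<in> arcs G" "s \<in> {0..1}" "t \<in> {0..1}"
  shows "mg_dist G (edge_point G e s) (edge_point G e t) \<le> \<bar>s - t\<bar>"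
  by (rule mg_dist_le[OF mg_path_edge[OF assms]])

text \<open>The distance is an infimum of path lengths; a lower bound comes from any function that
  is 1-Lipschitz along edges. Truncated distance functions are inserted below to locate small
  balls.\<close>

lemma mg_dist_ge:
  assumes "x \<in> mg_points G" "y \<in> mg_points G"
    and "\<And>e s t. e \<in> arcs G \<Longrightarrow> s \<in> {0..1} \<Longrightarrow> t \<in> {0..1} \<Longrightarrow>
      h (edge_point G e t) \<le> h (edge_point G e s) + \<bar>s - t\<bar>"
  shows "h y - h x \<le> mg_dist G x y"
proof (rule ccontr)
  assume "\<not> h y - h x \<le> mg_dist G x y"
  then have "mg_dist G x y < h y - h x" by simp
  then obtain l where l: "mg_path G x y l" "l < h y - h x"
    using mg_dist_less[OF assms(1,2)] by blast
  have "h y \<le> h x + l" using l(1) assms(3) by (rule mg_path_Lipschitz)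
  then show False using l by simp
qed

lemma near_vertex:
  assumes v: "v \<in> verts G" and y: "y \<in> mg_points G" and d: "mg_dist G (Vert v) y < 1"
  obtains e t where "e \<in> inc_arcs G v" "t \<in> {0..1}" "y = edge_point G e t"
    "v = tail G e \<and> t \<le> mg_dist G (Vert v) y \<or> v = head G e \<and> 1 - t \<le> mg_dist G (Vert v) y"
proof -
  \<comment> \<open>The distance to \<open>v\<close> on the edges at \<open>v\<close>, cut off at 1.
    Without loops each of these edges has \<open>v\<close> at exactly one end, so \<open>h\<close>
    is well behaved along edges.\<close>
  define h :: "('v, 'e) mg_point \<Rightarrow> real" where
    "h = (\<lambda>y. case y of Vert w \<Rightarrow> if w = v then 0 else 1
      | Inner e t \<Rightarrow> if tail G e = v then t else if head G e = v then 1 - t else 1)"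
  have v': "Vert v \<in> mg_points G" using v by (simp add: mg_points_def)
  have "h (edge_point G e t) \<le> h (edge_point G e s) + \<bar>s - t\<bar>"
    if "e \<in> arcs G" "s \<in> {0..1}" "t \<in> {0..1}" for e s t
    using that no_loops[OF that(1)] by (auto simp: h_def edge_point_def)
  from mg_dist_ge[OF v' y this]
  have le: "h y \<le> mg_dist G (Vert v) y" by (simp add: h_def)
  obtain e t where et: "e \<in> arcs G" "t \<in> {0..1}" "y = edge_point G e t"
    by (rule mg_points_edge[OF y])
  have h1: "h y < 1" using le d by simp
  show ?thesis
  proof (cases y)
    case (Vert w)
    then have "w = v" using h1 by (auto simp: h_def split: if_splits)
    obtain a where a: "a \<in> inc_arcs G v" using inc_arcs_nonempty[OF v] by blast
    then show ?thesis
      using that[of a 0] that[of a 1] le Vert \<open>w = v\<close> by (auto simp: h_def dest: inc_arcsD)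
  next
    case (Inner a r)
    then have ar: "a \<in> arcs G" "0 < r" "r < 1" using y by (auto simp: mg_points_def)
    show ?thesis
      using that[of a r] Inner ar le h1 by (auto simp: h_def inc_arcs_iff split: if_splits)
  qed
qed

lemma near_inner:
  assumes e: "e \<in> arcs G" "0 < r" "r < 1" and y: "y \<in> mg_points G"
    and d: "mg_dist G (Inner e r) y < min r (1 - r)"
  obtains t where "0 < t" "t < 1" "y = edge_point G e t" "\<bar>t - r\<bar> \<le> mg_dist G (Inner e r) y"
proof -
  \<comment> \<open>The distance to the inner point along its edge, cut off at the distance to the
    nearer end; the cutoff makes it constant on all other edges.\<close>
  define h :: "('v, 'e) mg_point \<Rightarrow> real" where
    "h = (\<lambda>y. case y of Vert w \<Rightarrow> min r (1 - r)
      | Inner a t \<Rightarrow> if a = e then min \<bar>t - r\<bar> (min r (1 - r)) else min r (1 - r))"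
  have x: "Inner e r \<in> mg_points G" using e by (simp add: mg_points_def)
  have "h (edge_point G a t) \<le> h (edge_point G a s) + \<bar>s - t\<bar>"
    if "a \<in> arcs G" "s \<in> {0..1}" "t \<in> {0..1}" for a s t
    using that e by (auto simp: h_def edge_point_def)
  from mg_dist_ge[OF x y this]
  have le: "h y \<le> mg_dist G (Inner e r) y" using e by (simp add: h_def)
  then have "h y < min r (1 - r)" using d by simp
  then obtain t where "y = Inner e t" "\<bar>t - r\<bar> = h y"
    by (cases y) (auto simp: h_def min_def split: if_splits)
  then show ?thesis using that[of t] le y by (auto simp: mg_points_def)
qed

lemma continuous_map_mg_iff:
  "continuous_on_graph G u \<longleftrightarrow> (\<forall>x\<in>mg_points G. \<forall>\<epsilon>>0. \<exists>\<delta>>0. \<forall>y.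
     y \<in> mg_points G \<and> mg_dist G x y < \<delta> \<longrightarrow> cmod (u x - u y) < \<epsilon>)"
proof -
  interpret mg: Metric_space "mg_points G" "mg_dist G" by (rule Metric_space_mg)
  show ?thesis
    using mg.metric_continuous_map[OF Met_TC.Metric_space_axioms, of u]
    by (simp add: continuous_on_graph_def mtopology_of_def dist_norm)
qed

lemma continuous_map_edge_point:
  assumes "e \<in> arcs G"
  shows "continuous_map (top_of_set {0..1}) (mtopology_of (mg_metric G)) (edge_point G e)"
proof -
  have "Lipschitz_continuous_map (submetric euclidean_metric {0..1}) (mg_metric G) (edge_point G e)"
    unfolding Lipschitz_continuous_map_def using assms mg_dist_edge[OF assms]
    by (auto simp: dist_real_def intro!: exI[of _ 1])
  from Lipschitz_continuous_imp_continuous_map[OF this] show ?thesis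
    by (simp add: mtopology_of_submetric)
qed

text \<open>Edges are parametrised by 1-Lipschitz maps, which gives one direction. The other is
  local: a small ball around an inner point stays in its edge, and one around a vertex stays in the
  finitely many incident edges.\<close>

lemma continuous_on_graph_iff:
  "continuous_on_graph G u \<longleftrightarrow> (\<forall>e\<in>arcs G. continuous_on {0..1} (\<lambda>t. u (edge_point G e t)))"
proof
  assume u: "continuous_on_graph G u"
  show "\<forall>e\<in>arcs G. continuous_on {0..1} (\<lambda>t. u (edge_point G e t))"
  proof
    fix e assume "e \<in> arcs G"
    from continuous_map_compose[OF continuous_map_edge_point[OF this] u[unfolded continuous_on_graph_def]]
    show "continuous_on {0..1} (\<lambda>t. u (edge_point G e t))"
      by (simp add: o_def)
  qed
next
  assume u: "\<forall>e\<in>arcs G. continuous_on {0..1} (\<lambda>t. u (edge_point G e t))"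
  have delta: "\<exists>\<delta>>0. \<forall>s\<in>{0..1}. \<bar>s - t\<bar> < \<delta> \<longrightarrow>
      cmod (u (edge_point G e t) - u (edge_point G e s)) < \<epsilon>"
    if "e \<in> arcs G" "t \<in> {0..1}" "0 < \<epsilon>" for e t \<epsilon>
    using u that
    by (auto simp: continuous_on_iff dist_norm norm_minus_commute[of "u (edge_point G e t)"])
  show "continuous_on_graph G u"
    unfolding continuous_map_mg_iff
  proof (intro ballI allI impI)
    fix x and \<epsilon> :: real assume x: "x \<in> mg_points G" and \<epsilon>: "0 < \<epsilon>"
    show "\<exists>\<delta>>0. \<forall>y. y \<in> mg_points G \<and> mg_dist G x y < \<delta> \<longrightarrow> cmod (u x - u y) < \<epsilon>"
    proof (cases x)
      case (Vert v)
      then have v: "v \<in> verts G" using x by (auto simp: mg_points_def)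
      define end_of where "end_of e = (if v = tail G e then 0 else 1 :: real)" for e
      have "\<forall>e\<in>inc_arcs G v. \<exists>\<delta>>0. \<forall>s\<in>{0..1}. \<bar>s - end_of e\<bar> < \<delta> \<longrightarrow>
          cmod (u (Vert v) - u (edge_point G e s)) < \<epsilon>"
      proof
        fix e assume e: "e \<in> inc_arcs G v"
        then have "edge_point G e (end_of e) = Vert v" by (auto simp: end_of_def dest: inc_arcsD)
        then show "\<exists>\<delta>>0. \<forall>s\<in>{0..1}. \<bar>s - end_of e\<bar> < \<delta> \<longrightarrow>
            cmod (u (Vert v) - u (edge_point G e s)) < \<epsilon>"
          using delta[of e "end_of e" \<epsilon>] e \<epsilon> by (auto simp: end_of_def dest: inc_arcsD)
      qed
      then obtain \<delta> where \<delta>: "\<And>e. e \<in> inc_arcs G v \<Longrightarrow> 0 < \<delta> e"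
        "\<And>e s. e \<in> inc_arcs G v \<Longrightarrow> s \<in> {0..1} \<Longrightarrow> \<bar>s - end_of e\<bar> < \<delta> e \<Longrightarrow>
          cmod (u (Vert v) - u (edge_point G e s)) < \<epsilon>" by metis
      \<comment> \<open>The 1 keeps the ball within the edges at \<open>v\<close>; local finiteness
        makes the minimum positive.\<close>
      let ?D = "insert 1 (\<delta> ` inc_arcs G v)"
      have fin: "finite ?D" using finite_inc_arcs[OF v] by simp
      show ?thesis
      proof (intro exI[of _ "Min ?D"] conjI allI impI)
        show "0 < Min ?D" using fin \<delta>(1) by (subst Min_gr_iff) auto
        fix y assume y: "y \<in> mg_points G \<and> mg_dist G x y < Min ?D"
        then have lt: "mg_dist G (Vert v) y < 1" "\<And>e. e \<in> inc_arcs G v \<Longrightarrow> mg_dist G (Vert v) y < \<delta> e"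
          using fin Vert by (auto simp: Min_gr_iff)
        obtain e t where et: "e \<in> inc_arcs G v" "t \<in> {0..1}" "y = edge_point G e t"
          "v = tail G e \<and> t \<le> mg_dist G (Vert v) y \<or> v = head G e \<and> 1 - t \<le> mg_dist G (Vert v) y"
          by (rule near_vertex[OF v _ lt(1)]) (use y in auto)
        have "\<bar>t - end_of e\<bar> < \<delta> e"
          using et lt(2)[OF et(1)] no_loops[of e] inc_arcsD[OF et(1)] by (auto simp: end_of_def)
        then show "cmod (u x - u y) < \<epsilon>" using \<delta>(2) et Vert by simp
      qed
    next
      case (Inner e r)
      then have e: "e \<in> arcs G" "0 < r" "r < 1" using x by (auto simp: mg_points_def)
      obtain \<delta> where \<delta>: "\<delta> > 0" "\<And>s. s \<in> {0..1} \<Longrightarrow> \<bar>s - r\<bar> < \<delta> \<Longrightarrow>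
          cmod (u (edge_point G e r) - u (edge_point G e s)) < \<epsilon>"
        using delta[OF e(1) _ \<epsilon>, of r] e by (auto simp del: edge_point_simps)
      show ?thesis
      proof (intro exI[of _ "min \<delta> (min r (1 - r))"] conjI allI impI)
        show "0 < min \<delta> (min r (1 - r))" using \<delta> e by simp
        fix y assume y: "y \<in> mg_points G \<and> mg_dist G x y < min \<delta> (min r (1 - r))"
        obtain t where t: "0 < t" "t < 1" "y = edge_point G e t" "\<bar>t - r\<bar> \<le> mg_dist G (Inner e r) y"
          by (rule near_inner[OF e, of y]) (use y Inner in auto)
        then show "cmod (u x - u y) < \<epsilon>" using \<delta>(2)[of t] y e Inner by simp
      qed
    qed
  qed
qed

lemma edgewise_Lipschitz:
  fixes u :: "('v, 'e) mg_point \<Rightarrow> complex"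
  assumes L: "\<And>e s t. e \<in> arcs G \<Longrightarrow> s \<in> {0..1} \<Longrightarrow> t \<in> {0..1} \<Longrightarrow>
      cmod (u (edge_point G e s) - u (edge_point G e t)) \<le> L * \<bar>s - t\<bar>"
    and x: "x \<in> mg_points G" and y: "y \<in> mg_points G"
  shows "cmod (u x - u y) \<le> L * mg_dist G x y"
proof -
  have path: "cmod (u x - u y) \<le> L * l" if "mg_path G x y l" for l
    using that
  proof induction
    case (step x e s l t)
    have "cmod (u x - u (edge_point G e t)) \<le> cmod (u x - u (edge_point G e s)) +
        cmod (u (edge_point G e s) - u (edge_point G e t))"
      using norm_triangle_ineq[of "u x - u (edge_point G e s)" "u (edge_point G e s) - u (edge_point G e t)"]
      by simp
    then show ?case using L[OF step(2-4)] step.IH by (simp add: algebra_simps)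
  qed simp
  obtain e0 where e0: "e0 \<in> arcs G" using has_arc by blast
  have L0: "0 \<le> L" using order_trans[OF norm_ge_zero L[OF e0, of 0 1]] by simp
  show ?thesis
  proof (rule field_le_epsilon)
    fix \<epsilon> :: real assume \<epsilon>: "0 < \<epsilon>"
    \<comment> \<open>The infimum need not be known to be attained, so there is a margin; dividing
      by \<open>L + 1\<close> covers the case \<open>L = 0\<close>.\<close>
    have "mg_dist G x y < mg_dist G x y + \<epsilon> / (L + 1)" using \<epsilon> L0 by simp
    then obtain l where l: "mg_path G x y l" "l < mg_dist G x y + \<epsilon> / (L + 1)"
      using mg_dist_less[OF x y] by blast
    have "cmod (u x - u y) \<le> L * (mg_dist G x y + \<epsilon> / (L + 1))"
      using path[OF l(1)] l(2) L0 by (smt (verit) mult_left_mono)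
    also have "\<dots> \<le> L * mg_dist G x y + \<epsilon>"
      using L0 \<epsilon> by (simp add: field_simps)
    finally show "cmod (u x - u y) \<le> L * mg_dist G x y + \<epsilon>" .
  qed
qed

text \<open>Every point has distance less than 1 from some vertex, so open unit balls around
  vertices cover the graph, and each of them lies in the finitely many edges at its centre.\<close>

lemma compactin_finite_edges:
  assumes "compactin (mtopology_of (mg_metric G)) K"
  obtains F where "finite F" "F \<subseteq> arcs G" "K \<subseteq> (\<Union>e\<in>F. edge_point G e ` {0..1})"
proof -
  interpret mg: Metric_space "mg_points G" "mg_dist G" by (rule Metric_space_mg)
  have top: "mtopology_of (mg_metric G) = mg.mtopology" by (simp add: mtopology_of_def)
  have "K \<subseteq> mg_points G" using compactin_subset_topspace[OF assms] by simp
  have "K \<subseteq> \<Union> ((\<lambda>v. mg.mball (Vert v) 1) ` verts G)"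
  proof
    fix x assume "x \<in> K"
    then have x: "x \<in> mg_points G" using \<open>K \<subseteq> mg_points G\<close> by blast
    show "x \<in> \<Union> ((\<lambda>v. mg.mball (Vert v) 1) ` verts G)"
    proof (cases x)
      case (Vert v)
      then have "v \<in> verts G" using x by (auto simp: mg_points_def)
      then show ?thesis using x Vert by auto
    next
      case (Inner e t)
      then have e: "e \<in> arcs G" "0 < t" "t < 1" using x by (auto simp: mg_points_def)
      then have "mg_dist G (Vert (tail G e)) x < 1" using mg_dist_edge[OF e(1), of 0 t] Inner by simp
      moreover have "tail G e \<in> verts G" using e by simp
      moreover have "Vert (tail G e) \<in> mg_points G" using edge_point_mg[OF e(1), of 0] by simp
      ultimately show ?thesis using x by auto
    qed
  qed
  then obtain \<F> where \<F>: "finite \<F>" "\<F> \<subseteq> (\<lambda>v. mg.mball (Vert v) 1) ` verts G" "K \<subseteq> \<Union>\<F>"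
    using compactinD[OF assms, of "(\<lambda>v. mg.mball (Vert v) 1) ` verts G"] top by auto
  then obtain V where V: "finite V" "V \<subseteq> verts G" "\<F> = (\<lambda>v. mg.mball (Vert v) 1) ` V"
    by (meson finite_subset_image)
  show ?thesis
  proof (rule that[of "\<Union> (inc_arcs G ` V)"])
    show "finite (\<Union> (inc_arcs G ` V))" using V finite_inc_arcs by auto
    show "\<Union> (inc_arcs G ` V) \<subseteq> arcs G" by (auto dest: inc_arcsD)
    show "K \<subseteq> (\<Union>e\<in>\<Union> (inc_arcs G ` V). edge_point G e ` {0..1})"
    proof
      fix x assume "x \<in> K"
      then obtain v where v: "v \<in> V" "x \<in> mg_points G" "mg_dist G (Vert v) x < 1"
        using \<F>(3) V(3) by auto
      obtain e t where "e \<in> inc_arcs G v" "t \<in> {0..1}" "x = edge_point G e t"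
        by (rule near_vertex[of v x]) (use v V in auto)
      then show "x \<in> (\<Union>e\<in>\<Union> (inc_arcs G ` V). edge_point G e ` {0..1})" using v by blast
    qed
  qed
qed

lemma finite_edges_compactin:
  assumes "finite F" "F \<subseteq> arcs G"
  shows "compactin (mtopology_of (mg_metric G)) (\<Union>e\<in>F. edge_point G e ` {0..1})"
proof (rule compactin_Union)
  show "finite ((\<lambda>e. edge_point G e ` {0..1}) ` F)" using assms by simp
  show "compactin (mtopology_of (mg_metric G)) K"
    if "K \<in> (\<lambda>e. edge_point G e ` {0..1}) ` F" for K
    using that assms
    by (auto intro!: image_compactin[OF _ continuous_map_edge_point] simp: compactin_subtopology)
qed

end

section \<open>Resolvents on the graph and on its vertices\<close>

definition edge_L1 :: "('v, 'e) pre_digraph \<Rightarrow> (('v, 'e) mg_point \<Rightarrow> complex) \<Rightarrow> 'e \<Rightarrow> real" where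
  "edge_L1 G u e = integral {0..1} (\<lambda>t. cmod (u (edge_point G e t)))"

definition glue :: "('v \<Rightarrow> complex) \<Rightarrow> ('e \<Rightarrow> real \<Rightarrow> complex) \<Rightarrow> ('v, 'e) mg_point \<Rightarrow> complex" where
  "glue z w x = (case x of Vert v \<Rightarrow> z v | Inner e t \<Rightarrow> w e t)"

lemma glue_simps [simp]: "glue z w (Vert v) = z v" "glue z w (Inner e t) = w e t"
  by (simp_all add: glue_def)

lemma glue_edge_point:
  assumes "w e 0 = z (tail G e)" "w e 1 = z (head G e)" "t \<in> {0..1}"
  shows "glue z w (edge_point G e t) = w e t"
  using assms by (cases "t = 0"; cases "t = 1") auto

text \<open>
  \<open>Q q b\<close> abstracts "the sequence \<open>q\<close> on the edges belongs to the weighted \<open>l\<^sup>p\<close>, \<open>c\<^sub>0\<close> or \<open>l\<^sup>\<infinity>\<close> space and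
  has norm at most \<open>b\<close>". A function is measured by its \<open>L\<^sup>1\<close> norms on the edges, whereas sup and
  Lipschitz bounds on the edges are required to conclude membership; solving the equation on an edge
  passes from the former to the latter.
\<close>
locale space_pair = equilateral_metric_graph G c
  for G :: "('v, 'e) pre_digraph" (structure) and c :: "'e \<Rightarrow> real" +
  fixes X :: "(('v, 'e) mg_point \<Rightarrow> complex) set" and N :: "(('v, 'e) mg_point \<Rightarrow> complex) \<Rightarrow> real"
    and Z :: "('v \<Rightarrow> complex) set" and M :: "('v \<Rightarrow> complex) \<Rightarrow> real"
    and Q :: "('e \<Rightarrow> real) \<Rightarrow> real \<Rightarrow> bool" and K :: real
  assumes K_nonneg: "0 \<le> K"
    and X_lincomb: "u \<in> X \<Longrightarrow> v \<in> X \<Longrightarrow> (\<lambda>x. \<alpha> * u x + v x) \<in> X"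
    and X_edge: "u \<in> X \<Longrightarrow> e \<in> arcs G \<Longrightarrow>
      (\<lambda>t. u (edge_point G e t)) absolutely_integrable_on {0..1}"
    and N_nonneg: "u \<in> X \<Longrightarrow> 0 \<le> N u"
    and M_nonneg: "z \<in> Z \<Longrightarrow> 0 \<le> M z"
    and X_Q: "u \<in> X \<Longrightarrow> Q (edge_L1 G u) (N u)"
    and Z_Q: "z \<in> Z \<Longrightarrow> Q (\<lambda>e. cmod (z (tail G e)) + cmod (z (head G e))) (K * M z)"
    and Q_0: "Q (\<lambda>e. 0) 0"
    and Q_scale: "Q q b \<Longrightarrow> 0 \<le> a \<Longrightarrow> Q (\<lambda>e. a * q e) (a * b)"
    and Q_add: "Q q b \<Longrightarrow> Q q' b' \<Longrightarrow> Q (\<lambda>e. q e + q' e) (K * (b + b'))"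
    and Q_zero: "Q q 0 \<Longrightarrow> e \<in> arcs G \<Longrightarrow> q e = 0"
    and Q_X: "Q q b \<Longrightarrow>
      (\<And>e t. e \<in> arcs G \<Longrightarrow> t \<in> {0..1} \<Longrightarrow> cmod (u (edge_point G e t)) \<le> q e) \<Longrightarrow>
      (\<And>e s t. e \<in> arcs G \<Longrightarrow> s \<in> {0..1} \<Longrightarrow> t \<in> {0..1} \<Longrightarrow>
        cmod (u (edge_point G e s) - u (edge_point G e t)) \<le> q e * \<bar>s - t\<bar>) \<Longrightarrow>
      u \<in> X \<and> N u \<le> K * b"
    and Q_Z: "Q q b \<Longrightarrow>
      (\<And>v. v \<in> verts G \<Longrightarrow> cmod (z v) * vertex_weight G c v \<le> (\<Sum>e\<in>inc_arcs G v. c e * q e)) \<Longrightarrow>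
      z \<in> Z \<and> M z \<le> K * b"
begin

abbreviation "wt \<equiv> vertex_weight G c"

definition avg :: "('v \<Rightarrow> complex) \<Rightarrow> 'v \<Rightarrow> complex" where
  "avg z v = (\<Sum>e\<in>inc_arcs G v. complex_of_real (c e / wt v) * z (other_end G e v))"

lemma N_zero: "N (\<lambda>x. 0) = 0"
proof -
  have "(\<lambda>x. 0) \<in> X \<and> N (\<lambda>x. 0) \<le> K * 0" by (rule Q_X[OF Q_0]) auto
  then show ?thesis using N_nonneg by force
qed

lemma Z_zero:
  assumes "\<And>v. v \<in> verts G \<Longrightarrow> z v = 0"
  shows "z \<in> Z" "M z = 0"
proof -
  have "z \<in> Z \<and> M z \<le> K * 0" by (rule Q_Z[OF Q_0]) (use assms in auto)
  then show "z \<in> Z" "M z = 0" using M_nonneg by force+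
qed

text \<open>Every vertex is an end of some edge, and on that edge the number that \<open>Z_Q\<close>
  attaches to \<open>z\<close> vanishes by \<open>Q_zero\<close>.\<close>

lemma M_eq_0D:
  assumes "z \<in> Z" "M z = 0" "v \<in> verts G"
  shows "z v = 0"
proof -
  obtain e where e: "e \<in> inc_arcs G v" using inc_arcs_nonempty[OF assms(3)] by blast
  have "cmod (z (tail G e)) + cmod (z (head G e)) = 0"
    using Q_zero[of "\<lambda>e. cmod (z (tail G e)) + cmod (z (head G e))" e] Z_Q[OF assms(1)] assms(2)
      inc_arcsD[OF e] by simp
  then have "cmod (z (tail G e)) = 0 \<and> cmod (z (head G e)) = 0"
    by (simp add: add_nonneg_eq_0_iff)
  then show ?thesis using inc_arcsD[OF e] by auto
qed

lemma weighted_sum_le: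
  assumes "v \<in> verts G" and "\<And>e. e \<in> inc_arcs G v \<Longrightarrow> x \<le> q e"
  shows "x * wt v \<le> (\<Sum>e\<in>inc_arcs G v. c e * q e)"
  unfolding vertex_weight_def sum_distrib_left
  using assms conductivity_nonneg
  by (intro sum_mono) (auto simp: mult.commute[of x] intro!: mult_left_mono dest: inc_arcsD)

text \<open>Multiplication by the vertex weight cancels the denominators of the transition
  probabilities and leaves the form required by \<open>Q_Z\<close>. Both ends appear because the
  right-hand side must be a sequence on edges.\<close>

lemma norm_avg_le:
  assumes v: "v \<in> verts G"
  shows "cmod (avg z v) * wt v \<le>
    (\<Sum>e\<in>inc_arcs G v. c e * (cmod (z (tail G e)) + cmod (z (head G e))))"
proof -
  have w: "0 < wt v" by (rule vertex_weight_pos[OF v])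
  have "cmod (avg z v) \<le> (\<Sum>e\<in>inc_arcs G v. c e / wt v * cmod (z (other_end G e v)))"
    unfolding avg_def
  proof (rule sum_norm_le)
    fix e assume "e \<in> inc_arcs G v"
    then have "0 \<le> c e" by (auto dest: inc_arcsD conductivity_nonneg)
    then show "cmod (complex_of_real (c e / wt v) * z (other_end G e v))
        \<le> c e / wt v * cmod (z (other_end G e v))"
      using w by (simp add: norm_mult norm_divide)
  qed
  then have "cmod (avg z v) * wt v \<le> (\<Sum>e\<in>inc_arcs G v. c e / wt v * cmod (z (other_end G e v))) * wt v"
    using w by (intro mult_right_mono) auto
  also have "\<dots> = (\<Sum>e\<in>inc_arcs G v. c e * cmod (z (other_end G e v)))"
    using w by (simp add: sum_distrib_right)
  also have "\<dots> \<le> (\<Sum>e\<in>inc_arcs G v. c e * (cmod (z (tail G e)) + cmod (z (head G e))))"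
    by (intro sum_mono mult_left_mono) (auto simp: other_end_def dest: inc_arcsD conductivity_nonneg)
  finally show ?thesis .
qed

text \<open>Covers \<open>C 1 - P\<close> with \<open>b = 0\<close> and, with \<open>b = 1\<close>,
  the residual of the discrete equation, to which \<open>M_eq_0D\<close> is applied later.\<close>

lemma lincomb_avg_Z:
  assumes "z \<in> Z" "h \<in> Z"
  shows "(\<lambda>v. a * z v - avg z v - b * h v) \<in> Z"
proof -
  let ?q = "\<lambda>z e. cmod (z (tail G e)) + cmod (z (head G e)) :: real"
  have "Q (\<lambda>e. (cmod a + 1) * ?q z e + cmod b * ?q h e)
      (K * ((cmod a + 1) * (K * M z) + cmod b * (K * M h)))"
    by (intro Q_add Q_scale Z_Q assms) auto
  from Q_Z[OF this, of "\<lambda>v. a * z v - avg z v - b * h v"] show ?thesis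
  proof (rule conjunct1)
    fix v assume v: "v \<in> verts G"
    have w: "0 < wt v" by (rule vertex_weight_pos[OF v])
    have dist: "\<alpha> * (k * p) + k * p + \<beta> * (k * r) = k * ((\<alpha> + 1) * p + \<beta> * r)" for \<alpha> \<beta> k p r :: real
      by (simp add: algebra_simps)
    have q: "cmod (y v) * wt v \<le> (\<Sum>e\<in>inc_arcs G v. c e * ?q y e)" for y :: "'v \<Rightarrow> complex"
      by (rule weighted_sum_le[OF v]) (auto dest: inc_arcsD)
    have "cmod (a * z v - avg z v - b * h v) \<le> cmod a * cmod (z v) + cmod (avg z v) + cmod b * cmod (h v)"
      using norm_triangle_ineq4[of "a * z v - avg z v" "b * h v"]
        norm_triangle_ineq4[of "a * z v" "avg z v"] by (simp add: norm_mult)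
    then have "cmod (a * z v - avg z v - b * h v) * wt v \<le>
        (cmod a * cmod (z v) + cmod (avg z v) + cmod b * cmod (h v)) * wt v"
      using w by (intro mult_right_mono) auto
    also have "\<dots> = cmod a * (cmod (z v) * wt v) + cmod (avg z v) * wt v + cmod b * (cmod (h v) * wt v)"
      by (simp add: algebra_simps)
    also have "\<dots> \<le> cmod a * (\<Sum>e\<in>inc_arcs G v. c e * ?q z e) + (\<Sum>e\<in>inc_arcs G v. c e * ?q z e)
        + cmod b * (\<Sum>e\<in>inc_arcs G v. c e * ?q h e)"
      by (intro add_mono mult_left_mono q norm_avg_le v) auto
    also have "\<dots> = (\<Sum>e\<in>inc_arcs G v. c e * ((cmod a + 1) * ?q z e + cmod b * ?q h e))"
      unfolding sum_distrib_left sum.distrib[symmetric]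
      by (rule sum.cong[OF HOL.refl]) (rule dist)
    finally show "cmod (a * z v - avg z v - b * h v) * wt v \<le>
        (\<Sum>e\<in>inc_arcs G v. c e * ((cmod a + 1) * ?q z e + cmod b * ?q h e))" .
  qed
qed

end

section \<open>The Kirchhoff conditions as an equation on the vertices\<close>

locale space_pair_at = space_pair G c X N Z M Q K + regular_value \<mu>
  for G :: "('v, 'e) pre_digraph" (structure) and c X N Z M Q K \<mu>
begin

abbreviation "\<Delta> \<equiv> laplacian G c (X, N)"

definition on_edge :: "(('v, 'e) mg_point \<Rightarrow> complex) \<Rightarrow> 'e \<Rightarrow> real \<Rightarrow> complex" where
  "on_edge f e t = f (edge_point G e t)"

text \<open>The contribution of \<open>f\<close> to the derivative at \<open>v\<close> in the
  direction into the edge, computed with zero vertex values.\<close>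

definition boundary_slope :: "(('v, 'e) mg_point \<Rightarrow> complex) \<Rightarrow> 'e \<Rightarrow> 'v \<Rightarrow> complex" where
  "boundary_slope f e v = (if v = tail G e then edge_sol' (on_edge f e) 0 0 0
    else - edge_sol' (on_edge f e) 0 0 1)"

text \<open>The prefactor normalises the Kirchhoff condition at \<open>v\<close> to
  \<open>C 1 * z v - avg z v = load f v\<close>.\<close>

definition load :: "(('v, 'e) mg_point \<Rightarrow> complex) \<Rightarrow> 'v \<Rightarrow> complex" where
  "load f v = S 1 / complex_of_real (wt v) *
    (\<Sum>e\<in>inc_arcs G v. complex_of_real (c e) * boundary_slope f e v)"

text \<open>Encodes the differential equation, the vertex values \<open>z\<close> and continuity in
  one formula, leaving the Kirchhoff conditions open.\<close>

definition solves :: "(('v, 'e) mg_point \<Rightarrow> complex) \<Rightarrow> ('v \<Rightarrow> complex) \<Rightarrow>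
    (('v, 'e) mg_point \<Rightarrow> complex) \<Rightarrow> bool" where
  "solves f z u \<longleftrightarrow> (\<forall>e\<in>arcs G. \<forall>t\<in>{0..1}.
     u (edge_point G e t) = edge_sol (on_edge f e) (z (tail G e)) (z (head G e)) t)"

lemma on_edge_integrable: "f \<in> X \<Longrightarrow> e \<in> arcs G \<Longrightarrow> on_edge f e absolutely_integrable_on {0..1}"
  using X_edge unfolding on_edge_def [abs_def] .

lemma edge_L1_on_edge: "edge_L1 G f e = integral {0..1} (\<lambda>t. cmod (on_edge f e t))"
  by (simp add: edge_L1_def on_edge_def)

text \<open>At either end the slope into the edge is
  \<open>(z (other_end G e v) - C 1 * z v) / S 1\<close> plus the boundary slope of
  \<open>f\<close>. Weighting with \<open>c\<close> and summing turns the first term into the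
  transition operator.\<close>

lemma sum_normal_deriv:
  assumes f: "f \<in> X" and u: "solves f z u" and v: "v \<in> verts G"
  shows "(\<Sum>e\<in>inc_arcs G v. normal_deriv G c u e v) =
    complex_of_real (wt v) / S 1 * (avg z v - C 1 * z v + load f v)"
proof -
  have w: "complex_of_real (wt v) \<noteq> 0" using vertex_weight_pos[OF v] by simp
  have nd: "normal_deriv G c u e v = complex_of_real (c e) * z (other_end G e v) / S 1
      - complex_of_real (c e) * (C 1 * z v / S 1) + complex_of_real (c e) * boundary_slope f e v"
    if e: "e \<in> inc_arcs G v" for e
  proof -
    have ea: "e \<in> arcs G" and ends: "v = tail G e \<or> v = head G e" using inc_arcsD[OF e] by auto
    note fe = on_edge_integrable[OF f ea]
    let ?a = "z (tail G e)" and ?b = "z (head G e)"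
    have "normal_deriv G c u e v = (if v = tail G e
        then complex_of_real (c e) * edge_sol' (on_edge f e) ?a ?b 0
        else - complex_of_real (c e) * edge_sol' (on_edge f e) ?a ?b 1)"
    proof (rule normal_deriv_eq)
      fix t :: real assume t: "t \<in> {0<..<1}"
      show "((\<lambda>s. u (Inner e s)) has_vector_derivative edge_sol' (on_edge f e) ?a ?b t) (at t)"
      proof (rule has_vector_derivative_transform_within_open[OF edge_sol_deriv_at[OF fe t]])
        fix s :: real assume "s \<in> {0<..<1}"
        then show "edge_sol (on_edge f e) ?a ?b s = u (Inner e s)"
          using u[unfolded solves_def, rule_format, OF ea, of s] by simp
      qed (use t in auto)
    qed (rule continuous_on_edge_sol'[OF fe])
    then show ?thesis
      using ends no_loops[OF ea]
      by (auto simp: boundary_slope_def other_end_def edge_sol'_0[of "on_edge f e" ?a ?b]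
          edge_sol'_1[of "on_edge f e" ?a ?b] algebra_simps diff_divide_distrib)
  qed
  have "(\<Sum>e\<in>inc_arcs G v. normal_deriv G c u e v) =
      (\<Sum>e\<in>inc_arcs G v. complex_of_real (c e) * z (other_end G e v)) / S 1
      - (\<Sum>e\<in>inc_arcs G v. complex_of_real (c e)) * (C 1 * z v / S 1)
      + (\<Sum>e\<in>inc_arcs G v. complex_of_real (c e) * boundary_slope f e v)"
    by (simp add: nd sum.distrib sum_subtractf sum_divide_distrib sum_distrib_right)
  also have "(\<Sum>e\<in>inc_arcs G v. complex_of_real (c e) * z (other_end G e v))
      = complex_of_real (wt v) * avg z v"
    using w by (simp add: avg_def sum_distrib_left)
  also have "(\<Sum>e\<in>inc_arcs G v. complex_of_real (c e)) = complex_of_real (wt v)"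
    by (simp add: vertex_weight_def)
  also have "(\<Sum>e\<in>inc_arcs G v. complex_of_real (c e) * boundary_slope f e v) =
      complex_of_real (wt v) / S 1 * load f v"
    using w sin_nz by (simp add: load_def)
  finally show ?thesis by (simp add: algebra_simps diff_divide_distrib)
qed

text \<open>The same edge number bounds the solution and its derivative, hence supplies both
  premises of \<open>Q_X\<close>.\<close>

lemma solution_bound:
  obtains B where "0 \<le> B"
    "\<And>f z u. f \<in> X \<Longrightarrow> z \<in> Z \<Longrightarrow> solves f z u \<Longrightarrow> u \<in> X \<and> N u \<le> B * (M z + N f)"
proof -
  obtain A where A: "0 \<le> A"
    "\<And>f a b t. f absolutely_integrable_on {0..1} \<Longrightarrow> t \<in> {0..1} \<Longrightarrow>
      cmod (edge_sol f a b t) \<le> A * (cmod a + cmod b + integral {0..1} (\<lambda>t. cmod (f t)))"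
    "\<And>f a b t. f absolutely_integrable_on {0..1} \<Longrightarrow> t \<in> {0..1} \<Longrightarrow>
      cmod (edge_sol' f a b t) \<le> A * (cmod a + cmod b + integral {0..1} (\<lambda>t. cmod (f t)))"
    by (rule edge_sol_bound) blast
  show ?thesis
  proof (rule that)
    show "0 \<le> K * (A * (K * (K + 1)))" using A(1) K_nonneg by simp
    fix f z u assume f: "f \<in> X" and z: "z \<in> Z" and u: "solves f z u"
    let ?q = "\<lambda>e. A * (cmod (z (tail G e)) + cmod (z (head G e)) + edge_L1 G f e)"
    have "Q ?q (A * (K * (K * M z + N f)))"
      by (intro Q_scale Q_add Z_Q X_Q f z A)
    then have "u \<in> X \<and> N u \<le> K * (A * (K * (K * M z + N f)))"
    proof (rule Q_X)
      fix e and t :: real assume e: "e \<in> arcs G" and t: "t \<in> {0..1}"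
      show "cmod (u (edge_point G e t)) \<le> ?q e"
        using A(2)[OF on_edge_integrable[OF f e] t] u e t by (simp add: solves_def edge_L1_on_edge)
    next
      fix e and s t :: real assume e: "e \<in> arcs G" and s: "s \<in> {0..1}" and t: "t \<in> {0..1}"
      show "cmod (u (edge_point G e s) - u (edge_point G e t)) \<le> ?q e * \<bar>s - t\<bar>"
        using edge_sol_Lipschitz[OF on_edge_integrable[OF f e] s t A(3)[OF on_edge_integrable[OF f e]],
            of "z (tail G e)" "z (head G e)"] u e s t
        by (simp add: solves_def edge_L1_on_edge)
    qed
    moreover have "K * (A * (K * (K * M z + N f))) \<le> K * (A * (K * ((K + 1) * (M z + N f))))"
      using A(1) K_nonneg M_nonneg[OF z] N_nonneg[OF f]
      by (intro mult_left_mono) (auto simp: algebra_simps)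
    ultimately show "u \<in> X \<and> N u \<le> K * (A * (K * (K + 1))) * (M z + N f)"
      by (simp add: mult.assoc)
  qed
qed

text \<open>That \<open>z\<close> lies in \<open>Z\<close> is a conclusion: it comes from the edge
  equation through \<open>boundary_value_bound\<close>, which bounds both end values by edge
  integrals.\<close>

lemma trace_bound:
  obtains B where "0 \<le> B"
    "\<And>f z u. f \<in> X \<Longrightarrow> u \<in> X \<Longrightarrow> solves f z u \<Longrightarrow> z \<in> Z \<and> M z \<le> B * (N u + N f)"
proof -
  obtain A where A: "0 \<le> A"
    "\<And>f a b. f absolutely_integrable_on {0..1} \<Longrightarrow>
      cmod a + cmod b \<le> A * (integral {0..1} (\<lambda>t. cmod (edge_sol f a b t)) +
        integral {0..1} (\<lambda>t. cmod (f t)))"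
    by (rule boundary_value_bound) blast
  show ?thesis
  proof (rule that)
    show "0 \<le> K * (A * K)" using A(1) K_nonneg by simp
    fix f z u assume f: "f \<in> X" and uX: "u \<in> X" and u: "solves f z u"
    let ?q = "\<lambda>e. A * (edge_L1 G u e + edge_L1 G f e)"
    have "Q ?q (A * (K * (N u + N f)))"
      by (intro Q_scale Q_add X_Q f uX A)
    then have "z \<in> Z \<and> M z \<le> K * (A * (K * (N u + N f)))"
    proof (rule Q_Z)
      fix v assume v: "v \<in> verts G"
      show "cmod (z v) * wt v \<le> (\<Sum>e\<in>inc_arcs G v. c e * ?q e)"
      proof (rule weighted_sum_le[OF v])
        fix e assume "e \<in> inc_arcs G v"
        note e = inc_arcsD[OF this]
        have "edge_L1 G u e =
            integral {0..1} (\<lambda>t. cmod (edge_sol (on_edge f e) (z (tail G e)) (z (head G e)) t))"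
          unfolding edge_L1_def using u e by (intro integral_cong) (simp add: solves_def)
        with A(2)[OF on_edge_integrable[OF f], of e "z (tail G e)" "z (head G e)"] e
        have "cmod (z (tail G e)) + cmod (z (head G e)) \<le> ?q e"
          by (simp add: edge_L1_on_edge)
        moreover have "cmod (z v) \<le> cmod (z (tail G e)) + cmod (z (head G e))" using e by auto
        ultimately show "cmod (z v) \<le> ?q e" by linarith
      qed
    qed
    then show "z \<in> Z \<and> M z \<le> K * (A * K) * (N u + N f)" by (simp add: mult.assoc)
  qed
qed

text \<open>Boundary slopes are bounded by edge integrals of \<open>f\<close>. The function
  \<open>h\<close> is tied to the load on the vertices only, so that
  \<open>C 1 * z v - avg z v\<close> can be inserted for it.\<close>

lemma load_bound:
  obtains B where "0 \<le> B"
    "\<And>f h. f \<in> X \<Longrightarrow> (\<And>v. v \<in> verts G \<Longrightarrow> h v = load f v) \<Longrightarrow> h \<in> Z \<and> M h \<le> B * N f"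
proof -
  obtain A where A: "0 \<le> A"
    "\<And>f a b t. f absolutely_integrable_on {0..1} \<Longrightarrow> t \<in> {0..1} \<Longrightarrow>
      cmod (edge_sol' f a b t) \<le> A * (cmod a + cmod b + integral {0..1} (\<lambda>t. cmod (f t)))"
    by (rule edge_sol_bound) blast
  let ?s = "cmod (S 1)"
  show ?thesis
  proof (rule that)
    show "0 \<le> K * (?s * A)" using A(1) K_nonneg by simp
    fix f h assume f: "f \<in> X" and h: "\<And>v. v \<in> verts G \<Longrightarrow> h v = load f v"
    let ?q = "\<lambda>e. (?s * A) * edge_L1 G f e"
    have "Q ?q ((?s * A) * N f)"
      using A(1) by (intro Q_scale X_Q f) auto
    then have "h \<in> Z \<and> M h \<le> K * ((?s * A) * N f)"
    proof (rule Q_Z)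
      fix v assume v: "v \<in> verts G"
      have w: "0 < wt v" by (rule vertex_weight_pos[OF v])
      have "cmod (h v) * wt v =
          ?s * cmod (\<Sum>e\<in>inc_arcs G v. complex_of_real (c e) * boundary_slope f e v)"
        using w by (simp add: h[OF v] load_def norm_mult norm_divide)
      also have "\<dots> \<le> ?s * (\<Sum>e\<in>inc_arcs G v. c e * (A * edge_L1 G f e))"
      proof (intro mult_left_mono sum_norm_le)
        fix e assume "e \<in> inc_arcs G v"
        note e = inc_arcsD[OF this]
        have "cmod (boundary_slope f e v) \<le> A * edge_L1 G f e"
          using A(2)[OF on_edge_integrable[OF f], of e 0 0 0] A(2)[OF on_edge_integrable[OF f], of e 1 0 0] e
          by (auto simp: boundary_slope_def edge_L1_on_edge)
        then show "cmod (complex_of_real (c e) * boundary_slope f e v) \<le> c e * (A * edge_L1 G f e)"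
          using conductivity_nonneg[of e] e by (simp add: norm_mult mult_left_mono)
      qed simp
      also have "\<dots> = (\<Sum>e\<in>inc_arcs G v. c e * ?q e)"
        by (simp add: sum_distrib_left mult_ac)
      finally show "cmod (h v) * wt v \<le> (\<Sum>e\<in>inc_arcs G v. c e * ?q e)" .
    qed
    then show "h \<in> Z \<and> M h \<le> K * (?s * A) * N f" by (simp add: mult.assoc)
  qed
qed

text \<open>Each edge receives the polynomial right-hand side with boundary slope
  \<open>h / S 1\<close> at both ends. All slopes at a vertex are then equal, so averaging does
  nothing and the factor \<open>S 1\<close> of the load cancels.\<close>

lemma load_surj:
  obtains B where "0 \<le> B"
    "\<And>h. h \<in> Z \<Longrightarrow> \<exists>f\<in>X. (\<forall>v\<in>verts G. load f v = h v) \<and> N f \<le> B * M h"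
proof -
  obtain A where A: "0 \<le> A"
    "\<And>x y t. t \<in> {0..1} \<Longrightarrow> cmod (bump_load x y t) \<le> A * (cmod x + cmod y)"
    "\<And>x y s t. s \<in> {0..1} \<Longrightarrow> t \<in> {0..1} \<Longrightarrow>
      cmod (bump_load x y s - bump_load x y t) \<le> A * (cmod x + cmod y) * \<bar>s - t\<bar>"
    by (rule bump_load_bound) blast
  let ?s = "cmod (S 1)"
  have s: "0 < ?s" using sin_nz by simp
  show ?thesis
  proof (rule that)
    show "0 \<le> K * (A / ?s * K)" using A(1) K_nonneg s by simp
    fix h assume h: "h \<in> Z"
    define w where "w e = bump_load (h (tail G e) / S 1) (h (head G e) / S 1)" for e
    define f where "f = (glue (\<lambda>_. 0) w :: ('v, 'e) mg_point \<Rightarrow> complex)"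
    have fw: "f (edge_point G e t) = w e t" if "t \<in> {0..1}" for e t
      unfolding f_def by (rule glue_edge_point) (use that in \<open>auto simp: w_def\<close>)
    let ?q = "\<lambda>e. (A / ?s) * (cmod (h (tail G e)) + cmod (h (head G e)))"
    have q: "A * (cmod (h (tail G e) / S 1) + cmod (h (head G e) / S 1)) = ?q e" for e
      by (simp add: norm_divide add_divide_distrib distrib_left)
    have "Q ?q ((A / ?s) * (K * M h))"
      using A(1) s by (intro Q_scale Z_Q h) auto
    then have f: "f \<in> X \<and> N f \<le> K * ((A / ?s) * (K * M h))"
    proof (rule Q_X)
      fix e and t :: real assume "t \<in> {0..1}"
      then show "cmod (f (edge_point G e t)) \<le> ?q e"
        unfolding fw[OF \<open>t \<in> {0..1}\<close>] w_def q[symmetric] by (rule A)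
    next
      fix e and s t :: real assume st: "s \<in> {0..1}" "t \<in> {0..1}"
      then show "cmod (f (edge_point G e s) - f (edge_point G e t)) \<le> ?q e * \<bar>s - t\<bar>"
        unfolding fw[OF st(1)] fw[OF st(2)] w_def q[symmetric] by (rule A)
    qed
    have slope: "boundary_slope f e v = h v / S 1" if e: "e \<in> inc_arcs G v" for e v
    proof -
      have "on_edge f e absolutely_integrable_on {0..1}"
        using f inc_arcsD[OF e] by (intro on_edge_integrable) auto
      moreover have "w e absolutely_integrable_on {0..1}"
        unfolding w_def by (intro absolutely_integrable_continuous_real continuous_on_bump_load)
      \<comment> \<open>The two functions agree on the unit interval only, which suffices for equal
        slopes.\<close>
      moreover have "integral {0..1} (\<lambda>t. cmod (on_edge f e t - w e t)) = integral {0..1} (\<lambda>t::real. 0)"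
        by (intro integral_cong) (simp add: on_edge_def fw)
      ultimately have "edge_sol' (on_edge f e) 0 0 t = edge_sol' (w e) 0 0 t" if "t \<in> {0..1}" for t
        using that by (intro edge_sol'_cong) auto
      then show ?thesis
        using inc_arcsD[OF e] by (auto simp: boundary_slope_def w_def edge_sol'_bump_load)
    qed
    have "load f v = h v" if v: "v \<in> verts G" for v
    proof -
      have "(\<Sum>e\<in>inc_arcs G v. complex_of_real (c e) * boundary_slope f e v) =
          complex_of_real (wt v) * (h v / S 1)"
        by (simp add: slope vertex_weight_def sum_distrib_right sum_divide_distrib)
      then show ?thesis using sin_nz vertex_weight_pos[OF v] by (simp add: load_def)
    qed
    then show "\<exists>f\<in>X. (\<forall>v\<in>verts G. load f v = h v) \<and> N f \<le> K * (A / ?s * K) * M h"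
      using f by (auto simp: mult.assoc)
  qed
qed

text \<open>The operator under study is \<open>\<mu> - (- \<Delta>)\<close>, hence the plus sign in
  \<open>f\<close>. Uniqueness on each edge identifies \<open>u\<close> with the solution having its
  own vertex values.\<close>

lemma laplacian_solves:
  assumes ug: "(u, g) \<in> \<Delta>"
  defines "f \<equiv> \<lambda>x. \<mu> * u x + g x"
  shows "f \<in> X" "solves f (\<lambda>v. u (Vert v)) u"
    "\<And>v. v \<in> verts G \<Longrightarrow> C 1 * u (Vert v) - avg (\<lambda>v. u (Vert v)) v = load f v"
proof -
  have u: "u \<in> X" and g: "g \<in> X"
    and d: "\<And>e. e \<in> arcs G \<Longrightarrow> has_second_deriv (\<lambda>t. u (Inner e t)) (\<lambda>t. g (Inner e t))"
    and cont: "continuous_on_graph G u"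
    and kirchhoff: "\<And>v. v \<in> verts G \<Longrightarrow> (\<Sum>e\<in>inc_arcs G v. normal_deriv G c u e v) = 0"
    using ug by (auto simp: laplacian_def)
  show f: "f \<in> X" unfolding f_def by (rule X_lincomb[OF u g])
  show s: "solves f (\<lambda>v. u (Vert v)) u"
    unfolding solves_def
  proof (intro ballI)
    fix e and t :: real assume e: "e \<in> arcs G" and t: "t \<in> {0..1}"
    have "has_second_deriv (\<lambda>t. u (edge_point G e t)) (\<lambda>t. on_edge f e t - \<mu> * u (edge_point G e t))"
      using d[OF e] by (subst has_second_deriv_cong[of _ "\<lambda>t. u (Inner e t)" _ "\<lambda>t. g (Inner e t)"])
        (auto simp: on_edge_def f_def)
    moreover have "continuous_on {0..1} (\<lambda>t. u (edge_point G e t))"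
      using cont e by (simp add: continuous_on_graph_iff)
    ultimately show "u (edge_point G e t) =
        edge_sol (on_edge f e) (u (Vert (tail G e))) (u (Vert (head G e))) t"
      using edge_sol_unique[OF on_edge_integrable[OF f e], of "\<lambda>t. u (edge_point G e t)" t] t by simp
  qed
  show "C 1 * u (Vert v) - avg (\<lambda>v. u (Vert v)) v = load f v" if v: "v \<in> verts G" for v
  proof -
    have "avg (\<lambda>v. u (Vert v)) v - C 1 * u (Vert v) + load f v = 0"
      using sum_normal_deriv[OF f s v] kirchhoff[OF v] sin_nz vertex_weight_pos[OF v] by simp
    then show ?thesis by algebra
  qed
qed

lemma solution_exists:
  assumes f: "f \<in> X" and z: "z \<in> Z"
    and eq: "\<And>v. v \<in> verts G \<Longrightarrow> C 1 * z v - avg z v = load f v"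
  obtains u where "(u, \<lambda>x. f x - \<mu> * u x) \<in> \<Delta>" "solves f z u"
proof -
  define u where "u = glue z (\<lambda>e. edge_sol (on_edge f e) (z (tail G e)) (z (head G e)))"
  have s: "solves f z u"
    unfolding solves_def u_def by (intro ballI glue_edge_point) auto
  obtain B where "u \<in> X \<and> N u \<le> B * (M z + N f)"
    using solution_bound f z s by metis
  then have u: "u \<in> X" by simp
  have "(\<lambda>x. - \<mu> * u x + f x) \<in> X" by (rule X_lincomb[OF u f])
  moreover have "(\<lambda>x. - \<mu> * u x + f x) = (\<lambda>x. f x - \<mu> * u x)" by auto
  ultimately have g: "(\<lambda>x. f x - \<mu> * u x) \<in> X" by simp
  have "continuous_on_graph G u"
    unfolding continuous_on_graph_iff
  proof
    fix e assume e: "e \<in> arcs G"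
    have "continuous_on {0..1} (edge_sol (on_edge f e) (z (tail G e)) (z (head G e)))"
      by (rule continuous_on_edge_sol[OF on_edge_integrable[OF f e]])
    then show "continuous_on {0..1} (\<lambda>t. u (edge_point G e t))"
      by (rule continuous_on_eq) (use s e in \<open>simp add: solves_def\<close>)
  qed
  moreover have "has_second_deriv (\<lambda>t. u (Inner e t)) (\<lambda>t. f (Inner e t) - \<mu> * u (Inner e t))"
    if e: "e \<in> arcs G" for e
    using has_second_deriv_edge_sol[OF on_edge_integrable[OF f e], of "z (tail G e)" "z (head G e)"]
    by (subst has_second_deriv_cong) (auto simp: u_def on_edge_def)
  moreover have "(\<Sum>e\<in>inc_arcs G v. normal_deriv G c u e v) = 0" if v: "v \<in> verts G" for v
  proof -
    have "avg z v - C 1 * z v + load f v = 0" by (simp flip: eq[OF v])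
    then show ?thesis using sum_normal_deriv[OF f s v] by simp
  qed
  ultimately have "(u, \<lambda>x. f x - \<mu> * u x) \<in> \<Delta>" using u g by (simp add: laplacian_def)
  then show ?thesis using that s by blast
qed

text \<open>Elements of the function space are determined up to null functions only, so the load has
  to be well defined on classes; null functions have vanishing edge integrals by
  \<open>Q_zero\<close>.\<close>

lemma load_cong:
  assumes f: "f \<in> X" and g: "g \<in> X" and fg: "N (\<lambda>x. f x - g x) = 0" and v: "v \<in> verts G"
  shows "load f v = load g v"
proof -
  have "(\<lambda>x. - 1 * g x + f x) \<in> X" by (rule X_lincomb[OF g f])
  moreover have "(\<lambda>x. - 1 * g x + f x) = (\<lambda>x. f x - g x)" by auto
  ultimately have d: "(\<lambda>x. f x - g x) \<in> X" by simp
  have "boundary_slope f e v = boundary_slope g e v" if e: "e \<in> inc_arcs G v" for e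
  proof -
    have ea: "e \<in> arcs G" using inc_arcsD[OF e] by simp
    have "edge_L1 G (\<lambda>x. f x - g x) e = 0"
      using Q_zero[OF _ ea] X_Q[OF d] fg by simp
    then have "integral {0..1} (\<lambda>t. cmod (on_edge f e t - on_edge g e t)) = 0"
      by (simp add: edge_L1_def on_edge_def)
    from edge_sol'_cong[OF on_edge_integrable[OF f ea] on_edge_integrable[OF g ea] this]
    show ?thesis by (simp add: boundary_slope_def)
  qed
  then show ?thesis by (simp add: load_def)
qed

lemma resolvent_laplacian_iff:
  "\<mu> \<in> resolvent_set (X, N) (neg_oper \<Delta>) \<longleftrightarrow>
    (\<forall>u g. (u, g) \<in> \<Delta> \<longrightarrow> N (\<lambda>x. \<mu> * u x + g x) = 0 \<longrightarrow> N u = 0) \<and>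
    (\<forall>f\<in>X. \<exists>u g. (u, g) \<in> \<Delta> \<and> N (\<lambda>x. \<mu> * u x + g x - f x) = 0) \<and>
    (\<exists>B. \<forall>u g. (u, g) \<in> \<Delta> \<longrightarrow> N u \<le> B * N (\<lambda>x. \<mu> * u x + g x))"
proof -
  have all: "(\<forall>(u, g)\<in>neg_oper \<Delta>. P u g) \<longleftrightarrow> (\<forall>u g. (u, g) \<in> \<Delta> \<longrightarrow> P u (\<lambda>x. - g x))" for P
    by (auto simp: neg_oper_def)
  have ex: "(\<exists>(u, g)\<in>neg_oper \<Delta>. P u g) \<longleftrightarrow> (\<exists>u g. (u, g) \<in> \<Delta> \<and> P u (\<lambda>x. - g x))" for P
    by (auto simp: neg_oper_def)
  show ?thesis by (simp add: resolvent_set_def all ex)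
qed

lemma resolvent_transition_iff:
  "C 1 \<in> resolvent_set (Z, M) (transition_operator G c (Z, M)) \<longleftrightarrow>
    (\<forall>z\<in>Z. M (\<lambda>v. C 1 * z v - avg z v) = 0 \<longrightarrow> M z = 0) \<and>
    (\<forall>h\<in>Z. \<exists>z\<in>Z. M (\<lambda>v. C 1 * z v - avg z v - h v) = 0) \<and>
    (\<exists>B. \<forall>z\<in>Z. M z \<le> B * M (\<lambda>v. C 1 * z v - avg z v))"
proof -
  have t: "transition_operator G c (Z, M) = {(z, avg z) | z. z \<in> Z}"
    by (auto simp: transition_operator_def avg_def [abs_def])
  have all: "(\<forall>(z, y)\<in>{(z, avg z) | z. z \<in> Z}. P z y) \<longleftrightarrow> (\<forall>z\<in>Z. P z (avg z))" for P by auto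
  have ex: "(\<exists>(z, y)\<in>{(z, avg z) | z. z \<in> Z}. P z y) \<longleftrightarrow> (\<exists>z\<in>Z. P z (avg z))" for P by auto
  show ?thesis unfolding resolvent_set_def t all ex prod.case mem_Collect_eq ..
qed

text \<open>In each direction surjectivity and the lower norm bound are transported; injectivity
  follows from the bound.\<close>

lemma resolvent_correspondence:
  "\<mu> \<in> resolvent_set (X, N) (neg_oper \<Delta>) \<longleftrightarrow>
   C 1 \<in> resolvent_set (Z, M) (transition_operator G c (Z, M))"
proof -
  obtain Bs where Bs: "0 \<le> Bs"
    "\<And>f z u. f \<in> X \<Longrightarrow> z \<in> Z \<Longrightarrow> solves f z u \<Longrightarrow> u \<in> X \<and> N u \<le> Bs * (M z + N f)"
    by (rule solution_bound) blast
  obtain Bt where Bt: "0 \<le> Bt"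
    "\<And>f z u. f \<in> X \<Longrightarrow> u \<in> X \<Longrightarrow> solves f z u \<Longrightarrow> z \<in> Z \<and> M z \<le> Bt * (N u + N f)"
    by (rule trace_bound) blast
  obtain Bl where Bl: "0 \<le> Bl"
    "\<And>f h. f \<in> X \<Longrightarrow> (\<And>v. v \<in> verts G \<Longrightarrow> h v = load f v) \<Longrightarrow> h \<in> Z \<and> M h \<le> Bl * N f"
    by (rule load_bound) blast
  obtain Bf where Bf: "0 \<le> Bf"
    "\<And>h. h \<in> Z \<Longrightarrow> \<exists>f\<in>X. (\<forall>v\<in>verts G. load f v = h v) \<and> N f \<le> Bf * M h"
    by (rule load_surj) blast
  have memZ: "(\<lambda>v. C 1 * z v - avg z v) \<in> Z" if "z \<in> Z" for z
    using lincomb_avg_Z[OF that that, of "C 1" 0] by simp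
  \<comment> \<open>The constant in a resolvent set may be negative, whereas the estimates below
    multiply inequalities by it.\<close>
  have bound_le: "B * N f \<le> max B 0 * N f" if "f \<in> X" for B f
    using N_nonneg[OF that] by (intro mult_right_mono) auto
  have bound_le': "B * M z \<le> max B 0 * M z" if "z \<in> Z" for B z
    using M_nonneg[OF that] by (intro mult_right_mono) auto
  show ?thesis
  proof
    assume "\<mu> \<in> resolvent_set (X, N) (neg_oper \<Delta>)"
    then obtain B where
      surj: "\<And>f. f \<in> X \<Longrightarrow> \<exists>u g. (u, g) \<in> \<Delta> \<and> N (\<lambda>x. \<mu> * u x + g x - f x) = 0"
      and bd: "\<And>u g. (u, g) \<in> \<Delta> \<Longrightarrow> N u \<le> B * N (\<lambda>x. \<mu> * u x + g x)"
      unfolding resolvent_laplacian_iff by blast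
    define D where "D = Bt * ((max B 0 + 1) * Bf)"
    have bound: "M z \<le> D * M (\<lambda>v. C 1 * z v - avg z v)" if z: "z \<in> Z" for z
    proof -
      let ?h = "\<lambda>v. C 1 * z v - avg z v"
      \<comment> \<open>With \<open>(C 1 - P) z\<close> realised as a load, the solution with vertex
        values \<open>z\<close> lies in the domain of the Laplacian, and its resolvent bound
        applies.\<close>
      obtain f where f: "f \<in> X" "\<And>v. v \<in> verts G \<Longrightarrow> load f v = ?h v" "N f \<le> Bf * M ?h"
        using Bf(2)[OF memZ[OF z]] by blast
      obtain u where u: "(u, \<lambda>x. f x - \<mu> * u x) \<in> \<Delta>" "solves f z u"
        by (rule solution_exists[OF f(1) z]) (use f(2) in auto)
      have uX: "u \<in> X" using u(1) by (simp add: laplacian_def)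
      have "N u \<le> B * N f" using bd[OF u(1)] by simp
      then have "N u \<le> max B 0 * N f" using bound_le[OF f(1), of B] by linarith
      then have "N u + N f \<le> (max B 0 + 1) * N f" by (simp add: algebra_simps)
      also have "\<dots> \<le> (max B 0 + 1) * (Bf * M ?h)" using f(3) by (intro mult_left_mono) auto
      finally have "Bt * (N u + N f) \<le> Bt * ((max B 0 + 1) * (Bf * M ?h))"
        using Bt(1) by (intro mult_left_mono)
      moreover have "M z \<le> Bt * (N u + N f)" using Bt(2)[OF f(1) uX u(2)] by simp
      ultimately show ?thesis by (simp add: D_def mult.assoc)
    qed
    have "M z = 0" if "z \<in> Z" "M (\<lambda>v. C 1 * z v - avg z v) = 0" for z
      using bound[OF that(1)] M_nonneg[OF that(1)] that(2) by simp
    moreover have "\<exists>z\<in>Z. M (\<lambda>v. C 1 * z v - avg z v - h v) = 0" if h: "h \<in> Z" for h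
    proof -
      obtain f where f: "f \<in> X" "\<And>v. v \<in> verts G \<Longrightarrow> load f v = h v"
        using Bf(2)[OF h] by blast
      \<comment> \<open>Here \<open>\<mu> u + g\<close> equals \<open>f\<close> only modulo null
        functions, which \<open>load_cong\<close> absorbs.\<close>
      obtain u g where ug: "(u, g) \<in> \<Delta>" "N (\<lambda>x. \<mu> * u x + g x - f x) = 0"
        using surj[OF f(1)] by blast
      have uX: "u \<in> X" using ug(1) by (simp add: laplacian_def)
      note L = laplacian_solves[OF ug(1)]
      have z: "(\<lambda>v. u (Vert v)) \<in> Z" using Bt(2)[OF L(1) uX L(2)] by simp
      have "M (\<lambda>v. C 1 * u (Vert v) - avg (\<lambda>v. u (Vert v)) v - h v) = 0"
        using L(3) load_cong[OF L(1) f(1) ug(2)] f(2) by (intro Z_zero) simp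
      with z show ?thesis by (intro bexI[of _ "\<lambda>v. u (Vert v)"])
    qed
    ultimately show "C 1 \<in> resolvent_set (Z, M) (transition_operator G c (Z, M))"
      unfolding resolvent_transition_iff using bound by blast
  next
    assume "C 1 \<in> resolvent_set (Z, M) (transition_operator G c (Z, M))"
    then obtain B where
      surj: "\<And>h. h \<in> Z \<Longrightarrow> \<exists>z\<in>Z. M (\<lambda>v. C 1 * z v - avg z v - h v) = 0"
      and bd: "\<And>z. z \<in> Z \<Longrightarrow> M z \<le> B * M (\<lambda>v. C 1 * z v - avg z v)"
      unfolding resolvent_transition_iff by blast
    define D where "D = Bs * (max B 0 * Bl + 1)"
    have bound: "N u \<le> D * N (\<lambda>x. \<mu> * u x + g x)" if ug: "(u, g) \<in> \<Delta>" for u g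
    proof -
      let ?f = "\<lambda>x. \<mu> * u x + g x" and ?z = "\<lambda>v. u (Vert v)"
      note L = laplacian_solves[OF ug]
      have uX: "u \<in> X" using ug by (simp add: laplacian_def)
      have z: "?z \<in> Z" using Bt(2)[OF L(1) uX L(2)] by simp
      have "M ?z \<le> max B 0 * M (\<lambda>v. C 1 * ?z v - avg ?z v)"
        using bd[OF z] bound_le'[OF memZ[OF z], of B] by linarith
      also have "\<dots> \<le> max B 0 * (Bl * N ?f)"
        using Bl(2)[OF L(1), of "\<lambda>v. C 1 * ?z v - avg ?z v"] L(3) by (intro mult_left_mono) auto
      finally have "M ?z + N ?f \<le> (max B 0 * Bl + 1) * N ?f" by (simp add: algebra_simps)
      then have "Bs * (M ?z + N ?f) \<le> Bs * ((max B 0 * Bl + 1) * N ?f)"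
        using Bs(1) by (intro mult_left_mono)
      then show ?thesis using Bs(2)[OF L(1) z L(2)] by (simp add: D_def mult.assoc)
    qed
    have "N u = 0" if ug: "(u, g) \<in> \<Delta>" and "N (\<lambda>x. \<mu> * u x + g x) = 0" for u g
    proof -
      have "u \<in> X" using ug by (simp add: laplacian_def)
      then show ?thesis using bound[OF ug] N_nonneg that(2) by force
    qed
    moreover have "\<exists>u g. (u, g) \<in> \<Delta> \<and> N (\<lambda>x. \<mu> * u x + g x - f x) = 0" if f: "f \<in> X" for f
    proof -
      have l: "load f \<in> Z" using Bl(2)[OF f, of "load f"] by simp
      then obtain z where z: "z \<in> Z" "M (\<lambda>v. C 1 * z v - avg z v - load f v) = 0"
        using surj by blast
      have d: "(\<lambda>v. C 1 * z v - avg z v - load f v) \<in> Z"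
        using lincomb_avg_Z[OF z(1) l, of "C 1" 1] by simp
      \<comment> \<open>A null element of \<open>Z\<close> is zero at every vertex, so the Kirchhoff
        conditions hold exactly.\<close>
      have eq: "C 1 * z v - avg z v = load f v" if "v \<in> verts G" for v
        using M_eq_0D[OF d z(2) that] by simp
      obtain u where u: "(u, \<lambda>x. f x - \<mu> * u x) \<in> \<Delta>"
        using solution_exists[OF f z(1) eq] by blast
      have "N (\<lambda>x. \<mu> * u x + (f x - \<mu> * u x) - f x) = 0" using N_zero by simp
      with u show ?thesis by blast
    qed
    ultimately show "\<mu> \<in> resolvent_set (X, N) (neg_oper \<Delta>)"
      unfolding resolvent_laplacian_iff using bound by blast
  qed
qed

end

section \<open>The spaces \<open>L\<^sup>p\<close>\<close>

lemma powr_tangent_le: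
  fixes x m p :: real
  assumes "1 \<le> p" "0 < m" "0 \<le> x"
  shows "m powr p + p * m powr (p - 1) * (x - m) \<le> x powr p"
proof (cases "x = 0")
  case True
  have "p * m powr (p - 1) * m = p * m powr p"
    using assms by (simp add: powr_diff)
  moreover have "m powr p \<le> p * m powr p" using assms by simp
  ultimately show ?thesis using True assms by (simp add: algebra_simps)
next
  case False
  have "x powr p - m powr p \<ge> (p * m powr (p - 1)) * (x - m)"
  proof (rule convex_on_imp_above_tangent[where A = "{0<..}"])
    show "((\<lambda>x. x powr p) has_real_derivative p * m powr (p - 1)) (at m within {0<..})"
      using assms by (auto intro!: derivative_eq_intros simp: powr_diff)
  qed (use assms False in \<open>auto simp: interior_open intro: powr_convex\<close>)
  then show ?thesis by simp
qed

text \<open>Jensen's inequality by summing tangents at \<open>x\<close>. That \<open>x\<close> is at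
  most the weighted mean makes the linear term nonnegative.\<close>

lemma weighted_mean_powr_le:
  fixes a q :: "'a \<Rightarrow> real"
  assumes p: "1 \<le> p" and I: "finite I" and a: "\<And>i. i \<in> I \<Longrightarrow> 0 \<le> a i"
    and q: "\<And>i. i \<in> I \<Longrightarrow> 0 \<le> q i" and w: "0 < sum a I"
    and x: "0 \<le> x" "x * sum a I \<le> (\<Sum>i\<in>I. a i * q i)"
  shows "x powr p * sum a I \<le> (\<Sum>i\<in>I. a i * q i powr p)"
proof (cases "x = 0")
  case True
  then show ?thesis using a by (auto intro!: sum_nonneg)
next
  case False
  have "x powr p * sum a I \<le> x powr p * sum a I +
      p * x powr (p - 1) * ((\<Sum>i\<in>I. a i * q i) - x * sum a I)"
    using x p by (intro le_add_same_cancel1[THEN iffD2] mult_nonneg_nonneg) auto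
  also have "\<dots> = (\<Sum>i\<in>I. a i * (x powr p + p * x powr (p - 1) * (q i - x)))"
    by (simp add: algebra_simps sum.distrib sum_subtractf sum_distrib_left sum_distrib_right)
  also have "\<dots> \<le> (\<Sum>i\<in>I. a i * q i powr p)"
    using False x p q a by (intro sum_mono mult_left_mono powr_tangent_le) auto
  finally show ?thesis .
qed

lemma add_powr_le:
  fixes x y p :: real
  assumes "1 \<le> p" "0 \<le> x" "0 \<le> y"
  shows "(x + y) powr p \<le> 2 powr p * (x powr p + y powr p)"
proof -
  have "(x + y) powr p \<le> (2 * max x y) powr p" using assms by (intro powr_mono2) auto
  also have "\<dots> = 2 powr p * max x y powr p" using assms by (simp add: powr_mult)
  also have "\<dots> \<le> 2 powr p * (x powr p + y powr p)"
    by (intro mult_left_mono) (auto simp: max_def)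
  finally show ?thesis .
qed

lemma two_le_powr: "1 \<le> p \<Longrightarrow> 2 \<le> (2::real) powr p"
  using powr_mono[of 1 p "2::real"] by simp

lemma Lp_interval_cong:
  assumes "\<And>t. t \<in> {0<..<1} \<Longrightarrow> w t = w' t"
  shows "Lp_interval p w \<longleftrightarrow> Lp_interval p w'" "Lp_integral p w = Lp_integral p w'"
proof -
  have "(\<lambda>t. indicator {0<..<1} t *\<^sub>R w t) = (\<lambda>t. indicator {0<..<1} t *\<^sub>R w' t)"
    "(\<lambda>t. indicator {0<..<1} t *\<^sub>R cmod (w t) powr p) = (\<lambda>t. indicator {0<..<1} t *\<^sub>R cmod (w' t) powr p)"
    using assms by (auto simp: indicator_def fun_eq_iff)
  then show "Lp_interval p w \<longleftrightarrow> Lp_interval p w'" "Lp_integral p w = Lp_integral p w'"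
    by (simp_all add: Lp_interval_def Lp_integral_def set_borel_measurable_def
        set_integrable_def set_lebesgue_integral_def)
qed

lemma Lp_integral_nonneg: "0 \<le> Lp_integral p w"
  unfolding Lp_integral_def set_lebesgue_integral_def by (intro integral_nonneg_AE) auto

lemma set_integrable_const_unit: "set_integrable lebesgue {0<..<1::real} (\<lambda>t. k :: real)"
  using absolutely_integrable_continuous_real[of 0 1 "\<lambda>t. k"]
    absolutely_integrable_on_open_interval[of "0::real" 1 "\<lambda>t. k"] by simp

text \<open>The interval has measure 1, so Jensen's inequality holds without a constant: the tangent
  at the mean \<open>m\<close> is integrated.\<close>

lemma Lp_interval_L1:
  assumes p: "1 \<le> p" and w: "Lp_interval p w"
  shows "w absolutely_integrable_on {0..1}"
    and "integral {0..1} (\<lambda>t. cmod (w t)) powr p \<le> Lp_integral p w"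
proof -
  have i: "set_integrable lebesgue {0<..<1} (\<lambda>t. cmod (w t) powr p)"
    and m: "set_borel_measurable lebesgue {0<..<1} w" using w by (auto simp: Lp_interval_def)
  have "set_integrable lebesgue {0<..<1} w"
  proof (rule set_integrable_bound[OF set_integral_add(1)[OF set_integrable_const_unit[of 1] i] m])
    \<comment> \<open>Integrability comes from this domination: where \<open>y\<close> exceeds 1 the
      power is larger, elsewhere 1 suffices.\<close>
    have "y \<le> 1 + y powr p" if "0 \<le> y" for y :: real
      using powr_mono[of 1 p y] p that by (cases "y \<le> 1") (auto intro: add_increasing2)
    then show "AE t in lebesgue. t \<in> {0<..<1} \<longrightarrow> cmod (w t) \<le> norm (1 + cmod (w t) powr p)"
      by simp
  qed
  then show a: "w absolutely_integrable_on {0..1}"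
    using absolutely_integrable_on_open_interval[of 0 1 w] by simp
  define m where "m = integral {0..1} (\<lambda>t. cmod (w t))"
  have wi: "(\<lambda>t. cmod (w t)) integrable_on {0..1}" using a by (simp add: absolutely_integrable_on_def)
  then have m0: "0 \<le> m" unfolding m_def by (rule Henstock_Kurzweil_Integration.integral_nonneg) simp
  show "integral {0..1} (\<lambda>t. cmod (w t)) powr p \<le> Lp_integral p w"
  proof (cases "m = 0")
    case True
    then show ?thesis using Lp_integral_nonneg by (simp add: m_def)
  next
    case False
    have J: "(\<lambda>t. cmod (w t) powr p) integrable_on {0..1}"
      "Lp_integral p w = integral {0..1} (\<lambda>t. cmod (w t) powr p)"
      using set_lebesgue_integral_eq_integral[OF i]
      by (simp_all add: Lp_integral_def integral_open_interval_real integrable_on_open_interval_real)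
    let ?k = "p * m powr (p - 1)"
    have const: "((\<lambda>t. k) has_integral k) {0..1::real}" for k :: real
      using has_integral_const_real[of k 0 1] by simp
    \<comment> \<open>At the mean the linear term of the tangent integrates to 0.\<close>
    have "((\<lambda>t. m powr p + ?k * (cmod (w t) - m)) has_integral m powr p + ?k * (m - m)) {0..1}"
      by (intro has_integral_add has_integral_mult_right has_integral_diff const
          integrable_integral[OF wi, folded m_def])
    then have h: "((\<lambda>t. m powr p + ?k * (cmod (w t) - m)) has_integral m powr p) {0..1}"
      by simp
    have "m powr p \<le> integral {0..1} (\<lambda>t. cmod (w t) powr p)"
      by (rule has_integral_le[OF h integrable_integral[OF J(1)]])
         (use False m0 p in \<open>auto intro: powr_tangent_le\<close>)
    then show ?thesis by (simp add: J m_def)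
  qed
qed

lemma Lp_interval_lincomb:
  assumes p: "1 \<le> p" and w: "Lp_interval p w" and w': "Lp_interval p w'"
  shows "Lp_interval p (\<lambda>t. a * w t + w' t)"
    and "Lp_integral p (\<lambda>t. a * w t + w' t) \<le>
      2 powr p * (cmod a powr p * Lp_integral p w + Lp_integral p w')"
proof -
  let ?v = "\<lambda>t. a * w t + w' t"
  let ?B = "\<lambda>t. 2 powr p * (cmod a powr p * cmod (w t) powr p + cmod (w' t) powr p)"
  have m: "set_borel_measurable lebesgue {0<..<1} ?v"
  proof -
    have "(\<lambda>t. a * (indicator {0<..<1} t *\<^sub>R w t) + indicator {0<..<1} t *\<^sub>R w' t) \<in> borel_measurable lebesgue"
      using w w' unfolding Lp_interval_def set_borel_measurable_def
      by (intro borel_measurable_add borel_measurable_times) auto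
    then show ?thesis
      unfolding set_borel_measurable_def by (simp add: algebra_simps scaleR_conv_of_real)
  qed
  have i: "set_integrable lebesgue {0<..<1} (\<lambda>t. cmod (w t) powr p)"
    "set_integrable lebesgue {0<..<1} (\<lambda>t. cmod (w' t) powr p)"
    using w w' by (auto simp: Lp_interval_def)
  have B: "set_integrable lebesgue {0<..<1} ?B"
    by (intro set_integrable_mult_right set_integral_add i)
  have le: "cmod (?v t) powr p \<le> ?B t" for t
  proof -
    have "cmod (?v t) powr p \<le> (cmod a * cmod (w t) + cmod (w' t)) powr p"
      using p by (intro powr_mono2) (auto simp: norm_mult[symmetric] norm_triangle_ineq)
    also have "\<dots> \<le> 2 powr p * ((cmod a * cmod (w t)) powr p + cmod (w' t) powr p)"
      using p by (intro add_powr_le) auto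
    finally show ?thesis by (simp add: powr_mult)
  qed
  have "set_borel_measurable lebesgue {0<..<1} (\<lambda>t. cmod (?v t) powr p)"
  proof -
    have "(\<lambda>t. cmod (indicator {0<..<1} t *\<^sub>R ?v t) powr p) \<in> borel_measurable lebesgue"
      by (intro powr_real_measurable measurable_compose[OF m[unfolded set_borel_measurable_def]]
          borel_measurable_norm borel_measurable_const)
    moreover have "(\<lambda>t. cmod (indicator {0<..<1} t *\<^sub>R ?v t) powr p)
        = (\<lambda>t. indicator {0<..<1} t *\<^sub>R cmod (?v t) powr p)"
      using p by (auto simp: indicator_def)
    ultimately show ?thesis by (simp add: set_borel_measurable_def)
  qed
  then have v: "set_integrable lebesgue {0<..<1} (\<lambda>t. cmod (?v t) powr p)"
    using order_trans[OF le abs_ge_self] by (intro set_integrable_bound[OF B]) auto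
  then show "Lp_interval p ?v" using m by (simp add: Lp_interval_def)
  have "Lp_integral p ?v \<le> (LINT t:{0<..<1}|lebesgue. ?B t)"
    unfolding Lp_integral_def by (intro set_integral_mono v B le)
  also have "\<dots> = 2 powr p * (cmod a powr p * Lp_integral p w + Lp_integral p w')"
    unfolding Lp_integral_def using i by (simp add: set_integral_add)
  finally show "Lp_integral p ?v \<le> 2 powr p * (cmod a powr p * Lp_integral p w + Lp_integral p w')" .
qed

lemma Lp_interval_continuous:
  assumes w: "continuous_on {0<..<1} w" and q: "\<And>t. t \<in> {0<..<1} \<Longrightarrow> cmod (w t) \<le> q"
    and p: "0 < p"
  shows "Lp_interval p w" and "Lp_integral p w \<le> q powr p"
proof -
  have mm: "set_borel_measurable lebesgue {0<..<1} f" if "continuous_on {0<..<1} f"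
    for f :: "real \<Rightarrow> 'a :: {real_normed_vector, second_countable_topology}"
  proof -
    have "(\<lambda>t. indicator {0<..<1} t *\<^sub>R f t) \<in> borel_measurable borel"
      using set_measurable_continuous_on[OF _ that] by (simp add: set_borel_measurable_def)
    then have "(\<lambda>t. indicator {0<..<1} t *\<^sub>R f t) \<in> borel_measurable lborel" by simp
    then show ?thesis unfolding set_borel_measurable_def by (rule measurable_completion)
  qed
  have le: "cmod (w t) powr p \<le> q powr p" if "t \<in> {0<..<1}" for t
    using p q[OF that] by (intro powr_mono2) auto
  have "continuous_on {0<..<1} (\<lambda>t. cmod (w t) powr p)"
    using w p by (intro continuous_on_powr' continuous_intros) auto
  then have i: "set_integrable lebesgue {0<..<1} (\<lambda>t. cmod (w t) powr p)"
    using le by (intro set_integrable_bound[OF set_integrable_const_unit[of "q powr p"] mm]) auto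
  show "Lp_interval p w" unfolding Lp_interval_def using mm[OF w] i by simp
  have "Lp_integral p w \<le> (LINT t:{0<..<1::real}|lebesgue. q powr p)"
    unfolding Lp_integral_def by (intro set_integral_mono i set_integrable_const_unit le)
  also have "\<dots> = q powr p"
    using set_lebesgue_integral_eq_integral(2)[OF set_integrable_const_unit[of "q powr p"]]
    by (simp add: integral_open_interval_real[symmetric])
  finally show "Lp_integral p w \<le> q powr p" .
qed

lemma nonneg_summable_infsum_le:
  fixes f :: "'a \<Rightarrow> real"
  assumes "\<And>x. x \<in> A \<Longrightarrow> 0 \<le> f x"
    and "\<And>F. finite F \<Longrightarrow> F \<subseteq> A \<Longrightarrow> sum f F \<le> B"
  shows "f summable_on A" "infsum f A \<le> B"
proof -
  show s: "f summable_on A"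
    using assms by (intro nonneg_bdd_above_summable_on bdd_aboveI2[of _ _ B]) auto
  show "infsum f A \<le> B" using s assms(2) by (rule infsum_le_finite_sums)
qed

lemma continuous_on_Lipschitz:
  fixes g :: "real \<Rightarrow> complex"
  assumes "\<And>s t. s \<in> A \<Longrightarrow> t \<in> A \<Longrightarrow> cmod (g s - g t) \<le> L * \<bar>s - t\<bar>"
  shows "continuous_on A g"
proof -
  have "(max L 0)-lipschitz_on A g"
  proof (rule lipschitz_onI)
    fix s t assume st: "s \<in> A" "t \<in> A"
    have "L * \<bar>s - t\<bar> \<le> max L 0 * \<bar>s - t\<bar>" by (intro mult_right_mono) auto
    then show "dist (g s) (g t) \<le> max L 0 * dist s t"
      using assms[OF st] by (simp add: dist_norm)
  qed simp
  then show ?thesis by (rule lipschitz_on_continuous_on)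
qed

section \<open>Weighted \<open>l^p\<close> bounds on edges and vertices\<close>

context equilateral_metric_graph
begin

text \<open>Bounding all finite partial sums expresses summability and the norm bound in one
  condition.\<close>

definition lp_bound :: "real \<Rightarrow> ('e \<Rightarrow> real) \<Rightarrow> real \<Rightarrow> bool" where
  "lp_bound p q b \<longleftrightarrow> 0 \<le> b \<and> (\<forall>e\<in>arcs G. 0 \<le> q e) \<and>
     (\<forall>F. finite F \<longrightarrow> F \<subseteq> arcs G \<longrightarrow> (\<Sum>e\<in>F. c e * q e powr p) \<le> b powr p)"

lemma lp_bound_scale:
  assumes p: "1 \<le> p" and q: "lp_bound p q b" and a: "0 \<le> a"
  shows "lp_bound p (\<lambda>e. a * q e) (a * b)"
  unfolding lp_bound_def
proof (intro conjI ballI allI impI)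
  fix F assume F: "finite F" "F \<subseteq> arcs G"
  have "(\<Sum>e\<in>F. c e * (a * q e) powr p) = a powr p * (\<Sum>e\<in>F. c e * q e powr p)"
    unfolding sum_distrib_left
    using F q a by (intro sum.cong) (auto simp: lp_bound_def powr_mult)
  also have "\<dots> \<le> a powr p * b powr p"
    using F q by (intro mult_left_mono) (auto simp: lp_bound_def)
  also have "\<dots> = (a * b) powr p" using a q by (simp add: powr_mult lp_bound_def)
  finally show "(\<Sum>e\<in>F. c e * (a * q e) powr p) \<le> (a * b) powr p" .
qed (use q a in \<open>auto simp: lp_bound_def\<close>)

text \<open>The 4 is 2 times 2: one factor from the power of a sum, the other from adding two
  bounds, absorbed by \<open>2 \<le> 2 powr p\<close>. It is the constant \<open>K\<close> of the
  \<open>L^p\<close> case.\<close>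

lemma sum_c_add_powr_le:
  assumes p: "1 \<le> p" and F: "F \<subseteq> arcs G" and 0: "0 \<le> b"
    and q: "\<And>e. e \<in> F \<Longrightarrow> 0 \<le> q e" "\<And>e. e \<in> F \<Longrightarrow> 0 \<le> q' e"
    and s: "(\<Sum>e\<in>F. c e * q e powr p) \<le> b powr p" "(\<Sum>e\<in>F. c e * q' e powr p) \<le> b powr p"
  shows "(\<Sum>e\<in>F. c e * (q e + q' e) powr p) \<le> (4 * b) powr p"
proof -
  have c: "0 \<le> c e" if "e \<in> F" for e using that F conductivity_pos[of e] by auto
  have "(\<Sum>e\<in>F. c e * (q e + q' e) powr p) \<le> (\<Sum>e\<in>F. c e * (2 powr p * (q e powr p + q' e powr p)))"
    using p q c by (intro sum_mono mult_left_mono add_powr_le) auto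
  also have "\<dots> = 2 powr p * ((\<Sum>e\<in>F. c e * q e powr p) + (\<Sum>e\<in>F. c e * q' e powr p))"
    by (simp add: sum.distrib[symmetric] sum_distrib_left algebra_simps)
  also have "\<dots> \<le> 2 powr p * (b powr p + b powr p)"
    by (intro mult_left_mono add_mono s) auto
  also have "\<dots> = 2 * (2 powr p * b powr p)" by simp
  also have "\<dots> \<le> 2 powr p * (2 powr p * b powr p)"
    using two_le_powr[OF p] by (intro mult_right_mono) auto
  also have "\<dots> = (4 * b) powr p"
    using 0 powr_mult[of 2 2 p] by (simp add: powr_mult mult.assoc[symmetric])
  finally show ?thesis .
qed

text \<open>Edges are grouped by their selected end. Each group consists of edges at that vertex, so
  its conductivities add up to at most the vertex weight. The selection is \<open>tail G\<close> or
  \<open>head G\<close> later.\<close>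

lemma sum_c_vertex_le:
  assumes "finite F" "F \<subseteq> arcs G" and "\<And>v. v \<in> verts G \<Longrightarrow> 0 \<le> g v"
    and g: "(\<lambda>v. g v * vertex_weight G c v) summable_on verts G"
    and v: "\<And>e. e \<in> arcs G \<Longrightarrow> v e \<in> verts G \<and> e \<in> inc_arcs G (v e)"
  shows "(\<Sum>e\<in>F. c e * g (v e)) \<le> (\<Sum>\<^sub>\<infinity>v\<in>verts G. g v * vertex_weight G c v)"
proof -
  have "(\<Sum>e\<in>F. c e * g (v e)) = (\<Sum>w\<in>v ` F. \<Sum>e\<in>{e \<in> F. v e = w}. c e * g (v e))"
    by (rule sum.image_gen[OF assms(1)])
  also have "\<dots> \<le> (\<Sum>w\<in>v ` F. g w * vertex_weight G c w)"
  proof (rule sum_mono)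
    fix w assume "w \<in> v ` F"
    then have w: "w \<in> verts G" using v assms(2) by auto
    have "(\<Sum>e\<in>{e \<in> F. v e = w}. c e * g (v e)) = g w * (\<Sum>e\<in>{e \<in> F. v e = w}. c e)"
      by (simp add: sum_distrib_left mult.commute)
    also have "\<dots> \<le> g w * vertex_weight G c w"
      unfolding vertex_weight_def
    proof (intro mult_left_mono sum_mono2 finite_inc_arcs[OF w] assms(3)[OF w])
      show "{e \<in> F. v e = w} \<subseteq> inc_arcs G w" using v assms(2) by blast
      show "0 \<le> c e" if "e \<in> inc_arcs G w - {e \<in> F. v e = w}" for e
        using that inc_arcsD[of e w] conductivity_pos[of e] by simp
    qed
    finally show "(\<Sum>e\<in>{e \<in> F. v e = w}. c e * g (v e)) \<le> g w * vertex_weight G c w" .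
  qed
  also have "\<dots> \<le> (\<Sum>\<^sub>\<infinity>v\<in>verts G. g v * vertex_weight G c v)"
    using assms(1,2,3) vertex_weight_nonneg v
    by (intro finite_sum_le_infsum g) auto
  finally show ?thesis .
qed

text \<open>Incoming edges of different vertices are disjoint, and so are outgoing ones; each family
  contributes one \<open>B\<close>.\<close>

lemma sum_inc_arcs_le:
  fixes g :: "'e \<Rightarrow> real"
  assumes F: "finite F" "F \<subseteq> verts G" and g: "\<And>e. e \<in> arcs G \<Longrightarrow> 0 \<le> g e"
    and B: "\<And>F. finite F \<Longrightarrow> F \<subseteq> arcs G \<Longrightarrow> sum g F \<le> B"
  shows "(\<Sum>v\<in>F. \<Sum>e\<in>inc_arcs G v. g e) \<le> B + B"
proof -
  have fin: "finite (in_arcs G v)" "finite (out_arcs G v)" if "v \<in> F" for v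
    using finite_inc_arcs[of v] that F unfolding inc_arcs_def by auto
  have "(\<Sum>v\<in>F. \<Sum>e\<in>inc_arcs G v. g e) \<le> (\<Sum>v\<in>F. (\<Sum>e\<in>in_arcs G v. g e) + (\<Sum>e\<in>out_arcs G v. g e))"
  proof (rule sum_mono)
    fix v assume v: "v \<in> F"
    have "(\<Sum>e\<in>inc_arcs G v. g e) + (\<Sum>e\<in>in_arcs G v \<inter> out_arcs G v. g e) =
        (\<Sum>e\<in>in_arcs G v. g e) + (\<Sum>e\<in>out_arcs G v. g e)"
      unfolding inc_arcs_def by (rule sum.union_inter[OF fin[OF v]])
    moreover have "0 \<le> (\<Sum>e\<in>in_arcs G v \<inter> out_arcs G v. g e)"
      using g by (intro sum_nonneg) auto
    ultimately show "(\<Sum>e\<in>inc_arcs G v. g e) \<le> (\<Sum>e\<in>in_arcs G v. g e) + (\<Sum>e\<in>out_arcs G v. g e)"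
      by linarith
  qed
  also have "\<dots> = sum g (\<Union>v\<in>F. in_arcs G v) + sum g (\<Union>v\<in>F. out_arcs G v)"
    unfolding sum.distrib using F fin
    by (subst (1 2) sum.UNION_disjoint) (auto simp: in_arcs_def out_arcs_def)
  also have "\<dots> \<le> B + B" using F fin by (intro add_mono B) auto
  finally show ?thesis .
qed

lemma space_pair_Lp:
  assumes p: "1 \<le> p"
  shows "space_pair G c (fst (Lp_graph_space G c p)) (snd (Lp_graph_space G c p))
    (fst (lp_vertex_space G c p)) (snd (lp_vertex_space G c p)) (lp_bound p) 4"
proof (unfold_locales, goal_cases)
  case 1 show ?case by simp
next
  case (2 u v \<alpha>)
  let ?u = "\<lambda>e t. u (Inner e t)" and ?v = "\<lambda>e t. v (Inner e t)"
  have uv: "\<And>e. e \<in> arcs G \<Longrightarrow> Lp_interval p (?u e)" "\<And>e. e \<in> arcs G \<Longrightarrow> Lp_interval p (?v e)"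
    "(\<lambda>e. c e * Lp_integral p (?u e)) summable_on arcs G"
    "(\<lambda>e. c e * Lp_integral p (?v e)) summable_on arcs G"
    using 2 by (auto simp: Lp_graph_space_def)
  have "(\<lambda>e. 2 powr p * (cmod \<alpha> powr p * (c e * Lp_integral p (?u e)) + c e * Lp_integral p (?v e)))
      summable_on arcs G"
    by (intro summable_on_cmult_right summable_on_add uv)
  then have "(\<lambda>e. c e * Lp_integral p (\<lambda>t. \<alpha> * ?u e t + ?v e t)) summable_on arcs G"
  proof (rule summable_on_comparison_test)
    fix e assume e: "e \<in> arcs G"
    have "c e * Lp_integral p (\<lambda>t. \<alpha> * ?u e t + ?v e t) \<le>
        c e * (2 powr p * (cmod \<alpha> powr p * Lp_integral p (?u e) + Lp_integral p (?v e)))"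
      using conductivity_pos[OF e] by (intro mult_left_mono Lp_interval_lincomb p uv e) auto
    then show "c e * Lp_integral p (\<lambda>t. \<alpha> * ?u e t + ?v e t) \<le>
        2 powr p * (cmod \<alpha> powr p * (c e * Lp_integral p (?u e)) + c e * Lp_integral p (?v e))"
      by (simp add: algebra_simps)
    show "0 \<le> c e * Lp_integral p (\<lambda>t. \<alpha> * ?u e t + ?v e t)"
      using conductivity_pos[OF e] Lp_integral_nonneg by simp
  qed
  then show ?case
    using Lp_interval_lincomb(1)[OF p uv(1) uv(2)] by (simp add: Lp_graph_space_def)
next
  case (3 u e)
  then have "Lp_interval p (\<lambda>t. u (Inner e t))" by (simp add: Lp_graph_space_def)
  then have "Lp_interval p (\<lambda>t. u (edge_point G e t))"
    by (subst Lp_interval_cong) auto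
  then show ?case by (rule Lp_interval_L1[OF p])
next
  case (4 u) show ?case by (simp add: Lp_graph_space_def)
next
  case (5 z) show ?case by (simp add: lp_vertex_space_def)
next
  \<comment> \<open>Assumption \<open>X_Q\<close>: Jensen on each edge compares edge integrals with
    the \<open>L^p\<close> norm.\<close>
  case (6 u)
  let ?u = "\<lambda>e t. u (Inner e t)"
  let ?A = "\<Sum>\<^sub>\<infinity>e\<in>arcs G. c e * Lp_integral p (?u e)"
  have u: "\<And>e. e \<in> arcs G \<Longrightarrow> Lp_interval p (?u e)"
    "(\<lambda>e. c e * Lp_integral p (?u e)) summable_on arcs G"
    using 6 by (auto simp: Lp_graph_space_def)
  have nn: "0 \<le> c e * Lp_integral p (?u e)" if "e \<in> arcs G" for e
    using conductivity_pos[OF that] Lp_integral_nonneg by simp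
  have A0: "0 \<le> ?A" by (intro infsum_nonneg nn)
  have le: "edge_L1 G u e powr p \<le> Lp_integral p (?u e)" "0 \<le> edge_L1 G u e" if e: "e \<in> arcs G" for e
  proof -
    have eq: "Lp_integral p (?u e) = Lp_integral p (\<lambda>t. u (edge_point G e t))"
      and i: "Lp_interval p (\<lambda>t. u (edge_point G e t))"
      using u(1)[OF e] Lp_interval_cong[of "?u e" "\<lambda>t. u (edge_point G e t)" p] by auto
    show "edge_L1 G u e powr p \<le> Lp_integral p (?u e)"
      unfolding eq edge_L1_def by (rule Lp_interval_L1[OF p i])
    show "0 \<le> edge_L1 G u e" unfolding edge_L1_def
      using Lp_interval_L1(1)[OF p i]
      by (intro Henstock_Kurzweil_Integration.integral_nonneg) (auto simp: absolutely_integrable_on_def)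
  qed
  have "(\<Sum>e\<in>F. c e * edge_L1 G u e powr p) \<le> ?A" if F: "finite F" "F \<subseteq> arcs G" for F
  proof -
    have "(\<Sum>e\<in>F. c e * edge_L1 G u e powr p) \<le> (\<Sum>e\<in>F. c e * Lp_integral p (?u e))"
      using F le conductivity_nonneg by (intro sum_mono mult_left_mono) auto
    also have "\<dots> \<le> ?A" using F nn by (intro finite_sum_le_infsum u) auto
    finally show ?thesis .
  qed
  moreover have "(?A powr (1 / p)) powr p = ?A" using A0 p by (simp add: powr_powr)
  ultimately show ?case using le by (simp add: lp_bound_def Lp_graph_space_def)
next
  case (7 z)
  let ?g = "\<lambda>v. cmod (z v) powr p"
  let ?A = "\<Sum>\<^sub>\<infinity>v\<in>verts G. ?g v * vertex_weight G c v"
  have s: "(\<lambda>v. ?g v * vertex_weight G c v) summable_on verts G"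
    using 7 by (simp add: lp_vertex_space_def)
  have A0: "0 \<le> ?A" using vertex_weight_nonneg by (intro infsum_nonneg) auto
  have A: "(?A powr (1 / p)) powr p = ?A" using A0 p by (simp add: powr_powr)
  have "(\<Sum>e\<in>F. c e * (cmod (z (tail G e)) + cmod (z (head G e))) powr p) \<le> (4 * ?A powr (1 / p)) powr p"
    if F: "finite F" "F \<subseteq> arcs G" for F
  proof (rule sum_c_add_powr_le[OF p F(2)])
    show "(\<Sum>e\<in>F. c e * cmod (z (tail G e)) powr p) \<le> (?A powr (1 / p)) powr p"
      unfolding A by (rule sum_c_vertex_le[OF F _ s]) (auto simp: inc_arcs_iff)
    show "(\<Sum>e\<in>F. c e * cmod (z (head G e)) powr p) \<le> (?A powr (1 / p)) powr p"
      unfolding A by (rule sum_c_vertex_le[OF F _ s]) (auto simp: inc_arcs_iff)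
  qed auto
  then show ?case by (simp add: lp_bound_def lp_vertex_space_def)
next
  case 8 show ?case by (simp add: lp_bound_def)
next
  case (9 q b a) then show ?case by (rule lp_bound_scale[OF p])
next
  case (10 q b q' b')
  have b: "0 \<le> b" "0 \<le> b'" using 10 by (auto simp: lp_bound_def)
  have "(\<Sum>e\<in>F. c e * (q e + q' e) powr p) \<le> (4 * (b + b')) powr p"
    if F: "finite F" "F \<subseteq> arcs G" for F
  proof (rule sum_c_add_powr_le[OF p F(2)])
    have "b powr p \<le> (b + b') powr p" "b' powr p \<le> (b + b') powr p"
      using b p by (auto intro!: powr_mono2)
    then show "(\<Sum>e\<in>F. c e * q e powr p) \<le> (b + b') powr p" "(\<Sum>e\<in>F. c e * q' e powr p) \<le> (b + b') powr p"
      using 10 F unfolding lp_bound_def by (meson order_trans)+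
  qed (use b 10 F in \<open>auto simp: lp_bound_def\<close>)
  then show ?case using 10 by (auto simp: lp_bound_def)
next
  case (11 q e)
  then have "(\<Sum>e\<in>{e}. c e * q e powr p) \<le> 0 powr p" unfolding lp_bound_def by blast
  then have "c e * q e powr p \<le> 0" using p by simp
  then have "q e powr p \<le> 0" using conductivity_pos[OF 11(2)] by (simp add: mult_le_0_iff)
  then show ?case by simp
next
  \<comment> \<open>Assumption \<open>Q_X\<close>: the Lipschitz bounds give continuity and thus
    measurability, and on an edge of length 1 the sup bound dominates the integral by
    \<open>q e powr p\<close>.\<close>
  case (12 q b u)
  let ?u = "\<lambda>e t. u (Inner e t)"
  have Le: "Lp_interval p (?u e)" "Lp_integral p (?u e) \<le> q e powr p" if e: "e \<in> arcs G" for e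
  proof -
    have "continuous_on {0..1} (\<lambda>t. u (edge_point G e t))"
      using 12(3)[OF e] by (rule continuous_on_Lipschitz)
    then have "continuous_on {0<..<1} (\<lambda>t. u (edge_point G e t))"
      by (rule continuous_on_subset) auto
    then have cont: "continuous_on {0<..<1} (?u e)" by (rule continuous_on_eq) simp
    have q: "cmod (?u e t) \<le> q e" if "t \<in> {0<..<1}" for t
      using 12(2)[OF e, of t] that by simp
    show "Lp_interval p (?u e)" "Lp_integral p (?u e) \<le> q e powr p"
      using Lp_interval_continuous[OF cont q] p by auto
  qed
  have nn: "0 \<le> c e * Lp_integral p (?u e)" if "e \<in> arcs G" for e
    using conductivity_pos[OF that] Lp_integral_nonneg by simp
  have b: "0 \<le> b" using 12(1) by (simp add: lp_bound_def)
  have B: "(\<Sum>e\<in>F. c e * Lp_integral p (?u e)) \<le> b powr p" if F: "finite F" "F \<subseteq> arcs G" for F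
  proof -
    have "(\<Sum>e\<in>F. c e * Lp_integral p (?u e)) \<le> (\<Sum>e\<in>F. c e * q e powr p)"
      using F Le conductivity_nonneg by (intro sum_mono mult_left_mono) auto
    also have "\<dots> \<le> b powr p" using F 12(1) by (auto simp: lp_bound_def)
    finally show ?thesis .
  qed
  note S = nonneg_summable_infsum_le[OF nn B]
  have "(\<Sum>\<^sub>\<infinity>e\<in>arcs G. c e * Lp_integral p (?u e)) powr (1 / p) \<le> (b powr p) powr (1 / p)"
    using p S(2) by (intro powr_mono2 infsum_nonneg nn) auto
  also have "\<dots> = b" using p b by (simp add: powr_powr)
  finally show ?case using S(1) Le b by (simp add: Lp_graph_space_def)
next
  \<comment> \<open>Assumption \<open>Q_Z\<close>: Jensen over the edges at each vertex, after which
    every edge is counted at its two ends.\<close>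
  case (13 q b z)
  let ?g = "\<lambda>v. cmod (z v) powr p * vertex_weight G c v"
  have nn: "0 \<le> ?g v" if "v \<in> verts G" for v using vertex_weight_pos[OF that] by simp
  have b: "0 \<le> b" using 13(1) by (simp add: lp_bound_def)
  have B: "sum ?g F \<le> (2 * b) powr p" if F: "finite F" "F \<subseteq> verts G" for F
  proof -
    have "sum ?g F \<le> (\<Sum>v\<in>F. \<Sum>e\<in>inc_arcs G v. c e * q e powr p)"
    proof (rule sum_mono)
      fix v assume "v \<in> F"
      then have v: "v \<in> verts G" using F by auto
      show "?g v \<le> (\<Sum>e\<in>inc_arcs G v. c e * q e powr p)"
        unfolding vertex_weight_def
      proof (rule weighted_mean_powr_le[OF p finite_inc_arcs[OF v]])
        show "cmod (z v) * sum c (inc_arcs G v) \<le> (\<Sum>e\<in>inc_arcs G v. c e * q e)"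
          using 13(2)[OF v] by (simp add: vertex_weight_def)
        show "0 < sum c (inc_arcs G v)" using vertex_weight_pos[OF v] by (simp add: vertex_weight_def)
      qed (use 13(1) conductivity_nonneg in \<open>auto simp: lp_bound_def dest!: inc_arcsD\<close>)
    qed
    also have "\<dots> \<le> b powr p + b powr p"
      using 13(1) conductivity_nonneg
      by (intro sum_inc_arcs_le F) (auto simp: lp_bound_def)
    also have "\<dots> = 2 * b powr p" by simp
    also have "\<dots> \<le> 2 powr p * b powr p" using two_le_powr[OF p] by (intro mult_right_mono) auto
    also have "\<dots> = (2 * b) powr p" using b by (simp add: powr_mult)
    finally show ?thesis .
  qed
  note S = nonneg_summable_infsum_le[OF nn B]
  have "(\<Sum>\<^sub>\<infinity>v\<in>verts G. ?g v) powr (1 / p) \<le> ((2 * b) powr p) powr (1 / p)"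
    using p S(2) by (intro powr_mono2 infsum_nonneg nn) auto
  also have "\<dots> = 2 * b" using p b by (simp add: powr_powr)
  finally show ?case using S(1) b by (simp add: lp_vertex_space_def)
qed

end

section \<open>The spaces \<open>C\<^sub>0\<close> and \<open>BUC\<close>\<close>

lemma sup_norm_upper:
  assumes "bounded (u ` A)" "x \<in> A"
  shows "cmod (u x) \<le> sup_norm A u"
  unfolding sup_norm_def
proof (rule cSUP_upper[OF assms(2)])
  obtain B where "\<And>y. y \<in> u ` A \<Longrightarrow> cmod y \<le> B" using assms(1) unfolding bounded_iff by blast
  then show "bdd_above ((\<lambda>x. cmod (u x)) ` A)" by (intro bdd_aboveI2[of _ _ B]) auto
qed

lemma sup_norm_least:
  assumes "A \<noteq> {}" "\<And>x. x \<in> A \<Longrightarrow> cmod (u x) \<le> B"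
  shows "sup_norm A u \<le> B"
  unfolding sup_norm_def using assms by (rule cSUP_least)

lemma sup_norm_nonneg:
  assumes "bounded (u ` A)" "A \<noteq> {}"
  shows "0 \<le> sup_norm A u"
  using assms sup_norm_upper order_trans[OF norm_ge_zero] by (metis all_not_in_conv)

lemma bounded_lincomb:
  fixes u v :: "'a \<Rightarrow> complex"
  assumes "bounded (u ` A)" "bounded (v ` A)"
  shows "bounded ((\<lambda>x. \<alpha> * u x + v x) ` A)"
proof -
  obtain B B' where "\<And>x. x \<in> A \<Longrightarrow> cmod (u x) \<le> B" "\<And>x. x \<in> A \<Longrightarrow> cmod (v x) \<le> B'"
    using assms unfolding bounded_iff by blast
  then have "cmod (\<alpha> * u x + v x) \<le> cmod \<alpha> * B + B'" if "x \<in> A" for x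
    using that by (intro order_trans[OF norm_triangle_ineq] add_mono)
      (auto simp: norm_mult intro: mult_left_mono)
  then show ?thesis by (auto simp: bounded_iff)
qed

section \<open>Sup-norm bounds on edges and vertices\<close>

context equilateral_metric_graph
begin

lemma mg_points_nonempty: "mg_points G \<noteq> {}" and verts_nonempty: "verts G \<noteq> {}"
proof -
  obtain e where "e \<in> arcs G" using has_arc by blast
  then have "tail G e \<in> verts G" by simp
  then show "mg_points G \<noteq> {}" "verts G \<noteq> {}" by (auto simp: mg_points_def)
qed

lemma edge_L1_bounds:
  assumes u: "continuous_on_graph G u" and e: "e \<in> arcs G"
    and B: "\<And>t. t \<in> {0..1} \<Longrightarrow> cmod (u (edge_point G e t)) \<le> B"
  shows "0 \<le> edge_L1 G u e" "edge_L1 G u e \<le> B"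
proof -
  have i: "(\<lambda>t. cmod (u (edge_point G e t))) integrable_on {0..1}"
    using u e unfolding continuous_on_graph_iff
    by (intro integrable_continuous_real continuous_intros) auto
  show "0 \<le> edge_L1 G u e" unfolding edge_L1_def
    by (rule Henstock_Kurzweil_Integration.integral_nonneg[OF i]) simp
  have "edge_L1 G u e \<le> integral {0..1::real} (\<lambda>t. B)"
    unfolding edge_L1_def by (rule integral_le[OF i]) (use B in auto)
  then show "edge_L1 G u e \<le> B" by simp
qed

definition sup_bound :: "('e \<Rightarrow> real) \<Rightarrow> real \<Rightarrow> bool" where
  "sup_bound q b \<longleftrightarrow> 0 \<le> b \<and> (\<forall>e\<in>arcs G. 0 \<le> q e \<and> q e \<le> b)"

definition null_bound :: "('e \<Rightarrow> real) \<Rightarrow> real \<Rightarrow> bool" where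
  "null_bound q b \<longleftrightarrow> sup_bound q b \<and> (\<forall>\<epsilon>>0. finite {e \<in> arcs G. \<epsilon> \<le> q e})"

text \<open>The 2 in the sum is slack, chosen to agree with \<open>vertex_sup_bound\<close>, since
  \<open>space_pair\<close> has a single constant.\<close>

lemma sup_bound_ops:
  "sup_bound q b \<Longrightarrow> 0 \<le> a \<Longrightarrow> sup_bound (\<lambda>e. a * q e) (a * b)"
  "sup_bound q b \<Longrightarrow> sup_bound q' b' \<Longrightarrow> sup_bound (\<lambda>e. q e + q' e) (2 * (b + b'))"
  "sup_bound q 0 \<Longrightarrow> e \<in> arcs G \<Longrightarrow> q e = 0"
  by (force simp: sup_bound_def intro: mult_left_mono)+

lemma edge_L1_sup_bound:
  assumes u: "continuous_on_graph G u" and b: "bounded (u ` mg_points G)"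
  shows "sup_bound (edge_L1 G u) (sup_norm (mg_points G) u)"
  unfolding sup_bound_def
proof (intro conjI ballI sup_norm_nonneg[OF b mg_points_nonempty])
  fix e assume e: "e \<in> arcs G"
  have "cmod (u (edge_point G e t)) \<le> sup_norm (mg_points G) u" for t
    by (rule sup_norm_upper[OF b edge_point_mg[OF e]])
  from edge_L1_bounds[OF u e this]
  show "0 \<le> edge_L1 G u e" "edge_L1 G u e \<le> sup_norm (mg_points G) u" .
qed

lemma vertex_sup_bound:
  assumes "bounded (z ` verts G)"
  shows "sup_bound (\<lambda>e. cmod (z (tail G e)) + cmod (z (head G e))) (2 * sup_norm (verts G) z)"
  unfolding sup_bound_def
proof (intro conjI ballI)
  show "0 \<le> 2 * sup_norm (verts G) z" using sup_norm_nonneg[OF assms verts_nonempty] by simp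
  fix e assume "e \<in> arcs G"
  then show "cmod (z (tail G e)) + cmod (z (head G e)) \<le> 2 * sup_norm (verts G) z"
    using sup_norm_upper[OF assms, of "tail G e"] sup_norm_upper[OF assms, of "head G e"] by simp
qed simp

lemma sup_bound_edgewise:
  assumes q: "sup_bound q b"
    and u: "\<And>e t. e \<in> arcs G \<Longrightarrow> t \<in> {0..1} \<Longrightarrow> cmod (u (edge_point G e t)) \<le> q e"
  shows "bounded (u ` mg_points G)" "sup_norm (mg_points G) u \<le> b"
proof -
  have le: "cmod (u x) \<le> b" if x: "x \<in> mg_points G" for x
  proof -
    obtain e t where "e \<in> arcs G" "t \<in> {0..1}" "x = edge_point G e t" by (rule mg_points_edge[OF x])
    then show ?thesis using u[of e t] q unfolding sup_bound_def by fastforce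
  qed
  then show "bounded (u ` mg_points G)" by (auto simp: bounded_iff)
  show "sup_norm (mg_points G) u \<le> b" by (rule sup_norm_least[OF mg_points_nonempty le])
qed

text \<open>If all terms were smaller than \<open>x\<close>, so would be their weighted mean. This
  replaces Jensen's inequality for the sup norms.\<close>

lemma weighted_sum_less:
  assumes v: "v \<in> verts G" and z: "x * vertex_weight G c v \<le> (\<Sum>e\<in>inc_arcs G v. c e * q e)"
  obtains e where "e \<in> inc_arcs G v" "x \<le> q e"
proof (rule ccontr)
  note edge = that
  assume "\<not> thesis"
  then have "q e < x" if "e \<in> inc_arcs G v" for e using edge[OF that] by force
  then have "(\<Sum>e\<in>inc_arcs G v. c e * q e) < (\<Sum>e\<in>inc_arcs G v. c e * x)"
    using inc_arcs_nonempty[OF v] finite_inc_arcs[OF v]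
    by (intro sum_strict_mono mult_strict_left_mono) (auto dest: inc_arcsD intro: conductivity_pos)
  also have "\<dots> = x * vertex_weight G c v" by (simp add: vertex_weight_def sum_distrib_left mult.commute)
  finally show False using z by simp
qed

lemma sup_bound_vertex:
  assumes q: "sup_bound q b"
    and z: "\<And>v. v \<in> verts G \<Longrightarrow> cmod (z v) * vertex_weight G c v \<le> (\<Sum>e\<in>inc_arcs G v. c e * q e)"
  shows "bounded (z ` verts G)" "sup_norm (verts G) z \<le> b"
proof -
  have le: "cmod (z v) \<le> b" if v: "v \<in> verts G" for v
  proof -
    obtain e where "e \<in> inc_arcs G v" "cmod (z v) \<le> q e" by (rule weighted_sum_less[OF v z[OF v]])
    then show ?thesis using q inc_arcsD unfolding sup_bound_def by fastforce
  qed
  then show "bounded (z ` verts G)" by (auto simp: bounded_iff)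
  show "sup_norm (verts G) z \<le> b" by (rule sup_norm_least[OF verts_nonempty le])
qed

lemma edge_Lipschitz_continuous:
  assumes "\<And>e s t. e \<in> arcs G \<Longrightarrow> s \<in> {0..1} \<Longrightarrow> t \<in> {0..1} \<Longrightarrow>
      cmod (u (edge_point G e s) - u (edge_point G e t)) \<le> q e * \<bar>s - t\<bar>"
  shows "continuous_on_graph G u"
  unfolding continuous_on_graph_iff using assms by (blast intro: continuous_on_Lipschitz)

lemma continuous_edge_integrable:
  "continuous_on_graph G u \<Longrightarrow> e \<in> arcs G \<Longrightarrow>
    (\<lambda>t. u (edge_point G e t)) absolutely_integrable_on {0..1}"
  unfolding continuous_on_graph_iff by (intro absolutely_integrable_continuous_real) auto

lemma continuous_on_graph_lincomb:
  assumes "continuous_on_graph G u" "continuous_on_graph G v"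
  shows "continuous_on_graph G (\<lambda>x. \<alpha> * u x + v x)"
  using assms unfolding continuous_on_graph_iff by (auto intro!: continuous_intros)

section \<open>Bounded uniformly continuous functions\<close>

lemma BUC_iff:
  "u \<in> fst (BUC_graph_space G) \<longleftrightarrow> bounded (u ` mg_points G) \<and>
    (\<forall>\<epsilon>>0. \<exists>\<delta>>0. \<forall>x\<in>mg_points G. \<forall>y\<in>mg_points G.
       mg_dist G y x < \<delta> \<longrightarrow> cmod (u y - u x) < \<epsilon>)"
  by (simp add: BUC_graph_space_def uniformly_continuous_map_def dist_norm)

lemma BUC_continuous: "u \<in> fst (BUC_graph_space G) \<Longrightarrow> continuous_on_graph G u"
  using uniformly_continuous_imp_continuous_map
  by (fastforce simp: BUC_graph_space_def continuous_on_graph_def)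

lemma space_pair_BUC:
  "space_pair G c (fst (BUC_graph_space G)) (snd (BUC_graph_space G))
    (fst (linf_vertex_space G)) (snd (linf_vertex_space G)) sup_bound 2"
proof (unfold_locales, goal_cases)
  case 1 show ?case by simp
next
  case (2 u v \<alpha>)
  show ?case unfolding BUC_iff
  proof (intro conjI allI impI)
    show "bounded ((\<lambda>x. \<alpha> * u x + v x) ` mg_points G)"
      using 2 by (intro bounded_lincomb) (auto simp: BUC_iff)
    fix \<epsilon> :: real assume \<epsilon>: "0 < \<epsilon>"
    \<comment> \<open>The added 1 allows \<alpha> = 0 and keeps the product with
      \<open>cmod \<alpha>\<close> strictly below \<epsilon> / 2.\<close>
    define \<eta> where "\<eta> = \<epsilon> / (2 * (cmod \<alpha> + 1))"
    have \<eta>: "0 < \<eta>" "cmod \<alpha> * \<eta> < \<epsilon> / 2"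
      using \<epsilon> by (auto simp: \<eta>_def field_simps add_pos_nonneg)
    obtain \<delta> where \<delta>: "\<delta> > 0" "\<And>x y. x \<in> mg_points G \<Longrightarrow> y \<in> mg_points G \<Longrightarrow>
        mg_dist G y x < \<delta> \<Longrightarrow> cmod (u y - u x) < \<eta>" using 2(1) \<eta>(1) unfolding BUC_iff by blast
    obtain \<delta>' where \<delta>': "\<delta>' > 0" "\<And>x y. x \<in> mg_points G \<Longrightarrow> y \<in> mg_points G \<Longrightarrow>
        mg_dist G y x < \<delta>' \<Longrightarrow> cmod (v y - v x) < \<epsilon> / 2"
      using 2(2) half_gt_zero[OF \<epsilon>] unfolding BUC_iff by blast
    have "cmod ((\<alpha> * u y + v y) - (\<alpha> * u x + v x)) < \<epsilon>"
      if "x \<in> mg_points G" "y \<in> mg_points G" "mg_dist G y x < min \<delta> \<delta>'" for x y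
    proof -
      have "(\<alpha> * u y + v y) - (\<alpha> * u x + v x) = \<alpha> * (u y - u x) + (v y - v x)"
        by (simp add: algebra_simps)
      then have "cmod ((\<alpha> * u y + v y) - (\<alpha> * u x + v x)) \<le> cmod \<alpha> * cmod (u y - u x) + cmod (v y - v x)"
        by (metis norm_mult norm_triangle_ineq)
      moreover have "cmod \<alpha> * cmod (u y - u x) \<le> cmod \<alpha> * \<eta>"
        using \<delta>(2)[OF that(1,2)] that(3) by (intro mult_left_mono) auto
      moreover have "cmod (v y - v x) < \<epsilon> / 2" using \<delta>'(2) that by auto
      ultimately show ?thesis using \<eta>(2) by linarith
    qed
    then show "\<exists>\<delta>>0. \<forall>x\<in>mg_points G. \<forall>y\<in>mg_points G. mg_dist G y x < \<delta> \<longrightarrow>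
        cmod ((\<alpha> * u y + v y) - (\<alpha> * u x + v x)) < \<epsilon>"
      using \<delta>(1) \<delta>'(1) by (intro exI[of _ "min \<delta> \<delta>'"]) auto
  qed
next
  case (3 u e) then show ?case by (intro continuous_edge_integrable BUC_continuous)
next
  case (4 u) then show ?case
    using sup_norm_nonneg[OF _ mg_points_nonempty] by (auto simp: BUC_graph_space_def)
next
  case (5 z) then show ?case
    using sup_norm_nonneg[OF _ verts_nonempty] by (auto simp: linf_vertex_space_def)
next
  case (6 u) then show ?case
    using edge_L1_sup_bound[OF BUC_continuous[OF 6]] by (simp add: BUC_graph_space_def)
next
  case (7 z) then show ?case using vertex_sup_bound by (simp add: linf_vertex_space_def)
next
  case 8 show ?case by (simp add: sup_bound_def)
next
  case (9 q b a) then show ?case by (rule sup_bound_ops)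
next
  case (10 q b q' b') then show ?case by (rule sup_bound_ops)
next
  case (11 q e) then show ?case by (rule sup_bound_ops)
next
  case (12 q b u)
  have b: "0 \<le> b" "\<And>e. e \<in> arcs G \<Longrightarrow> q e \<le> b" using 12(1) by (auto simp: sup_bound_def)
  \<comment> \<open>The sup bound serves as a Lipschitz constant common to all edges, hence for the
    path metric; this gives a modulus of continuity that is uniform over the graph.\<close>
  have L: "cmod (u y - u x) \<le> b * mg_dist G y x" if "x \<in> mg_points G" "y \<in> mg_points G" for x y
  proof (rule edgewise_Lipschitz[OF _ that(2,1)])
    fix e and s t :: real assume e: "e \<in> arcs G" "s \<in> {0..1}" "t \<in> {0..1}"
    have "q e * \<bar>s - t\<bar> \<le> b * \<bar>s - t\<bar>" using b(2)[OF e(1)] by (intro mult_right_mono) auto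
    then show "cmod (u (edge_point G e s) - u (edge_point G e t)) \<le> b * \<bar>s - t\<bar>"
      using 12(3)[OF e] by linarith
  qed
  have "\<exists>\<delta>>0. \<forall>x\<in>mg_points G. \<forall>y\<in>mg_points G. mg_dist G y x < \<delta> \<longrightarrow> cmod (u y - u x) < \<epsilon>"
    if \<epsilon>: "0 < \<epsilon>" for \<epsilon>
  proof (intro exI[of _ "\<epsilon> / (b + 1)"] conjI ballI impI)
    show "0 < \<epsilon> / (b + 1)" using \<epsilon> b by simp
    fix x y assume xy: "x \<in> mg_points G" "y \<in> mg_points G" "mg_dist G y x < \<epsilon> / (b + 1)"
    have "b * mg_dist G y x \<le> b * (\<epsilon> / (b + 1))" using xy b by (intro mult_left_mono) auto
    also have "\<dots> < \<epsilon>" using \<epsilon> b by (simp add: field_simps)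
    finally show "cmod (u y - u x) < \<epsilon>" using L[OF xy(1,2)] by linarith
  qed
  then have "u \<in> fst (BUC_graph_space G)"
    using sup_bound_edgewise(1)[OF 12(1,2)] by (simp add: BUC_iff)
  then show ?case using sup_bound_edgewise(2)[OF 12(1,2)] b by (simp add: BUC_graph_space_def)
next
  case (13 q b z)
  have "0 \<le> b" using 13(1) by (simp add: sup_bound_def)
  then show ?case using sup_bound_vertex[OF 13] by (simp add: linf_vertex_space_def)
qed

section \<open>Continuous functions vanishing at infinity\<close>

lemma C0_iff:
  "u \<in> fst (C0_graph_space G) \<longleftrightarrow> continuous_on_graph G u \<and>
    (\<forall>\<epsilon>>0. finite {e \<in> arcs G. \<exists>t\<in>{0..1}. \<epsilon> \<le> cmod (u (edge_point G e t))})"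
proof -
  let ?L = "\<lambda>\<epsilon>. {e \<in> arcs G. \<exists>t\<in>{0..1}. \<epsilon> \<le> cmod (u (edge_point G e t))}"
  have "(\<exists>K. compactin (mtopology_of (mg_metric G)) K \<and> (\<forall>x\<in>mg_points G - K. cmod (u x) < \<epsilon>))
      \<longleftrightarrow> finite (?L \<epsilon>)" (is "?l = ?r") for \<epsilon>
  proof
    assume ?l
    then obtain K where K: "compactin (mtopology_of (mg_metric G)) K"
      "\<And>x. x \<in> mg_points G - K \<Longrightarrow> cmod (u x) < \<epsilon>" by blast
    obtain F where F: "finite F" "F \<subseteq> arcs G" "K \<subseteq> (\<Union>e\<in>F. edge_point G e ` {0..1})"
      by (rule compactin_finite_edges[OF K(1)])
    \<comment> \<open>A large value at a vertex belongs to all its edges, including edges outside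
      \<open>F\<close>; hence the neighbouring edges are added.\<close>
    have "?L \<epsilon> \<subseteq> (\<Union>e\<in>F. inc_arcs G (tail G e) \<union> inc_arcs G (head G e))"
    proof
      fix e assume "e \<in> ?L \<epsilon>"
      then obtain t where e: "e \<in> arcs G" and t: "t \<in> {0..1}" "\<epsilon> \<le> cmod (u (edge_point G e t))" by blast
      then have "edge_point G e t \<in> K" using K(2)[of "edge_point G e t"] by fastforce
      then obtain e' t' where e': "e' \<in> F" "edge_point G e t = edge_point G e' t'" using F(3) by blast
      then have "e \<in> inc_arcs G (tail G e') \<union> inc_arcs G (head G e')"
        using e by (auto simp: edge_point_def inc_arcs_iff split: if_splits)
      with e'(1) show "e \<in> (\<Union>e\<in>F. inc_arcs G (tail G e) \<union> inc_arcs G (head G e))" by blast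
    qed
    moreover have "finite (\<Union>e\<in>F. inc_arcs G (tail G e) \<union> inc_arcs G (head G e))"
      using F by (auto intro!: finite_inc_arcs)
    ultimately show ?r by (rule finite_subset)
  next
    assume r: ?r
    show ?l
    proof (intro exI conjI ballI)
      show "compactin (mtopology_of (mg_metric G)) (\<Union>e\<in>?L \<epsilon>. edge_point G e ` {0..1})"
        by (rule finite_edges_compactin[OF r]) auto
      fix x assume x: "x \<in> mg_points G - (\<Union>e\<in>?L \<epsilon>. edge_point G e ` {0..1})"
      then have "x \<in> mg_points G" by simp
      then obtain e t where et: "e \<in> arcs G" "t \<in> {0..1}" "x = edge_point G e t" by (rule mg_points_edge)
      then have "e \<notin> ?L \<epsilon>" using x by blast
      then show "cmod (u x) < \<epsilon>" using et by force
    qed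
  qed
  then show ?thesis by (simp add: C0_graph_space_def)
qed

text \<open>Values of modulus at least 1 occur on finitely many edges, each of them compact.\<close>

lemma C0_bounded:
  assumes u: "u \<in> fst (C0_graph_space G)"
  shows "bounded (u ` mg_points G)"
proof -
  let ?F = "{e \<in> arcs G. \<exists>t\<in>{0..1}. 1 \<le> cmod (u (edge_point G e t))}"
  have fin: "finite ?F" and cont: "continuous_on_graph G u" using u by (auto simp: C0_iff)
  have "u ` mg_points G \<subseteq> (\<Union>e\<in>?F. (\<lambda>t. u (edge_point G e t)) ` {0..1}) \<union> cball 0 1"
  proof
    fix y assume "y \<in> u ` mg_points G"
    then obtain x where x: "x \<in> mg_points G" "y = u x" by blast
    obtain e t where et: "e \<in> arcs G" "t \<in> {0..1}" "x = edge_point G e t" by (rule mg_points_edge[OF x(1)])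
    show "y \<in> (\<Union>e\<in>?F. (\<lambda>t. u (edge_point G e t)) ` {0..1}) \<union> cball 0 1"
    proof (cases "e \<in> ?F")
      case False
      then have "cmod y \<le> 1" using et x by force
      then show ?thesis by simp
    qed (use et x in blast)
  qed
  moreover have "bounded ((\<Union>e\<in>?F. (\<lambda>t. u (edge_point G e t)) ` {0..1}) \<union> cball 0 1)"
    using cont fin unfolding continuous_on_graph_iff
    by (auto intro!: bounded_UN compact_imp_bounded compact_continuous_image)
  ultimately show ?thesis by (rule bounded_subset[rotated])
qed

lemma c0_bounded:
  assumes z: "z \<in> fst (c0_vertex_space G)"
  shows "bounded (z ` verts G)"
proof -
  have "finite {v \<in> verts G. 1 \<le> cmod (z v)}" using z by (simp add: c0_vertex_space_def)
  then have "bounded (z ` {v \<in> verts G. 1 \<le> cmod (z v)} \<union> cball 0 1)"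
    by (simp add: finite_imp_bounded)
  then show ?thesis by (rule bounded_subset) force
qed

lemma space_pair_C0:
  "space_pair G c (fst (C0_graph_space G)) (snd (C0_graph_space G))
    (fst (c0_vertex_space G)) (snd (c0_vertex_space G)) null_bound 2"
proof (unfold_locales, goal_cases)
  case 1 show ?case by simp
next
  case (2 u v \<alpha>)
  let ?L = "\<lambda>u \<epsilon>. {e \<in> arcs G. \<exists>t\<in>{0..1}. \<epsilon> \<le> cmod (u (edge_point G e t) :: complex)}"
  have "finite (?L (\<lambda>x. \<alpha> * u x + v x) \<epsilon>)" if \<epsilon>: "0 < \<epsilon>" for \<epsilon>
  proof -
    define \<eta> where "\<eta> = \<epsilon> / (2 * (cmod \<alpha> + 1))"
    have \<eta>: "0 < \<eta>" "cmod \<alpha> * \<eta> < \<epsilon> / 2"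
      using \<epsilon> by (auto simp: \<eta>_def field_simps add_pos_nonneg)
    have "?L (\<lambda>x. \<alpha> * u x + v x) \<epsilon> \<subseteq> ?L u \<eta> \<union> ?L v (\<epsilon> / 2)"
    proof (rule subsetI, rule ccontr)
      fix e assume e: "e \<in> ?L (\<lambda>x. \<alpha> * u x + v x) \<epsilon>" "e \<notin> ?L u \<eta> \<union> ?L v (\<epsilon> / 2)"
      then obtain t where t: "t \<in> {0..1}" "\<epsilon> \<le> cmod (\<alpha> * u (edge_point G e t) + v (edge_point G e t))"
        by blast
      then have lt: "cmod (u (edge_point G e t)) < \<eta>" "cmod (v (edge_point G e t)) < \<epsilon> / 2"
        using e by force+
      have "cmod (\<alpha> * u (edge_point G e t) + v (edge_point G e t)) \<le>
          cmod \<alpha> * cmod (u (edge_point G e t)) + cmod (v (edge_point G e t))"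
        by (metis norm_mult norm_triangle_ineq)
      moreover have "cmod \<alpha> * cmod (u (edge_point G e t)) \<le> cmod \<alpha> * \<eta>"
        using lt(1) by (intro mult_left_mono) auto
      ultimately show False using t(2) lt(2) \<eta>(2) by linarith
    qed
    moreover have "finite (?L u \<eta> \<union> ?L v (\<epsilon> / 2))" using 2 half_gt_zero[OF \<epsilon>] \<eta>(1) unfolding C0_iff by blast
    ultimately show ?thesis by (rule finite_subset)
  qed
  then show ?case using 2 continuous_on_graph_lincomb by (simp add: C0_iff)
next
  case (3 u e) then show ?case by (intro continuous_edge_integrable) (auto simp: C0_iff)
next
  case (4 u) then show ?case
    using sup_norm_nonneg[OF C0_bounded mg_points_nonempty] by (simp add: C0_graph_space_def)
next
  case (5 z) then show ?case
    using sup_norm_nonneg[OF c0_bounded verts_nonempty] by (simp add: c0_vertex_space_def)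
next
  case (6 u)
  then have cont: "continuous_on_graph G u" by (simp add: C0_iff)
  have "finite {e \<in> arcs G. \<epsilon> \<le> edge_L1 G u e}" if \<epsilon>: "0 < \<epsilon>" for \<epsilon>
  \<comment> \<open>Halving \<epsilon> gives strictness: values below \<epsilon> / 2 along an edge
    keep its integral below \<epsilon>.\<close>
  proof (rule finite_subset)
    show "finite {e \<in> arcs G. \<exists>t\<in>{0..1}. \<epsilon> / 2 \<le> cmod (u (edge_point G e t))}"
      using 6 half_gt_zero[OF \<epsilon>] unfolding C0_iff by blast
    show "{e \<in> arcs G. \<epsilon> \<le> edge_L1 G u e} \<subseteq>
        {e \<in> arcs G. \<exists>t\<in>{0..1}. \<epsilon> / 2 \<le> cmod (u (edge_point G e t))}"
    proof (rule subsetI, rule ccontr)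
      fix e assume e: "e \<in> {e \<in> arcs G. \<epsilon> \<le> edge_L1 G u e}"
        "e \<notin> {e \<in> arcs G. \<exists>t\<in>{0..1}. \<epsilon> / 2 \<le> cmod (u (edge_point G e t))}"
      then have "edge_L1 G u e \<le> \<epsilon> / 2"
        by (intro edge_L1_bounds(2)[OF cont]) force+
      then show False using e(1) \<epsilon> by simp
    qed
  qed
  then show ?case
    using edge_L1_sup_bound[OF cont C0_bounded[OF 6]] by (simp add: null_bound_def C0_graph_space_def)
next
  case (7 z)
  have "finite {e \<in> arcs G. \<epsilon> \<le> cmod (z (tail G e)) + cmod (z (head G e))}" if \<epsilon>: "0 < \<epsilon>" for \<epsilon>
  proof (rule finite_subset)
    let ?V = "{v \<in> verts G. \<epsilon> / 2 \<le> cmod (z v)}"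
    have "finite ?V" using 7 half_gt_zero[OF \<epsilon>] unfolding c0_vertex_space_def fst_conv by blast
    then show "finite (\<Union>v\<in>?V. inc_arcs G v)" by (auto intro: finite_inc_arcs)
    show "{e \<in> arcs G. \<epsilon> \<le> cmod (z (tail G e)) + cmod (z (head G e))} \<subseteq> (\<Union>v\<in>?V. inc_arcs G v)"
    proof
      fix e assume "e \<in> {e \<in> arcs G. \<epsilon> \<le> cmod (z (tail G e)) + cmod (z (head G e))}"
      then have e: "e \<in> arcs G" "\<epsilon> / 2 \<le> cmod (z (tail G e)) \<or> \<epsilon> / 2 \<le> cmod (z (head G e))" by auto
      moreover have "e \<in> inc_arcs G (tail G e)" "e \<in> inc_arcs G (head G e)"
        using e(1) by (simp_all add: inc_arcs_iff)
      moreover have "tail G e \<in> verts G" "head G e \<in> verts G" using e(1) by simp_all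
      ultimately show "e \<in> (\<Union>v\<in>?V. inc_arcs G v)" by blast
    qed
  qed
  then show ?case
    using vertex_sup_bound[OF c0_bounded[OF 7]] by (simp add: null_bound_def c0_vertex_space_def)
next
  case 8 show ?case by (simp add: null_bound_def sup_bound_def)
next
  case (9 q b a)
  have "finite {e \<in> arcs G. \<epsilon> \<le> a * q e}" if \<epsilon>: "0 < \<epsilon>" for \<epsilon>
  proof (cases "a = 0")
    case False
    then have "{e \<in> arcs G. \<epsilon> \<le> a * q e} = {e \<in> arcs G. \<epsilon> / a \<le> q e}"
      using 9(2) by (auto simp: field_simps)
    then show ?thesis using 9 False \<epsilon> by (simp add: null_bound_def)
  qed (use \<epsilon> in auto)
  then show ?case using 9 sup_bound_ops(1) by (simp add: null_bound_def)
next
  case (10 q b q' b')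
  have "finite {e \<in> arcs G. \<epsilon> \<le> q e + q' e}" if \<epsilon>: "0 < \<epsilon>" for \<epsilon>
  proof (rule finite_subset)
    show "finite ({e \<in> arcs G. \<epsilon> / 2 \<le> q e} \<union> {e \<in> arcs G. \<epsilon> / 2 \<le> q' e})"
      using 10 half_gt_zero[OF \<epsilon>] unfolding null_bound_def by blast
  qed auto
  then show ?case using 10 sup_bound_ops(2) by (simp add: null_bound_def)
next
  case (11 q e) then show ?case using sup_bound_ops(3) by (simp add: null_bound_def)
next
  case (12 q b u)
  have q: "sup_bound q b" "\<And>\<epsilon>. 0 < \<epsilon> \<Longrightarrow> finite {e \<in> arcs G. \<epsilon> \<le> q e}"
    using 12(1) by (auto simp: null_bound_def)
  have "finite {e \<in> arcs G. \<exists>t\<in>{0..1}. \<epsilon> \<le> cmod (u (edge_point G e t))}" if \<epsilon>: "0 < \<epsilon>" for \<epsilon>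
    using 12(2) by (intro finite_subset[OF _ q(2)[OF \<epsilon>]]) force
  then have "u \<in> fst (C0_graph_space G)"
    using edge_Lipschitz_continuous[OF 12(3)] by (simp add: C0_iff)
  moreover have "sup_norm (mg_points G) u \<le> 2 * b"
    using sup_bound_edgewise(2)[OF q(1) 12(2)] q(1) by (simp add: sup_bound_def)
  ultimately show ?case by (simp add: C0_graph_space_def)
next
  case (13 q b z)
  have q: "sup_bound q b" "\<And>\<epsilon>. 0 < \<epsilon> \<Longrightarrow> finite {e \<in> arcs G. \<epsilon> \<le> q e}"
    using 13(1) by (auto simp: null_bound_def)
  have "finite {v \<in> verts G. \<epsilon> \<le> cmod (z v)}" if \<epsilon>: "0 < \<epsilon>" for \<epsilon>
  proof (rule finite_subset)
    let ?F = "{e \<in> arcs G. \<epsilon> \<le> q e}"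
    show "finite (tail G ` ?F \<union> head G ` ?F)" using q(2)[OF \<epsilon>] by simp
    show "{v \<in> verts G. \<epsilon> \<le> cmod (z v)} \<subseteq> tail G ` ?F \<union> head G ` ?F"
    proof
      fix v assume v: "v \<in> {v \<in> verts G. \<epsilon> \<le> cmod (z v)}"
      then have "v \<in> verts G" by simp
      then obtain e where "e \<in> inc_arcs G v" "cmod (z v) \<le> q e"
        using weighted_sum_less[OF _ 13(2)] by metis
      then show "v \<in> tail G ` ?F \<union> head G ` ?F" using v by (auto simp: inc_arcs_iff)
    qed
  qed
  moreover have "sup_norm (verts G) z \<le> 2 * b"
    using sup_bound_vertex(2)[OF q(1) 13(2)] q(1) by (simp add: sup_bound_def)
  ultimately show ?case by (simp add: c0_vertex_space_def)
qed

end

section \<open>Spectra\<close>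

text \<open>\<open>S\<close> itself is an eigenfunction: it vanishes at both ends, and it is not
  null because its slope at 0 is 1.\<close>

lemma sin_fun_zero_imp_dirichlet_spectrum:
  assumes 0: "sin_fun \<mu> 1 = 0"
  shows "\<mu> \<in> spectrum L2_interval_space (neg_oper dirichlet_laplacian)"
proof (rule ccontr)
  assume "\<not> ?thesis"
  then have res: "\<mu> \<in> resolvent_set L2_interval_space (neg_oper dirichlet_laplacian)"
    by (simp add: spectrum_def)
  let ?w = "sin_fun \<mu>" and ?g = "\<lambda>t. - \<mu> * sin_fun \<mu> t"
  have L2: "Lp_interval 2 f" if f: "continuous_on {0..1} f" for f
  proof -
    obtain B where "B > 0" "\<And>t. t \<in> {0..1} \<Longrightarrow> cmod (f t) \<le> B"
      using bounded_on_unit[OF f] by blast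
    then show ?thesis
      by (intro Lp_interval_continuous[of f B] continuous_on_subset[OF f]) auto
  qed
  have "cos_fun \<mu> t - cos_fun \<mu> s = integral {s..t} ?g" if "s \<le> t" for s t
    using fundamental_theorem_of_calculus[OF that cos_fun_has_vector_derivative[of \<mu>]]
    by (rule integral_unique[symmetric])
  then have "has_second_deriv ?w ?g"
    unfolding has_second_deriv_def
    by (auto simp: vector_derivative_at[OF sin_fun_has_vector_derivative]
        intro: differentiableI_vector[OF sin_fun_has_vector_derivative]
        intro!: absolutely_integrable_continuous_real continuous_intros)
  then have "(?w, ?g) \<in> dirichlet_laplacian"
    unfolding dirichlet_laplacian_def using 0 by (auto intro!: L2 continuous_intros)
  then have "(?w, \<lambda>t. - ?g t) \<in> neg_oper dirichlet_laplacian"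
    unfolding neg_oper_def by (intro CollectI exI[of _ ?w] exI[of _ ?g] conjI HOL.refl)
  moreover have "sqrt (Lp_integral 2 (\<lambda>t. \<mu> * ?w t - - ?g t)) = 0"
    by (simp add: Lp_integral_def set_lebesgue_integral_def)
  ultimately have "sqrt (Lp_integral 2 ?w) = 0"
    using res unfolding resolvent_set_def L2_interval_space_def prod.case mem_Collect_eq
    by (elim conjE) (drule (1) bspec, simp)
  \<comment> \<open>A vanishing \<open>L^2\<close> norm forces a vanishing \<open>L^1\<close> norm,
    and continuity then forces \<open>S\<close> to vanish everywhere on the interval.\<close>
  then have "integral {0..1} (\<lambda>t. cmod (?w t)) powr 2 \<le> 0"
    using Lp_interval_L1(2)[OF _ L2[OF continuous_on_sin_fun[of _ \<mu>]]] by simp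
  then have "integral {0..1} (\<lambda>t. cmod (?w t)) = 0" by simp
  moreover have "continuous_on {0..1} (\<lambda>t. cmod (?w t))" by (intro continuous_intros)
  ultimately have z: "?w t = 0" if "t \<in> {0..1}" for t
    using integral_eq_0_iff[of 0 1 "\<lambda>t. cmod (?w t)"] that by simp
  have "cos_fun \<mu> 0 = 0"
  proof (rule vector_derivative_unique_within_closed_interval[of 0 1 0 ?w])
    show "(?w has_vector_derivative cos_fun \<mu> 0) (at 0 within cbox 0 1)"
      by (rule sin_fun_has_vector_derivative)
    show "(?w has_vector_derivative 0) (at 0 within cbox 0 1)"
      by (rule has_vector_derivative_transform[of 0 "cbox 0 1" ?w "\<lambda>_. 0"]) (use z in auto)
  qed auto
  then show False by simp
qed

lemma resolvent_iff:
  assumes "space_pair G c (fst Xc) (snd Xc) (fst Xd) (snd Xd) Q K" and "sin_fun \<mu> 1 \<noteq> 0"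
  shows "\<mu> \<in> resolvent_set Xc (neg_oper (laplacian G c Xc)) \<longleftrightarrow>
    cos_fun \<mu> 1 \<in> resolvent_set Xd (transition_operator G c Xd)"
proof -
  interpret space_pair_at G c "fst Xc" "snd Xc" "fst Xd" "snd Xd" Q K \<mu>
    using assms by (intro space_pair_at.intro regular_value.intro)
  show ?thesis using resolvent_correspondence by simp
qed

theorem theorem5:
  fixes G :: "('v, 'e) pre_digraph" and c :: "'e \<Rightarrow> real"
    and Xc :: "('v, 'e) mg_point fspace" and Xd :: "'v fspace"
  assumes "equilateral_metric_graph G c"
    and "growth_condition G c"
    and "(Xc, Xd) \<in> corresponding_spaces G c"
  shows "spectrum Xc (neg_oper (laplacian G c Xc)) -
      (point_spectrum Xc (neg_oper (laplacian G c Xc)) \<union>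
       spectrum L2_interval_space (neg_oper dirichlet_laplacian)) =
    {\<mu>. \<mu> \<notin> point_spectrum Xc (neg_oper (laplacian G c Xc)) \<union>
             spectrum L2_interval_space (neg_oper dirichlet_laplacian) \<and>
         cos_fun \<mu> 1 \<in> spectrum Xd (transition_operator G c Xd)}"
proof -
  interpret equilateral_metric_graph G c by (rule assms(1))
  obtain Q K where "space_pair G c (fst Xc) (snd Xc) (fst Xd) (snd Xd) Q K"
    using assms(3) space_pair_Lp space_pair_C0 space_pair_BUC
    unfolding corresponding_spaces_def by auto
  \<comment> \<open>Off the Dirichlet spectrum \<open>S 1\<close> is nonzero, so the equivalence of
    the resolvent conditions applies; taking complements gives the spectra.\<close>
  then show ?thesis
    using resolvent_iff sin_fun_zero_imp_dirichlet_spectrum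
    unfolding spectrum_def by blast
qed

end
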